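(* Let $\alpha\in(0,2]$ and $N>\alpha$. Suppose that $(V_\alpha2)$, $(\Gamma)$ and (F1)--(F4) (listed in the context) are satisfied. Then the equation $$(-\Delta)^{\alpha/2}u+V(x)u=f(x,u)-\Gamma(x)|u|^{q-2}u\quad\text{on }\mathbb{R}^N$$ has a ground state, i.e. there is a nontrivial critical point $u\in E^{\alpha/2}$ of $\mathcal{J}$ such that $\mathcal{J}(u)=\inf_{\mathcal{N}}\mathcal{J}$.
   Context: Functions are real-valued. $\mathcal{F}u(\xi)=\hat u(\xi)=(2\pi)^{-N/2}\int_{\mathbb{R}^N}e^{-i\xi\cdot x}u(x)\,dx$ is the Fourier transform and $(-\Delta)^{\alpha/2}$ is defined by $\mathcal{F}((-\Delta)^{\alpha/2}u)(\xi)=|\xi|^\alpha\hat u(\xi)$ (the classical $-\Delta$ when $\alpha=2$). Put $2^*_\alpha:=\frac{2N}{N-\alpha}$. Conditions: - (F1) $f:\mathbb{R}^N\times\mathbb{R}\to\mathbb{R}$ is measurable, $\mathbb{Z}^N$-periodic in $x\in\mathbb{R}^N$ and continuous in $u\in\mathbb{R}$ for a.e. $x\in\mathbb{R}^N$, and there are $c>0$ and $2<q<p<2^*_\alpha$ such that $|f(x,u)|\le c(1+|u|^{p-1})$ for all $u\in\mathbb{R}$, $x\in\mathbb{R}^N$. (This $q$ is the exponent in the equation.) - (F2) $f(x,u)=o(|u|)$ uniformly in $x$ as $|u|\to0^+$. - (F3) $F(x,u)/|u|^q\to\infty$ uniformly in $x$ as $|u|\to\infty$, where $F(x,u)=\int_0^u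 f(x,s)\,ds$. - (F4) $u\mapsto f(x,u)/|u|^{q-1}$ is strictly increasing on $(-\infty,0)$ and on $(0,\infty)$. - $(\Gamma)$ $\Gamma\in L^\infty(\mathbb{R}^N)$ is $\mathbb{Z}^N$-periodic and $\Gamma(x)\ge0$ for a.e. $x\in\mathbb{R}^N$. - $(V_\alpha2)$ $V:\mathbb{R}^N\to\mathbb{R}$ is continuous, $\lim_{|x|\to\infty}V(x)=\infty$ and $V_0:=\inf_{x\in\mathbb{R}^N}V(x)>0$. $E^{\alpha/2}:=\{u\in L^2(\mathbb{R}^N):\int_{\mathbb{R}^N}|\xi|^\alpha|\hat u(\xi)|^2\,d\xi+\int_{\mathbb{R}^N}V(x)|u|^2\,dx<\infty\}$ is a Hilbert space with norm $\|u\|^2:=\int_{\mathbb{R}^N}|\xi|^\alpha|\hat u(\xi)|^2\,d\xi+\int_{\mathbb{R}^N}V(x)|u|^2\,dx$. The energy functional $\mathcal{J}:E^{\alpha/2}\to\mathbb{R}$, of class $C^1$, is $$\mathcal{J}(u)=\tfrac12\|u\|^2-\int_{\mathbb{R}^N}\Big(F(x,u(x))-\tfrac1q\Gamma(x)|u(x)|^q\Big)dx,$$ and the Nehari manifold is $\mathcal{N}:=\{u\in E^{\alpha/2}\setminus\{0\}:\mathcal{J}'(u)(u)=0\}$. *)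

theory Defs
  imports "HOL-Analysis.Analysis"
begin

(* Elements of function spaces are represented by Lebesgue measurable functions on real ^ 'n,
   identified when they agree almost everywhere; the dimension N is CARD('n). *)

definition fourier_integral :: "(real ^ 'n::finite \<Rightarrow> real) \<Rightarrow> real ^ 'n \<Rightarrow> complex" where
  "fourier_integral u \<xi> =
     complex_of_real ((2 * pi) powr (- (real CARD('n) / 2))) *
     (LINT x|lebesgue. exp (- (\<i> * complex_of_real (\<xi> \<bullet> x))) * complex_of_real (u x))"

definition L2 :: "(real ^ 'n::finite \<Rightarrow> real) set" where
  "L2 = {u. u \<in> borel_measurable lebesgue \<and> integrable lebesgue (\<lambda>x. (u x)\<^sup>2)}"

(* The integral need not converge for u in L2, so the transform is extended from integrable
   functions as the L2-limit of the transforms of the truncations of u to balls. *)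
definition is_fourier_transform ::
    "(real ^ 'n::finite \<Rightarrow> real) \<Rightarrow> (real ^ 'n \<Rightarrow> complex) \<Rightarrow> bool" where
  "is_fourier_transform u g \<longleftrightarrow>
     g \<in> borel_measurable lebesgue \<and>
     integrable lebesgue (\<lambda>\<xi>. (cmod (g \<xi>))\<^sup>2) \<and>
     ((\<lambda>R. \<integral>\<^sup>+ \<xi>. ennreal ((cmod (fourier_integral (\<lambda>x. indicator (ball 0 R) x * u x) \<xi> - g \<xi>))\<^sup>2)
            \<partial>lebesgue) \<longlongrightarrow> 0) at_top"

(* For u in L2 such a function exists (Plancherel) and is unique almost everywhere; only
   integrals of the chosen representative are used below. *)
definition fourier :: "(real ^ 'n::finite \<Rightarrow> real) \<Rightarrow> real ^ 'n \<Rightarrow> complex" where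
  "fourier u = (SOME g. is_fourier_transform u g)"

definition energy_space :: "real \<Rightarrow> (real ^ 'n::finite \<Rightarrow> real) \<Rightarrow> (real ^ 'n \<Rightarrow> real) set" where
  "energy_space \<alpha> V = {u \<in> L2.
     integrable lebesgue (\<lambda>\<xi>. norm \<xi> powr \<alpha> * (cmod (fourier u \<xi>))\<^sup>2) \<and>
     integrable lebesgue (\<lambda>x. V x * (u x)\<^sup>2)}"

definition energy_norm ::
    "real \<Rightarrow> (real ^ 'n::finite \<Rightarrow> real) \<Rightarrow> (real ^ 'n \<Rightarrow> real) \<Rightarrow> real" where
  "energy_norm \<alpha> V u =
     sqrt ((LINT \<xi>|lebesgue. norm \<xi> powr \<alpha> * (cmod (fourier u \<xi>))\<^sup>2)
         + (LINT x|lebesgue. V x * (u x)\<^sup>2))"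

(* L is the Frechet derivative of \<Phi> at u on the normed space energy_space \<alpha> V. The set is not
   a type, so the library's has_derivative does not apply. Boundedness makes L invariant under
   almost-everywhere equality; only the values of L on the space are meaningful. *)
definition has_energy_derivative ::
    "real \<Rightarrow> (real ^ 'n::finite \<Rightarrow> real) \<Rightarrow> ((real ^ 'n \<Rightarrow> real) \<Rightarrow> real) \<Rightarrow> (real ^ 'n \<Rightarrow> real)
      \<Rightarrow> ((real ^ 'n \<Rightarrow> real) \<Rightarrow> real) \<Rightarrow> bool" where
  "has_energy_derivative \<alpha> V \<Phi> u L \<longleftrightarrow>
     (\<forall>v\<in>energy_space \<alpha> V. \<forall>w\<in>energy_space \<alpha> V. \<forall>a b.
        L (\<lambda>x. a * v x + b * w x) = a * L v + b * L w) \<and>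
     (\<exists>C. \<forall>v\<in>energy_space \<alpha> V. \<bar>L v\<bar> \<le> C * energy_norm \<alpha> V v) \<and>
     (\<forall>\<epsilon>>0. \<exists>\<delta>>0. \<forall>v\<in>energy_space \<alpha> V. energy_norm \<alpha> V v < \<delta> \<longrightarrow>
        \<bar>\<Phi> (\<lambda>x. u x + v x) - \<Phi> u - L v\<bar> \<le> \<epsilon> * energy_norm \<alpha> V v)"

definition int_vec :: "real ^ 'n::finite \<Rightarrow> bool" where
  "int_vec z \<longleftrightarrow> (\<forall>i. z $ i \<in> \<int>)"

definition primitive :: "(real ^ 'n::finite \<Rightarrow> real \<Rightarrow> real) \<Rightarrow> real ^ 'n \<Rightarrow> real \<Rightarrow> real" where
  "primitive f x u = (LBINT s=ereal 0..ereal u. f x s)"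

definition cond_F1 :: "real \<Rightarrow> real \<Rightarrow> (real ^ 'n::finite \<Rightarrow> real \<Rightarrow> real) \<Rightarrow> bool" where
  "cond_F1 \<alpha> q f \<longleftrightarrow>
     (\<lambda>(x, u). f x u) \<in> borel_measurable lebesgue \<and>
     (\<forall>x z u. int_vec z \<longrightarrow> f (x + z) u = f x u) \<and>
     (AE x in lebesgue. continuous_on UNIV (f x)) \<and>
     (\<exists>c>0. \<exists>p. 2 < q \<and> q < p \<and> p < 2 * real CARD('n) / (real CARD('n) - \<alpha>) \<and>
        (\<forall>x u. \<bar>f x u\<bar> \<le> c * (1 + \<bar>u\<bar> powr (p - 1))))"

definition cond_F2 :: "(real ^ 'n::finite \<Rightarrow> real \<Rightarrow> real) \<Rightarrow> bool" where
  "cond_F2 f \<longleftrightarrow> uniform_limit UNIV (\<lambda>u x. f x u / \<bar>u\<bar>) (\<lambda>x. 0) (at 0)"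

definition cond_F3 :: "real \<Rightarrow> (real ^ 'n::finite \<Rightarrow> real \<Rightarrow> real) \<Rightarrow> bool" where
  "cond_F3 q f \<longleftrightarrow>
     (\<forall>M. \<forall>\<^sub>F u in at_infinity. \<forall>x. M \<le> primitive f x u / \<bar>u\<bar> powr q)"

definition cond_F4 :: "real \<Rightarrow> (real ^ 'n::finite \<Rightarrow> real \<Rightarrow> real) \<Rightarrow> bool" where
  "cond_F4 q f \<longleftrightarrow>
     (\<forall>x. strict_mono_on {..<0} (\<lambda>u. f x u / \<bar>u\<bar> powr (q - 1)) \<and>
          strict_mono_on {0<..} (\<lambda>u. f x u / \<bar>u\<bar> powr (q - 1)))"

definition cond_Gamma :: "(real ^ 'n::finite \<Rightarrow> real) \<Rightarrow> bool" where
  "cond_Gamma \<Gamma> \<longleftrightarrow>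
     \<Gamma> \<in> borel_measurable lebesgue \<and>
     (\<exists>C. AE x in lebesgue. \<bar>\<Gamma> x\<bar> \<le> C) \<and>
     (\<forall>z. int_vec z \<longrightarrow> (AE x in lebesgue. \<Gamma> (x + z) = \<Gamma> x)) \<and>
     (AE x in lebesgue. 0 \<le> \<Gamma> x)"

definition cond_V :: "(real ^ 'n::finite \<Rightarrow> real) \<Rightarrow> bool" where
  "cond_V V \<longleftrightarrow>
     continuous_on UNIV V \<and> filterlim V at_top at_infinity \<and> 0 < (INF x. V x)"

definition energy ::
    "real \<Rightarrow> (real ^ 'n::finite \<Rightarrow> real) \<Rightarrow> (real ^ 'n \<Rightarrow> real \<Rightarrow> real) \<Rightarrow> (real ^ 'n \<Rightarrow> real) \<Rightarrow> real
      \<Rightarrow> (real ^ 'n \<Rightarrow> real) \<Rightarrow> real" where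
  "energy \<alpha> V f \<Gamma> q u =
     (1 / 2) * (energy_norm \<alpha> V u)\<^sup>2
     - (LINT x|lebesgue. primitive f x (u x) - (1 / q) * \<Gamma> x * \<bar>u x\<bar> powr q)"

definition nehari ::
    "real \<Rightarrow> (real ^ 'n::finite \<Rightarrow> real) \<Rightarrow> (real ^ 'n \<Rightarrow> real \<Rightarrow> real) \<Rightarrow> (real ^ 'n \<Rightarrow> real) \<Rightarrow> real
      \<Rightarrow> (real ^ 'n \<Rightarrow> real) set" where
  "nehari \<alpha> V f \<Gamma> q = {u \<in> energy_space \<alpha> V.
     \<not> (AE x in lebesgue. u x = 0) \<and>
     (\<exists>L. has_energy_derivative \<alpha> V (energy \<alpha> V f \<Gamma> q) u L \<and> L u = 0)}"

(* The infimum is taken in the extended reals, so that it has its usual meaning without a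
   separate proof that the functional is bounded below on the Nehari manifold. *)
definition ground_state ::
    "real \<Rightarrow> (real ^ 'n::finite \<Rightarrow> real) \<Rightarrow> (real ^ 'n \<Rightarrow> real \<Rightarrow> real) \<Rightarrow> (real ^ 'n \<Rightarrow> real) \<Rightarrow> real
      \<Rightarrow> (real ^ 'n \<Rightarrow> real) \<Rightarrow> bool" where
  "ground_state \<alpha> V f \<Gamma> q u \<longleftrightarrow>
     u \<in> energy_space \<alpha> V \<and>
     \<not> (AE x in lebesgue. u x = 0) \<and>
     has_energy_derivative \<alpha> V (energy \<alpha> V f \<Gamma> q) u (\<lambda>v. 0) \<and>
     ereal (energy \<alpha> V f \<Gamma> q u) = (INF v\<in>nehari \<alpha> V f \<Gamma> q. ereal (energy \<alpha> V f \<Gamma> q v))"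

end

theory Submission
  imports Defs "HOL-Probability.Characteristic_Functions" "HOL-Complex_Analysis.Great_Picard"
begin

text \<open>
  A ground state is found by minimising the energy over the Nehari manifold, and the three
  ingredients are a compact embedding, the geometry of the rays through the origin, and a
  deformation argument that avoids any manifold structure.

  \<^bold>\<open>Compactness.\<close> The embedding rests on one consequence of
  Plancherel's theorem: the norm of \<open>u (x + h) - u x\<close> in the square mean is at most a constant times
  \<open>norm h powr (\<alpha> / 2)\<close> times the energy norm (\<open>l2_translate_le\<close>). Plancherel's theorem itself comes from
  damping the spectrum with a Gaussian (\<open>Plancherel_integrable\<close>) and is extended from integrable
  functions by completeness (\<open>fourier_props\<close>). By the translation bound, the averages of \<open>u\<close> over
  dyadic cubes of side \<open>2\<close> to the power \<open>- k\<close> converge to \<open>u\<close> at a geometric rate. The increments of these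
  averages are controlled both in the square mean and uniformly, and interpolation sums them in every power
  below the critical exponent (\<open>subcritical_embedding\<close>). Since the averages of a bounded sequence
  are described by countably many bounded numbers and the potential \<open>V\<close> controls the tails, bounded
  sequences in the energy space have subsequences that converge almost everywhere under an integrable majorant of
  their squares and subcritical powers, with the energy norm lower semicontinuous
  (\<open>bounded_sequence_compact\<close>).

  \<^bold>\<open>Rays.\<close> Along a ray the derivative of the energy at \<open>t\<close>, divided by \<open>t powr (q - 1)\<close>, is strictly
  decreasing: the quadratic part gives \<open>t powr (2 - q)\<close> with \<open>q > 2\<close>, and the monotonicity of
  the quotient of \<open>f\<close> by \<open>\<bar>u\<bar> powr (q - 1)\<close> takes care of the rest, the term with \<open>\<Gamma>\<close> being constant.
  It is positive near \<open>0\<close> and negative somewhere, because the primitive of \<open>f\<close> outgrows the power \<open>q\<close>.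
  So every ray meets the Nehari manifold exactly once, at the maximum of the energy on the ray. Integrating the
  monotonicity gives \<open>q * G x s \<le> g x s * s\<close>, hence the energy on the Nehari manifold is at least a
  positive multiple of the squared norm (\<open>nehari_coercive\<close>), and minimising sequences are bounded.

  \<^bold>\<open>Minimisation.\<close> The limit of a minimising sequence is nonzero because the Nehari manifold stays away
  from \<open>0\<close>. Projecting the limit along its ray and comparing with the maximality of the sequence on its own rays
  gives a minimiser (\<open>nehari_minimiser\<close>). If its derivative did not vanish in some direction, pushing a piece of
  its ray in that direction would lower the energy, and the pushed piece would still cross the Nehari manifold
  by the intermediate value theorem (\<open>minimiser_derivative_nonneg\<close>).
\<close>

section \<open>Square-integrable functions\<close>

text \<open>Vector-valued, because both real functions and their complex spectra occur.\<close>

definition sq_int :: "'a measure \<Rightarrow> ('a \<Rightarrow> 'b::{banach,second_countable_topology}) \<Rightarrow> bool" where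
  "sq_int M f \<longleftrightarrow> f \<in> borel_measurable M \<and> integrable M (\<lambda>x. (norm (f x))\<^sup>2)"

definition l2 :: "'a measure \<Rightarrow> ('a \<Rightarrow> 'b::{banach,second_countable_topology}) \<Rightarrow> real" where
  "l2 M f = sqrt (LINT x|M. (norm (f x))\<^sup>2)"

lemma l2_nonneg [simp]: "0 \<le> l2 M f"
  by (simp add: l2_def)

lemma l2_power2: "(l2 M f)\<^sup>2 = (LINT x|M. (norm (f x))\<^sup>2)"
  by (simp add: l2_def)

text \<open>Young's inequality for the mixed term; optimising the parameter yields the triangle inequality.\<close>

lemma norm_add_power2_le:
  fixes a b :: "'a::real_normed_vector"
  assumes "d > 0"
  shows "(norm (a + b))\<^sup>2 \<le> (1 + d) * (norm a)\<^sup>2 + (1 + 1/d) * (norm b)\<^sup>2"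
proof -
  have "(norm (a + b))\<^sup>2 \<le> (norm a + norm b)\<^sup>2"
    by (intro power_mono norm_triangle_ineq) auto
  also have "\<dots> = (norm a)\<^sup>2 + (norm b)\<^sup>2 + 2 * norm a * norm b"
    by (simp add: power2_eq_square algebra_simps)
  also have "2 * norm a * norm b \<le> d * (norm a)\<^sup>2 + (1/d) * (norm b)\<^sup>2"
  proof -
    have "0 \<le> (d * norm a - norm b)\<^sup>2 / d" using assms by simp
    also have "\<dots> = d * (norm a)\<^sup>2 + (1/d) * (norm b)\<^sup>2 - 2 * norm a * norm b"
      using assms by (simp add: power2_eq_square field_simps)
    finally show ?thesis by simp
  qed
  finally show ?thesis by (simp add: algebra_simps)
qed

lemma sq_int_dominated:
  fixes f :: "'a \<Rightarrow> 'b::{banach,second_countable_topology}" and g :: "'a \<Rightarrow> 'c::{banach,second_countable_topology}"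
  assumes "f \<in> borel_measurable M" "sq_int M g" "AE x in M. norm (f x) \<le> C * norm (g x)" "C \<ge> 0"
  shows "sq_int M f" "l2 M f \<le> C * l2 M g"
proof -
  have *: "AE x in M. (norm (f x))\<^sup>2 \<le> C\<^sup>2 * (norm (g x))\<^sup>2"
    using assms(3)
  proof eventually_elim
    case (elim x)
    then have "(norm (f x))\<^sup>2 \<le> (C * norm (g x))\<^sup>2" by (intro power_mono) auto
    then show ?case by (simp add: power_mult_distrib)
  qed
  have ig: "integrable M (\<lambda>x. C\<^sup>2 * (norm (g x))\<^sup>2)" using assms(2) by (auto simp: sq_int_def)
  have int: "integrable M (\<lambda>x. (norm (f x))\<^sup>2)"
    by (rule Bochner_Integration.integrable_bound[OF ig]) (use assms(1) * in auto)
  then show "sq_int M f" using assms(1) by (simp add: sq_int_def)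
  have "(LINT x|M. (norm (f x))\<^sup>2) \<le> (LINT x|M. C\<^sup>2 * (norm (g x))\<^sup>2)"
    by (rule integral_mono_AE[OF int ig *])
  also have "\<dots> = (C * l2 M g)\<^sup>2" by (simp add: power_mult_distrib l2_power2)
  finally show "l2 M f \<le> C * l2 M g"
    unfolding l2_def[of M f] using assms(4) by (intro real_le_lsqrt) (auto intro!: mult_nonneg_nonneg)
qed

lemma sq_int_add:
  assumes "sq_int M f" "sq_int M g" shows "sq_int M (\<lambda>x. f x + g x)"
proof -
  have m: "f \<in> borel_measurable M" "g \<in> borel_measurable M" using assms by (auto simp: sq_int_def)
  have "integrable M (\<lambda>x. 2 * (norm (f x))\<^sup>2 + 2 * (norm (g x))\<^sup>2)"
    using assms by (auto simp: sq_int_def)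
  then have "integrable M (\<lambda>x. (norm (f x + g x))\<^sup>2)"
    by (rule Bochner_Integration.integrable_bound)
      (use m norm_add_power2_le[where d=1] in auto)
  then show ?thesis using m by (auto simp: sq_int_def)
qed

lemma sq_int_scaleR: "sq_int M f \<Longrightarrow> sq_int M (\<lambda>x. c *\<^sub>R f x)"
  by (auto simp: sq_int_def power_mult_distrib)

lemma sq_int_cmult: "sq_int M f \<Longrightarrow> sq_int M (\<lambda>x. c * f x)"
  for f :: "_ \<Rightarrow> 'b::{banach,second_countable_topology,real_normed_div_algebra}"
  by (auto simp: sq_int_def norm_mult power_mult_distrib)

lemma sq_int_diff: "sq_int M f \<Longrightarrow> sq_int M g \<Longrightarrow> sq_int M (\<lambda>x. f x - g x)"
  using sq_int_add[of M f "\<lambda>x. (-1) *\<^sub>R g x"] sq_int_scaleR[of M g "-1"] by simp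

lemma l2_scaleR: "l2 M (\<lambda>x. c *\<^sub>R f x) = \<bar>c\<bar> * l2 M f"
  by (simp add: l2_def power_mult_distrib real_sqrt_mult)

lemma l2_cmult: "l2 M (\<lambda>x. c * f x) = norm c * l2 M f"
  for f :: "_ \<Rightarrow> 'b::{banach,second_countable_topology,real_normed_div_algebra}"
  by (simp add: l2_def power_mult_distrib real_sqrt_mult norm_mult)

lemma l2_cong_AE:
  assumes "f \<in> borel_measurable M" "g \<in> borel_measurable M" "AE x in M. norm (f x) = norm (g x)"
  shows "l2 M f = l2 M g"
proof -
  have "(LINT x|M. (norm (f x))\<^sup>2) = (LINT x|M. (norm (g x))\<^sup>2)"
    by (rule integral_cong_AE) (use assms in auto)
  then show ?thesis by (simp add: l2_def)
qed

lemma l2_triangle: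
  assumes f: "sq_int M f" and g: "sq_int M g"
  shows "l2 M (\<lambda>x. f x + g x) \<le> l2 M f + l2 M g"
proof -
  let ?a = "l2 M f" and ?b = "l2 M g"
  have int: "integrable M (\<lambda>x. (norm (f x))\<^sup>2)" "integrable M (\<lambda>x. (norm (g x))\<^sup>2)"
    "integrable M (\<lambda>x. (norm (f x + g x))\<^sup>2)"
    using f g sq_int_add[OF f g] by (auto simp: sq_int_def)
  have main: "(l2 M (\<lambda>x. f x + g x))\<^sup>2 \<le> (1 + d) * ?a\<^sup>2 + (1 + 1/d) * ?b\<^sup>2" if "d > 0" for d
  proof -
    have "(LINT x|M. (norm (f x + g x))\<^sup>2) \<le> (LINT x|M. (1 + d) * (norm (f x))\<^sup>2 + (1 + 1/d) * (norm (g x))\<^sup>2)"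
      using int norm_add_power2_le[OF that] by (intro integral_mono) auto
    then show ?thesis using int by (simp add: l2_power2)
  qed
  \<comment> \<open>the best choice is the quotient of the two norms; the shift by \<open>e\<close> avoids division by zero\<close>
  have "l2 M (\<lambda>x. f x + g x) \<le> (?a + e) + (?b + e)" if "e > 0" for e
  proof -
    have pos: "?a + e > 0" "?b + e > 0" using that l2_nonneg[of M f] l2_nonneg[of M g] by linarith+
    let ?d = "(?b + e) / (?a + e)"
    have "(l2 M (\<lambda>x. f x + g x))\<^sup>2 \<le> (1 + ?d) * ?a\<^sup>2 + (1 + 1/?d) * ?b\<^sup>2"
      by (rule main) (use pos in simp)
    also have "\<dots> \<le> (1 + ?d) * (?a + e)\<^sup>2 + (1 + 1/?d) * (?b + e)\<^sup>2"
      using pos that by (intro add_mono mult_left_mono power_mono) auto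
    also have "\<dots> = ((?a + e) + (?b + e))\<^sup>2"
    proof -
      have "(1 + B / A) * A\<^sup>2 + (1 + 1 / (B / A)) * B\<^sup>2 = (A + B)\<^sup>2" if "A > 0" "B > 0" for A B :: real
        using that by (simp add: field_simps power2_eq_square)
      from this[OF pos] show ?thesis .
    qed
    finally show ?thesis by (rule power2_le_imp_le) (use pos in auto)
  qed
  from this[of "e/2" for e] have "l2 M (\<lambda>x. f x + g x) \<le> ?a + ?b + e" if "e > 0" for e
    using that by fastforce
  then show ?thesis by (rule field_le_epsilon)
qed

lemma l2_minus_commute: "l2 M (\<lambda>x. f x - g x) = l2 M (\<lambda>x. g x - f x)"
  by (simp add: l2_def norm_minus_commute)

lemma l2_triangle_diff:
  assumes "sq_int M f" "sq_int M g" "sq_int M h"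
  shows "l2 M (\<lambda>x. f x - h x) \<le> l2 M (\<lambda>x. f x - g x) + l2 M (\<lambda>x. g x - h x)"
  using l2_triangle[OF sq_int_diff[OF assms(1,2)] sq_int_diff[OF assms(2,3)]] by simp

lemma l2_abs_diff_le:
  assumes "sq_int M f" "sq_int M g"
  shows "\<bar>l2 M f - l2 M g\<bar> \<le> l2 M (\<lambda>x. f x - g x)"
proof -
  have "l2 M f \<le> l2 M (\<lambda>x. f x - g x) + l2 M g"
    using l2_triangle[OF sq_int_diff[OF assms] assms(2)] by simp
  moreover have "l2 M g \<le> l2 M (\<lambda>x. g x - f x) + l2 M f"
    using l2_triangle[OF sq_int_diff[OF assms(2,1)] assms(1)] by simp
  ultimately show ?thesis by (simp add: l2_minus_commute[of M g f])
qed

lemma l2_tendsto: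
  assumes "\<And>n. sq_int M (f n)" "sq_int M g" "((\<lambda>n. l2 M (\<lambda>x. f n x - g x)) \<longlongrightarrow> 0) F"
  shows "((\<lambda>n. l2 M (f n)) \<longlongrightarrow> l2 M g) F"
proof -
  have "((\<lambda>n. l2 M (f n) - l2 M g) \<longlongrightarrow> 0) F"
    by (rule Lim_null_comparison[OF _ assms(3)]) (auto intro!: always_eventually l2_abs_diff_le assms)
  then show ?thesis using LIM_zero_iff by blast
qed

lemma l2_eq_0_iff:
  assumes "sq_int M f" shows "l2 M f = 0 \<longleftrightarrow> (AE x in M. f x = 0)"
  using assms integral_nonneg_eq_0_iff_AE[of M "\<lambda>x. (norm (f x))\<^sup>2"]
  by (auto simp: l2_def sq_int_def)

lemma integrable_inner_sq_int:
  fixes f g :: "'a \<Rightarrow> 'b::{banach,second_countable_topology,real_normed_algebra}"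
  assumes "sq_int M f" "sq_int M g" shows "integrable M (\<lambda>x. f x * g x)"
proof -
  have m: "f \<in> borel_measurable M" "g \<in> borel_measurable M" using assms by (auto simp: sq_int_def)
  have "integrable M (\<lambda>x. (norm (f x))\<^sup>2 + (norm (g x))\<^sup>2)" using assms by (auto simp: sq_int_def)
  then show ?thesis
  proof (rule Bochner_Integration.integrable_bound)
    show "AE x in M. norm (f x * g x) \<le> norm ((norm (f x))\<^sup>2 + (norm (g x))\<^sup>2)"
    proof (intro always_eventually allI)
      fix x
      have "norm (f x * g x) \<le> norm (f x) * norm (g x)" by (rule norm_mult_ineq)
      also have "\<dots> \<le> (norm (f x))\<^sup>2 + (norm (g x))\<^sup>2"
        using sum_squares_bound[of "norm (f x)" "norm (g x)"] zero_le_power2[of "norm (f x)"] zero_le_power2[of "norm (g x)"]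
          mult_nonneg_nonneg[of "norm (f x)" "norm (g x)"] norm_ge_zero by linarith
      finally show "norm (f x * g x) \<le> norm ((norm (f x))\<^sup>2 + (norm (g x))\<^sup>2)" by simp
    qed
  qed (use m in measurable)
qed

text \<open>This form of Fatou's lemma yields both that limits have finite energy and that norms are lower
  semicontinuous.\<close>

lemma Fatou_integral_bound:
  fixes g :: "nat \<Rightarrow> 'a \<Rightarrow> real"
  assumes int: "\<And>n. integrable M (g n)" and nn: "\<And>n. AE x in M. 0 \<le> g n x"
    and lim: "AE x in M. (\<lambda>n. g n x) \<longlonglongrightarrow> h x" and [measurable]: "h \<in> borel_measurable M"
    and b: "eventually (\<lambda>n. (LINT x|M. g n x) \<le> C) sequentially"
  shows "integrable M h" "(LINT x|M. h x) \<le> C"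
proof -
  have [measurable]: "\<And>n. g n \<in> borel_measurable M" using int by auto
  have nn': "AE x in M. \<forall>n. 0 \<le> g n x" using nn by (simp add: AE_all_countable)
  have hnn: "AE x in M. 0 \<le> h x" using nn' lim
    by eventually_elim (auto intro: LIMSEQ_le_const)
  obtain N where N: "\<And>n. n \<ge> N \<Longrightarrow> (LINT x|M. g n x) \<le> C" using b by (auto simp: eventually_sequentially)
  have "0 \<le> (LINT x|M. g N x)" using nn by (intro integral_nonneg_AE)
  then have C0: "0 \<le> C" using N[of N] by simp
  have "(\<integral>\<^sup>+x. ennreal (h x) \<partial>M) = (\<integral>\<^sup>+x. liminf (\<lambda>n. ennreal (g (n + N) x)) \<partial>M)"
  proof (rule nn_integral_cong_AE, use lim in eventually_elim)
    case (elim x)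
    have "(\<lambda>n. ennreal (g (n + N) x)) \<longlonglongrightarrow> ennreal (h x)"
      by (intro tendsto_ennrealI LIMSEQ_ignore_initial_segment elim)
    then show ?case by (simp add: lim_imp_Liminf)
  qed
  also have "\<dots> \<le> liminf (\<lambda>n. \<integral>\<^sup>+x. ennreal (g (n + N) x) \<partial>M)"
    by (rule nn_integral_liminf) measurable
  also have "\<dots> \<le> liminf (\<lambda>n. ennreal C)"
  proof (rule Liminf_mono, rule always_eventually, rule allI)
    fix n show "(\<integral>\<^sup>+x. ennreal (g (n + N) x) \<partial>M) \<le> ennreal C"
      using nn_integral_eq_integral[OF int nn, of "n + N"] N[of "n+N"] by (simp add: ennreal_leI)
  qed
  also have "\<dots> = ennreal C" by (simp add: Liminf_const)
  finally have le: "(\<integral>\<^sup>+x. ennreal (h x) \<partial>M) \<le> ennreal C" .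
  show *: "integrable M h"
    by (rule integrableI_nonneg) (use hnn le in \<open>auto simp: less_top[symmetric] top_unique\<close>)
  show "(LINT x|M. h x) \<le> C"
    using le nn_integral_eq_integral[OF * hnn] C0 by simp
qed

text \<open>Along a subsequence with rapidly decreasing increments the increments are dominated pointwise
  by a geometric sequence, which gives an almost everywhere limit; Fatou's lemma identifies it.\<close>

lemma l2_complete:
  fixes f :: "nat \<Rightarrow> 'a \<Rightarrow> 'b::{banach,second_countable_topology}"
  assumes sq: "\<And>n. sq_int M (f n)"
    and C: "\<And>e. e > 0 \<Longrightarrow> \<exists>N. \<forall>m\<ge>N. \<forall>n\<ge>N. l2 M (\<lambda>x. f m x - f n x) < e"
  obtains g where "sq_int M g" "(\<lambda>n. l2 M (\<lambda>x. f n x - g x)) \<longlonglongrightarrow> 0"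
proof -
  have [measurable]: "\<And>n. f n \<in> borel_measurable M" using sq by (auto simp: sq_int_def)
  define P where "P = (\<lambda>k n. \<forall>m\<ge>n. l2 M (\<lambda>x. f m x - f n x) \<le> (1/4)^k)"
  have ex: "\<exists>n>l. P k n" for k l
  proof -
    obtain N where "\<forall>m\<ge>N. \<forall>n\<ge>N. l2 M (\<lambda>x. f m x - f n x) < (1/4)^k" using C[of "(1/4)^k"] by auto
    then show ?thesis unfolding P_def by (intro exI[of _ "max N (Suc l)"]) (auto intro: less_imp_le)
  qed
  have "\<exists>r. \<forall>k. P k (r k) \<and> r k < r (Suc k)"
  proof (intro dependent_nat_choice[where P=P and Q="\<lambda>_ m n. m < n"])
    show "\<exists>x. P 0 x" using ex[of 0 0] by auto
    show "\<exists>y. P (Suc n) y \<and> x < y" for x n using ex[of x "Suc n"] by auto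
  qed
  then obtain r where r: "\<And>k. P k (r k)" and rS: "\<And>k. r k < r (Suc k)" by blast
  have mono: "strict_mono r" using rS by (simp add: strict_mono_Suc_iff)
  define d where "d = (\<lambda>n x. f (r (Suc n)) x - f (r n) x)"
  have [measurable]: "\<And>n. d n \<in> borel_measurable M" unfolding d_def by measurable
  have sqd: "sq_int M (d n)" for n unfolding d_def by (intro sq_int_diff sq)
  have ld: "l2 M (d n) \<le> (1/4)^n" for n
    using r[of n] rS[of n] unfolding P_def d_def by (auto simp: less_imp_le)
  have "(\<integral>\<^sup>+x. (\<Sum>n. ennreal (2^n * (norm (d n x))\<^sup>2)) \<partial>M) = (\<Sum>n. \<integral>\<^sup>+x. ennreal (2^n * (norm (d n x))\<^sup>2) \<partial>M)"
    by (rule nn_integral_suminf) measurable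
  also have "\<dots> \<le> (\<Sum>n. ennreal ((1/8)^n))"
  proof (rule suminf_le)
    fix n
    have "(\<integral>\<^sup>+x. ennreal (2^n * (norm (d n x))\<^sup>2) \<partial>M) = ennreal (LINT x|M. 2^n * (norm (d n x))\<^sup>2)"
      by (rule nn_integral_eq_integral) (use sqd in \<open>auto simp: sq_int_def\<close>)
    also have "(LINT x|M. 2^n * (norm (d n x))\<^sup>2) = 2^n * (l2 M (d n))\<^sup>2" by (simp add: l2_power2)
    also have "\<dots> \<le> 2^n * ((1/4)^n)\<^sup>2" by (intro mult_left_mono power_mono ld) auto
    also have "\<dots> = (2 * (1/4)\<^sup>2)^n" by (simp only: power_mult_distrib power_mult[symmetric] mult.commute)
    also have "\<dots> = (1/8)^n" by (simp add: power2_eq_square)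
    finally show "(\<integral>\<^sup>+x. ennreal (2^n * (norm (d n x))\<^sup>2) \<partial>M) \<le> ennreal ((1/8)^n)" by (simp add: ennreal_leI)
  qed auto
  also have "\<dots> = ennreal (\<Sum>n. (1/8)^n)" by (rule suminf_ennreal2) auto
  finally have "(\<integral>\<^sup>+x. (\<Sum>n. ennreal (2^n * (norm (d n x))\<^sup>2)) \<partial>M) \<noteq> \<infinity>" by (auto simp: top_unique)
  then have "AE x in M. (\<Sum>n. ennreal (2^n * (norm (d n x))\<^sup>2)) \<noteq> \<infinity>"
    by (intro nn_integral_noteq_infinite) auto
  then have conv: "AE x in M. convergent (\<lambda>n. f (r n) x)"
  proof eventually_elim
    case (elim x)
    then have "summable (\<lambda>n. 2^n * (norm (d n x))\<^sup>2)" by (intro summable_suminf_not_top) auto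
    then obtain K where K: "\<And>n. norm (2^n * (norm (d n x))\<^sup>2) \<le> K"
      using summable_imp_Bseq[of "\<lambda>n. 2^n * (norm (d n x))\<^sup>2"] by (auto simp: Bseq_def)
    have nb: "norm (d n x) \<le> sqrt K * (sqrt (1/2))^n" for n
    proof -
      have "(norm (d n x))\<^sup>2 \<le> K * (1/2)^n" using K[of n] by (simp add: field_simps)
      then have "norm (d n x) \<le> sqrt (K * (1/2)^n)" by (rule real_le_rsqrt)
      then show ?thesis by (simp add: real_sqrt_mult real_sqrt_power)
    qed
    have "summable (\<lambda>n. sqrt K * (sqrt (1/2))^n)"
      by (rule summable_mult, rule summable_geometric) (simp add: real_sqrt_divide)
    then have "summable (\<lambda>n. d n x)"
      by (rule summable_comparison_test'[where N=0]) (rule nb)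
    then have "convergent (\<lambda>n. \<Sum>i<n. d i x)" by (simp add: summable_iff_convergent)
    moreover have "(\<Sum>i<n. d i x) = f (r n) x - f (r 0) x" for n
      unfolding d_def by (rule sum_lessThan_telescope)
    ultimately have "convergent (\<lambda>n. (f (r n) x - f (r 0) x) + f (r 0) x)"
      by (intro convergent_add convergent_const) simp
    then show ?case by simp
  qed
  define g where "g = (\<lambda>x. lim (\<lambda>n. f (r n) x))"
  have [measurable]: "g \<in> borel_measurable M" unfolding g_def by measurable
  have lim: "AE x in M. (\<lambda>n. f (r n) x) \<longlonglongrightarrow> g x"
    using conv unfolding g_def by eventually_elim (simp add: convergent_LIMSEQ_iff)
  have fat: "integrable M (\<lambda>x. (norm (f m x - g x))\<^sup>2) \<and> (LINT x|M. (norm (f m x - g x))\<^sup>2) \<le> ((1/4)^k)\<^sup>2 * 4"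
    if "m \<ge> r k" for m k
  proof -
    have *: "integrable M (\<lambda>x. (norm (f m x - f (r n) x))\<^sup>2)" for n
      using sq_int_diff[OF sq sq] by (auto simp: sq_int_def)
    have l: "AE x in M. (\<lambda>n. (norm (f m x - f (r n) x))\<^sup>2) \<longlonglongrightarrow> (norm (f m x - g x))\<^sup>2"
      using lim by eventually_elim (intro tendsto_intros)
    have "(LINT x|M. (norm (f m x - f (r n) x))\<^sup>2) \<le> ((1/4)^k)\<^sup>2 * 4" if "n \<ge> k" for n
    proof -
      have rk: "r n \<ge> r k" using that mono by (simp add: strict_mono_less_eq)
      have "l2 M (\<lambda>x. f m x - f (r n) x) \<le> l2 M (\<lambda>x. f m x - f (r k) x) + l2 M (\<lambda>x. f (r k) x - f (r n) x)"
        by (intro l2_triangle_diff sq)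
      also have "\<dots> \<le> (1/4)^k + (1/4)^k"
        using r[of k] rk \<open>m \<ge> r k\<close> unfolding P_def l2_minus_commute[of M "f (r k)"] by (intro add_mono) auto
      finally have "(l2 M (\<lambda>x. f m x - f (r n) x))\<^sup>2 \<le> (2 * (1/4)^k)\<^sup>2" by (intro power_mono) auto
      then show ?thesis by (simp add: l2_power2 power_mult_distrib)
    qed
    then have ev: "eventually (\<lambda>n. (LINT x|M. (norm (f m x - f (r n) x))\<^sup>2) \<le> ((1/4)^k)\<^sup>2 * 4) sequentially"
      by (auto simp: eventually_sequentially)
    show ?thesis using Fatou_integral_bound[OF * _ l _ ev] by auto
  qed
  have "sq_int M (\<lambda>x. f (r 0) x - g x)" using fat[of 0 "r 0"] by (auto simp: sq_int_def)
  from sq_int_diff[OF sq[of "r 0"] this] have gs: "sq_int M g" by simp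
  have "(\<lambda>n. l2 M (\<lambda>x. f n x - g x)) \<longlonglongrightarrow> 0"
  proof (rule LIMSEQ_I)
    fix e :: real assume "e > 0"
    have "(\<lambda>k. 2 * (1/4::real)^k) \<longlonglongrightarrow> 2 * 0" by (intro tendsto_intros LIMSEQ_power_zero) auto
    then have "eventually (\<lambda>k. 2 * (1/4::real)^k < e) sequentially"
      using order_tendstoD(2)[of _ 0 sequentially e] \<open>e > 0\<close> by simp
    then obtain k where k: "2 * (1/4::real)^k < e" by (auto simp: eventually_sequentially)
    have "norm (l2 M (\<lambda>x. f n x - g x) - 0) < e" if "n \<ge> r k" for n
    proof -
      have "(l2 M (\<lambda>x. f n x - g x))\<^sup>2 \<le> (2 * (1/4)^k)\<^sup>2"
        using fat[OF that] by (simp add: l2_power2 power_mult_distrib)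
      then have "l2 M (\<lambda>x. f n x - g x) \<le> 2 * (1/4)^k" by (rule power2_le_imp_le) auto
      then show ?thesis using k by simp
    qed
    then show "\<exists>no. \<forall>n\<ge>no. norm (l2 M (\<lambda>x. f n x - g x) - 0) < e" by blast
  qed
  with gs show ?thesis by (rule that)
qed

lemma l2_tendsto_AE_subseq:
  fixes f :: "nat \<Rightarrow> 'a \<Rightarrow> 'b::{banach,second_countable_topology}"
  assumes "\<And>n. sq_int M (f n)" "sq_int M g" "(\<lambda>n. l2 M (\<lambda>x. f n x - g x)) \<longlonglongrightarrow> 0"
  shows "\<exists>r::nat\<Rightarrow>nat. strict_mono r \<and> (AE x in M. (\<lambda>n. f (r n) x) \<longlonglongrightarrow> g x)"
proof -
  have "(\<lambda>n. (l2 M (\<lambda>x. f n x - g x))\<^sup>2) \<longlonglongrightarrow> 0\<^sup>2" by (intro tendsto_power assms)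
  then have "(\<lambda>n. LINT x|M. norm ((norm (f n x - g x))\<^sup>2)) \<longlonglongrightarrow> 0" by (simp add: l2_power2)
  then obtain r where "strict_mono r" and r: "AE x in M. (\<lambda>n. (norm (f (r n) x - g x))\<^sup>2) \<longlonglongrightarrow> 0"
    using tendsto_L1_AE_subseq[of M "\<lambda>n x. (norm (f n x - g x))\<^sup>2"] sq_int_diff[OF assms(1,2)]
    by (auto simp: sq_int_def)
  from r have "AE x in M. (\<lambda>n. f (r n) x) \<longlonglongrightarrow> g x"
  proof eventually_elim
    case (elim x)
    have "(\<lambda>n. sqrt ((norm (f (r n) x - g x))\<^sup>2)) \<longlonglongrightarrow> sqrt 0" by (intro tendsto_real_sqrt elim)
    then show ?case by (simp add: tendsto_norm_zero_iff LIM_zero_iff)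
  qed
  with \<open>strict_mono r\<close> show ?thesis by blast
qed

text \<open>Expand the square of the triangle inequality for \<open>f + g\<close> and for \<open>f - g\<close>.\<close>

lemma l2_Cauchy_Schwarz:
  fixes f g :: "'a \<Rightarrow> real"
  assumes f: "sq_int M f" and g: "sq_int M g"
  shows "\<bar>LINT x|M. f x * g x\<bar> \<le> l2 M f * l2 M g"
proof -
  have *: "2 * (LINT x|M. f x * k x) \<le> 2 * (l2 M f * l2 M k)" if k: "sq_int M k" for k
  proof -
    have int: "integrable M (\<lambda>x. (f x)\<^sup>2)" "integrable M (\<lambda>x. (k x)\<^sup>2)" "integrable M (\<lambda>x. f x * k x)"
      using f k integrable_inner_sq_int[OF f k] by (auto simp: sq_int_def)
    have "(l2 M (\<lambda>x. f x + k x))\<^sup>2 = (LINT x|M. (f x)\<^sup>2 + (k x)\<^sup>2 + 2 * (f x * k x))"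
      by (simp add: l2_power2 power2_sum mult.assoc)
    also have "\<dots> = (l2 M f)\<^sup>2 + (l2 M k)\<^sup>2 + 2 * (LINT x|M. f x * k x)"
      using int by (simp add: l2_power2)
    finally have "(l2 M f)\<^sup>2 + (l2 M k)\<^sup>2 + 2 * (LINT x|M. f x * k x) \<le> (l2 M f + l2 M k)\<^sup>2"
      using power_mono[OF l2_triangle[OF f k] l2_nonneg, of 2] by simp
    then show ?thesis by (simp add: power2_sum mult.assoc)
  qed
  have "l2 M (\<lambda>x. - g x) = l2 M g" "sq_int M (\<lambda>x. - g x)"
    using l2_scaleR[of M "-1" g] sq_int_scaleR[OF g, of "-1"] by auto
  then show ?thesis using *[OF g] *[of "\<lambda>x. - g x"] by simp
qed

lemma l2_dominated_convergence:
  fixes f :: "nat \<Rightarrow> 'a \<Rightarrow> 'b::{banach,second_countable_topology}" and w :: "'a \<Rightarrow> real"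
  assumes "\<And>n. f n \<in> borel_measurable M" "g \<in> borel_measurable M" "sq_int M w"
    and lim: "AE x in M. (\<lambda>n. f n x) \<longlonglongrightarrow> g x" and dom: "\<And>n. AE x in M. norm (f n x) \<le> w x"
  shows "sq_int M g" "\<And>n. sq_int M (f n)" "(\<lambda>n. l2 M (\<lambda>x. f n x - g x)) \<longlonglongrightarrow> 0"
proof -
  note [measurable] = assms(1,2)
  have dom': "AE x in M. \<forall>n. norm (f n x) \<le> w x" using dom by (simp add: AE_all_countable)
  have "AE x in M. norm (g x) \<le> w x"
    using dom' lim by eventually_elim (auto intro: LIMSEQ_le_const2 tendsto_norm)
  then have gw: "AE x in M. norm (g x) \<le> 1 * norm (w x)" by eventually_elim auto
  show "sq_int M g" by (rule sq_int_dominated(1)[OF assms(2,3) gw]) simp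
  show "sq_int M (f n)" for n
  proof (rule sq_int_dominated(1)[OF assms(1,3), where C=1])
    show "AE x in M. norm (f n x) \<le> 1 * norm (w x)" using dom[of n] by eventually_elim auto
  qed simp
  have "(\<lambda>n. LINT x|M. (norm (f n x - g x))\<^sup>2) \<longlonglongrightarrow> (LINT x|M. 0)"
  proof (rule integral_dominated_convergence[where w="\<lambda>x. 4 * (w x)\<^sup>2"])
    show "integrable M (\<lambda>x. 4 * (w x)\<^sup>2)" using assms(3) by (auto simp: sq_int_def)
    show "AE x in M. (\<lambda>n. (norm (f n x - g x))\<^sup>2) \<longlonglongrightarrow> 0"
      using lim
    proof eventually_elim
      case (elim x)
      have "(\<lambda>n. (norm (f n x - g x))\<^sup>2) \<longlonglongrightarrow> (norm (g x - g x))\<^sup>2" by (intro tendsto_intros elim)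
      then show ?case by simp
    qed
    show "AE x in M. norm ((norm (f n x - g x))\<^sup>2) \<le> 4 * (w x)\<^sup>2" for n
      using dom[of n] gw
    proof eventually_elim
      case (elim x)
      have "norm (f n x - g x) \<le> 2 * w x" using norm_triangle_ineq4[of "f n x" "g x"] elim norm_ge_zero[of "f n x"] by auto
      then have "(norm (f n x - g x))\<^sup>2 \<le> (2 * w x)\<^sup>2" by (intro power_mono) auto
      then show ?case by (simp add: power_mult_distrib)
    qed
  qed measurable
  then have "(\<lambda>n. sqrt (LINT x|M. (norm (f n x - g x))\<^sup>2)) \<longlonglongrightarrow> sqrt 0" by (intro tendsto_real_sqrt) simp
  then show "(\<lambda>n. l2 M (\<lambda>x. f n x - g x)) \<longlonglongrightarrow> 0" by (simp add: l2_def)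
qed

section \<open>The Gaussian and its Fourier transform\<close>

text \<open>Lebesgue measure is the image of the product measure over the coordinates.\<close>

lemma lborel_integral_prod_Basis:
  fixes f :: "'a::euclidean_space \<Rightarrow> real \<Rightarrow> 'b::{real_normed_field,banach,second_countable_topology}"
  assumes "\<And>b. b \<in> Basis \<Longrightarrow> integrable lborel (f b)"
  shows "integrable lborel (\<lambda>x. \<Prod>b\<in>Basis. f b (x \<bullet> b))"
    and "(LINT x|lborel. (\<Prod>b\<in>Basis. f b (x \<bullet> b))) = (\<Prod>b\<in>Basis. (LINT t|lborel. f b t))"
proof -
  interpret product_sigma_finite "\<lambda>b::'a. lborel :: real measure" ..
  have [measurable]: "f b \<in> borel_measurable borel" if "b \<in> Basis" for b
    using assms[OF that] borel_measurable_integrable by force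
  have m: "(\<lambda>x::'a. \<Prod>b\<in>Basis. f b (x \<bullet> b)) \<in> borel_measurable borel" by measurable
  have T: "(\<lambda>g. \<Sum>b\<in>Basis. g b *\<^sub>R b) \<in> (\<Pi>\<^sub>M b\<in>(Basis::'a set). lborel) \<rightarrow>\<^sub>M borel" by measurable
  have eq: "(\<Prod>b\<in>Basis. f b ((\<Sum>c\<in>Basis. g c *\<^sub>R c) \<bullet> b)) = (\<Prod>b\<in>Basis. f b (g b))" for g
    by (intro prod.cong refl arg_cong2[where f=f]) simp
  show "integrable lborel (\<lambda>x. \<Prod>b\<in>Basis. f b (x \<bullet> b))"
    unfolding lborel_eq[where 'a='a] integrable_distr_eq[OF T m] eq
    by (intro product_integrable_prod assms) auto
  show "(LINT x|lborel. (\<Prod>b\<in>Basis. f b (x \<bullet> b))) = (\<Prod>b\<in>Basis. (LINT t|lborel. f b t))"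
    unfolding lborel_eq[where 'a='a] integral_distr[OF T m] eq
    by (intro product_integral_prod assms) auto
qed

definition gauss :: "'a::euclidean_space \<Rightarrow> real" where
  "gauss x = (2 * pi) powr (- (DIM('a) / 2)) * exp (- (norm x)\<^sup>2 / 2)"

lemma gauss_pos: "0 < gauss x"
  by (simp add: gauss_def)

lemma gauss_measurable [measurable]: "gauss \<in> borel_measurable borel"
  unfolding gauss_def[abs_def] by measurable

lemma gauss_eq_prod: "gauss (x::'a::euclidean_space) = (\<Prod>b\<in>Basis. std_normal_density (x \<bullet> b))"
proof -
  have "(\<Prod>b\<in>(Basis::'a set). std_normal_density (x \<bullet> b))
     = (1 / sqrt (2 * pi)) ^ DIM('a) * exp (\<Sum>b\<in>Basis. - (x \<bullet> b)\<^sup>2 / 2)"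
    by (simp add: std_normal_density_def prod.distrib exp_sum power_divide prod_dividef)
  also have "(\<Sum>b\<in>Basis. - (x \<bullet> b)\<^sup>2 / 2) = - (norm x)\<^sup>2 / 2"
    by (simp add: norm_eq_sqrt_inner euclidean_inner[of x x] power2_eq_square sum_divide_distrib sum_negf sum_nonneg)
  also have "(1 / sqrt (2 * pi)) ^ DIM('a) = (2 * pi) powr (- (DIM('a) / 2))"
  proof -
    have "1 / sqrt (2 * pi) = (2 * pi) powr (- (1/2))"
      using powr_minus_divide[of "2 * pi" "1/2"] powr_half_sqrt[of "2 * pi"] by simp
    then have "(1 / sqrt (2 * pi)) ^ DIM('a) = ((2 * pi) powr (- (1/2))) powr real DIM('a)"
      by (simp add: powr_realpow)
    then show ?thesis by (simp add: powr_powr)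
  qed
  finally show ?thesis by (simp add: gauss_def)
qed

lemma gauss_fourier:
  fixes h :: "'a::euclidean_space"
  shows "integrable lborel (gauss :: 'a \<Rightarrow> real)"
    and "integral\<^sup>L lborel (gauss :: 'a \<Rightarrow> real) = 1"
    and "(LINT x|lborel. complex_of_real (gauss x) * cis (h \<bullet> x)) = complex_of_real (exp (- (norm h)\<^sup>2 / 2))"
proof -
  have i1: "integrable lborel std_normal_density" "integral\<^sup>L lborel std_normal_density = 1"
    by (auto simp: integrable_normal_density integral_normal_density)
  show "integrable lborel (gauss :: 'a \<Rightarrow> real)"
    using lborel_integral_prod_Basis(1)[where f="\<lambda>b::'a. std_normal_density"] i1
    by (simp add: gauss_eq_prod[abs_def])
  show "integral\<^sup>L lborel (gauss :: 'a \<Rightarrow> real) = 1"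
    using lborel_integral_prod_Basis(2)[where f="\<lambda>b::'a. std_normal_density"] i1
    by (simp add: gauss_eq_prod[abs_def])
  have c1: "(LINT t|lborel. complex_of_real (std_normal_density t) * cis (s * t)) = exp (- s\<^sup>2 / 2)" for s :: real
  proof -
    have "complex_of_real (exp (- s\<^sup>2 / 2)) = char std_normal_distribution s"
      by (simp add: char_std_normal_distribution)
    also have "\<dots> = (LINT t|lborel. std_normal_density t *\<^sub>R exp (\<i> * complex_of_real (s * t)))"
      unfolding char_def by (subst integral_density) auto
    finally show ?thesis by (simp add: cis_conv_exp scaleR_conv_of_real)
  qed
  have c2: "integrable lborel (\<lambda>t. complex_of_real (std_normal_density t) * cis (s * t))" for s :: real
  proof (rule Bochner_Integration.integrable_bound[OF i1(1)])
    have [measurable]: "(\<lambda>t. cis (s * t)) \<in> borel_measurable borel"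
      by (intro borel_measurable_continuous_onI continuous_intros)
    show "(\<lambda>t. complex_of_real (std_normal_density t) * cis (s * t)) \<in> borel_measurable lborel" by measurable
  qed (auto simp: norm_mult)
  have "complex_of_real (gauss x) * cis (h \<bullet> x) = (\<Prod>b\<in>Basis. complex_of_real (std_normal_density (x \<bullet> b)) * cis ((h \<bullet> b) * (x \<bullet> b)))" for x
  proof -
    have "cis (h \<bullet> x) = (\<Prod>b\<in>Basis. cis ((h \<bullet> b) * (x \<bullet> b)))"
      by (simp add: euclidean_inner[of h x] cis_conv_exp sum_distrib_left exp_sum)
    then show ?thesis by (simp add: gauss_eq_prod prod.distrib)
  qed
  then have "(LINT x|lborel. complex_of_real (gauss x) * cis (h \<bullet> x))
    = (\<Prod>b\<in>Basis. (LINT t|lborel. complex_of_real (std_normal_density t) * cis ((h \<bullet> b) * t)))"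
    using lborel_integral_prod_Basis(2)[where f="\<lambda>b t. complex_of_real (std_normal_density t) * cis ((h \<bullet> b) * t)"] c2
    by simp
  also have "\<dots> = (\<Prod>b\<in>Basis. exp (complex_of_real (- (h \<bullet> b)\<^sup>2 / 2)))" by (simp only: c1 exp_of_real[symmetric])
  also have "\<dots> = exp (complex_of_real (\<Sum>b\<in>Basis. - (h \<bullet> b)\<^sup>2 / 2))" by (simp add: exp_sum)
  also have "(\<Sum>b\<in>Basis. - (h \<bullet> b)\<^sup>2 / 2) = - (norm h)\<^sup>2 / 2"
    by (simp add: norm_eq_sqrt_inner euclidean_inner[of h h] power2_eq_square sum_divide_distrib sum_negf sum_nonneg)
  finally show "(LINT x|lborel. complex_of_real (gauss x) * cis (h \<bullet> x)) = complex_of_real (exp (- (norm h)\<^sup>2 / 2))"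
    by (simp only: exp_of_real)
qed

lemma lborel_integral_affine:
  fixes f :: "'a::euclidean_space \<Rightarrow> 'b::{banach,second_countable_topology}"
  assumes [measurable]: "f \<in> borel_measurable borel" and c: "c \<noteq> 0"
  shows "(LINT x|lborel. f x) = \<bar>c\<bar> ^ DIM('a) *\<^sub>R (LINT x|lborel. f (t + c *\<^sub>R x))"
    and "integrable lborel f \<longleftrightarrow> integrable lborel (\<lambda>x. f (t + c *\<^sub>R x))"
proof -
  show "(LINT x|lborel. f x) = \<bar>c\<bar> ^ DIM('a) *\<^sub>R (LINT x|lborel. f (t + c *\<^sub>R x))"
    by (subst lborel_affine[OF c, of t]) (simp add: integral_density integral_distr)
  have "integrable lborel f \<longleftrightarrow> integrable lborel (\<lambda>x. \<bar>c\<bar> ^ DIM('a) *\<^sub>R f (t + c *\<^sub>R x))"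
    by (subst lborel_affine[OF c, of t]) (simp add: integrable_density integrable_distr_eq)
  moreover have "integrable lborel (\<lambda>x. f (t + c *\<^sub>R x))"
    if "integrable lborel (\<lambda>x. \<bar>c\<bar> ^ DIM('a) *\<^sub>R f (t + c *\<^sub>R x))"
    using integrable_scaleR_right[OF that, of "inverse (\<bar>c\<bar> ^ DIM('a))"] c by simp
  ultimately show "integrable lborel f \<longleftrightarrow> integrable lborel (\<lambda>x. f (t + c *\<^sub>R x))"
    by auto
qed

lemma lborel_integral_translate:
  fixes f :: "'a::euclidean_space \<Rightarrow> 'b::{banach,second_countable_topology}"
  assumes "f \<in> borel_measurable borel"
  shows "(LINT x|lborel. f (x + h)) = (LINT x|lborel. f x)"
    and "integrable lborel (\<lambda>x. f (x + h)) \<longleftrightarrow> integrable lborel f"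
  using lborel_integral_affine[OF assms, of 1 h] by (simp_all add: add.commute)

text \<open>Up to the normalisation of the transform, a flat Gaussian weight on the spectrum corresponds to an
  approximate identity of width \<open>e\<close> in space.\<close>

lemma gauss_fourier_scaled:
  fixes w :: "'a::euclidean_space"
  assumes e: "e > 0"
  shows "(2 * pi) powr (- real DIM('a)) * (LINT x|lborel. complex_of_real (exp (- (norm (e *\<^sub>R x))\<^sup>2 / 2)) * cis (- (x \<bullet> w)))
     = complex_of_real ((1/e) ^ DIM('a) * gauss ((1/e) *\<^sub>R w))"
proof -
  let ?N = "real DIM('a)"
  have pp: "(2 * pi) powr (- ?N) * (2 * pi) powr (?N / 2) = (2 * pi) powr (- (?N / 2))"
    by (simp add: powr_add[symmetric])
  have ex: "exp (- ((norm y)\<^sup>2 / 2)) = (2 * pi) powr (?N / 2) * gauss y" for y :: 'a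
    by (simp add: gauss_def powr_minus field_simps)
  have "(LINT x|lborel. complex_of_real (exp (- (norm (e *\<^sub>R x))\<^sup>2 / 2)) * cis (- (x \<bullet> w)))
      = \<bar>1/e\<bar> ^ DIM('a) *\<^sub>R (LINT x|lborel. complex_of_real (exp (- (norm (e *\<^sub>R ((1/e) *\<^sub>R x)))\<^sup>2 / 2)) * cis (- (((1/e) *\<^sub>R x) \<bullet> w)))"
    by (subst lborel_integral_affine(1)[where c="1/e" and t=0]) 
      (use e in \<open>auto intro!: borel_measurable_times borel_measurable_continuous_onI continuous_intros\<close>)
  also have "(LINT x|lborel. complex_of_real (exp (- (norm (e *\<^sub>R ((1/e) *\<^sub>R x)))\<^sup>2 / 2)) * cis (- (((1/e) *\<^sub>R x) \<bullet> w)))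
     = (LINT x|lborel. complex_of_real ((2 * pi) powr (?N / 2)) * (complex_of_real (gauss x) * cis ((- ((1/e) *\<^sub>R w)) \<bullet> x)))"
    using e by (intro Bochner_Integration.integral_cong refl) (simp add: ex inner_commute mult.assoc)
  also have "\<dots> = complex_of_real ((2 * pi) powr (?N / 2) * exp (- (norm ((1/e) *\<^sub>R w))\<^sup>2 / 2))"
    by (simp only: integral_mult_right_zero gauss_fourier(3) norm_minus_cancel of_real_mult)
  finally have "(LINT x|lborel. complex_of_real (exp (- (norm (e *\<^sub>R x))\<^sup>2 / 2)) * cis (- (x \<bullet> w)))
     = complex_of_real ((1/e) ^ DIM('a) * ((2 * pi) powr (?N / 2) * exp (- (norm ((1/e) *\<^sub>R w))\<^sup>2 / 2)))"
    (is "?I = complex_of_real ?r") using e by (simp only: scaleR_conv_of_real of_real_mult abs_of_pos zero_less_divide_1_iff)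
  moreover have "(2 * pi) powr (- ?N) * ?r = (1/e) ^ DIM('a) * gauss ((1/e) *\<^sub>R w)"
    unfolding gauss_def pp[symmetric] by (simp only: mult_ac)
  ultimately show ?thesis by (simp only: flip: of_real_mult)
qed

section \<open>Continuity of translations in the square mean\<close>

lemma sq_int_translate:
  fixes u :: "'a::euclidean_space \<Rightarrow> 'b::{banach,second_countable_topology}"
  assumes "sq_int lborel u"
  shows "sq_int lborel (\<lambda>x. u (x + h))" "l2 lborel (\<lambda>x. u (x + h)) = l2 lborel u"
proof -
  have [measurable]: "u \<in> borel_measurable borel" using assms by (simp add: sq_int_def)
  show "sq_int lborel (\<lambda>x. u (x + h))"
    using assms lborel_integral_translate(2)[of "\<lambda>x. (norm (u x))\<^sup>2" h] by (auto simp: sq_int_def)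
  show "l2 lborel (\<lambda>x. u (x + h)) = l2 lborel u"
    using lborel_integral_translate(1)[of "\<lambda>x. (norm (u x))\<^sup>2" h] by (simp add: l2_def)
qed

lemma sq_int_indicator_cball:
  "sq_int lborel (\<lambda>x::'a::euclidean_space. B * indicator (cball 0 R) x :: real)"
proof -
  have "(\<lambda>x::'a. (norm (B * indicator (cball 0 R) x :: real))\<^sup>2) = (\<lambda>x. B\<^sup>2 * indicator (cball 0 R) x)"
    by (auto simp: indicator_def)
  moreover have [measurable]: "cball (0::'a) R \<in> sets borel" by simp
  then have "(\<lambda>x::'a. B * indicator (cball 0 R) x :: real) \<in> borel_measurable borel" by measurable
  moreover have "integrable lborel (\<lambda>x::'a. B\<^sup>2 * indicator (cball 0 R) x)"
    by (intro integrable_mult_right) (auto intro!: integrable_real_indicator emeasure_bounded_finite)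
  ultimately show ?thesis by (simp add: sq_int_def)
qed

text \<open>First \<open>u\<close> is cut off in its domain and its range. The cut-off function is an almost everywhere limit of
  continuous functions, and cutting these off in the same way makes the convergence dominated.\<close>

lemma compactly_supported_continuous_dense:
  fixes u :: "'a::euclidean_space \<Rightarrow> real"
  assumes u: "sq_int lborel u" and e: "e > 0"
  obtains g R where "continuous_on UNIV g" "\<And>x. norm x > R \<Longrightarrow> g x = 0" "sq_int lborel g"
    "l2 lborel (\<lambda>x. u x - g x) < e"
proof -
  have um[measurable]: "u \<in> borel_measurable borel" using u by (simp add: sq_int_def)
  define cl :: "nat \<Rightarrow> real \<Rightarrow> real" where "cl = (\<lambda>n t. max (- real n) (min (real n) t))"
  have clm [measurable]: "cl n \<in> borel_measurable borel" for n unfolding cl_def by measurable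
  have clc: "continuous_on UNIV (cl n)" for n unfolding cl_def by (intro continuous_intros)
  define v where "v = (\<lambda>n x. indicator (ball 0 (real n)) x * cl n (u x))"
  have vm[measurable]: "v n \<in> borel_measurable borel" for n
    unfolding v_def
    by (intro borel_measurable_times borel_measurable_indicator measurable_compose[OF um clm]) simp
  have "(\<lambda>n. l2 lborel (\<lambda>x. v n x - u x)) \<longlonglongrightarrow> 0"
  proof (rule l2_dominated_convergence(3)[where w="\<lambda>x. \<bar>u x\<bar>"])
    show "sq_int lborel (\<lambda>x. \<bar>u x\<bar>)" using u by (simp add: sq_int_def)
    show "AE x in lborel. (\<lambda>n. v n x) \<longlonglongrightarrow> u x"
    proof (intro always_eventually allI)
      fix x
      obtain N :: nat where N: "max \<bar>u x\<bar> (norm x) < N" using reals_Archimedean2 by blast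
      have "v n x = u x" if "n \<ge> N" for n
      proof -
        have "real N \<le> real n" using that by simp
        then have "norm x < real n" "\<bar>u x\<bar> \<le> real n" using N by linarith+
        then show ?thesis by (auto simp: v_def cl_def indicator_def)
      qed
      then show "(\<lambda>n. v n x) \<longlonglongrightarrow> u x" by (intro tendsto_eventually) (auto simp: eventually_sequentially)
    qed
    show "AE x in lborel. norm (v n x) \<le> \<bar>u x\<bar>" for n
      by (auto simp: v_def cl_def indicator_def)
  qed auto
  then have "eventually (\<lambda>n. l2 lborel (\<lambda>x. v n x - u x) < e/2) sequentially"
    by (rule order_tendstoD) (use e in simp)
  then obtain n where n: "l2 lborel (\<lambda>x. v n x - u x) < e/2" by (auto simp: eventually_sequentially)
  have "v n \<in> borel_measurable lebesgue" by (intro measurable_completion) simp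
  then have "v n measurable_on UNIV" by (intro lebesgue_measurable_imp_measurable_on_real) auto
  then obtain Z g where Z: "negligible Z" and g: "\<And>k. continuous_on UNIV (g k)"
    and gl: "\<And>x. x \<notin> Z \<Longrightarrow> (\<lambda>k. g k x) \<longlonglongrightarrow> v n x"
    by (auto simp: measurable_on_def)
  define \<eta> where "\<eta> = (\<lambda>x::'a. max 0 (min 1 (real n + 1 - norm x)))"
  have \<eta>c: "continuous_on UNIV \<eta>" unfolding \<eta>_def by (intro continuous_intros)
  define h where "h = (\<lambda>k x. \<eta> x * cl n (g k x))"
  have hc: "continuous_on UNIV (h k)" for k
    unfolding h_def by (intro continuous_on_mult \<eta>c continuous_on_compose2[OF clc g]) auto
  have h0: "h k x = 0" if "norm x > real n + 1" for k x using that by (simp add: h_def \<eta>_def)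
  have hb: "\<bar>h k x\<bar> \<le> real n * indicator (cball 0 (real n + 1)) x" for k x
  proof (cases "norm x > real n + 1")
    case True then show ?thesis by (simp add: h0)
  next
    case False
    have "\<bar>h k x\<bar> = \<bar>\<eta> x\<bar> * \<bar>cl n (g k x)\<bar>" by (simp add: h_def abs_mult)
    also have "\<dots> \<le> 1 * real n" by (intro mult_mono) (auto simp: \<eta>_def cl_def)
    finally show ?thesis using False by simp
  qed
  have [measurable]: "h k \<in> borel_measurable borel" for k by (rule borel_measurable_continuous_onI[OF hc])
  note dc = l2_dominated_convergence[where f=h and g="v n" and M=lborel and w="\<lambda>x. real n * indicator (cball 0 (real n + 1)) x"]
  have AEl: "AE x in lborel. (\<lambda>k. h k x) \<longlonglongrightarrow> v n x"
  proof -
    have "Z \<in> null_sets lebesgue" using Z by (simp add: negligible_iff_null_sets)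
    then have "AE x in lborel. x \<notin> Z" using AE_not_in AE_completion_iff by blast
    then show ?thesis
    proof eventually_elim
      case (elim x)
      have "isCont (cl n) (v n x)" using clc by (simp add: continuous_on_eq_continuous_at)
      then have "(\<lambda>k. \<eta> x * cl n (g k x)) \<longlonglongrightarrow> \<eta> x * cl n (v n x)"
        by (intro tendsto_mult tendsto_const) (rule isCont_tendsto_compose[OF _ gl[OF elim]])
      also have "\<eta> x * cl n (v n x) = v n x"
        by (auto simp: v_def \<eta>_def cl_def indicator_def)
      finally show ?case by (simp add: h_def)
    qed
  qed
  have sq: "sq_int lborel (v n)" "\<And>k. sq_int lborel (h k)" "(\<lambda>k. l2 lborel (\<lambda>x. h k x - v n x)) \<longlonglongrightarrow> 0"
    using dc AEl hb by (auto simp: sq_int_indicator_cball)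
  from order_tendstoD(2)[OF sq(3), of "e/2"] e
  obtain k where k: "l2 lborel (\<lambda>x. h k x - v n x) < e/2" by (auto simp: eventually_sequentially)
  have "l2 lborel (\<lambda>x. u x - h k x) \<le> l2 lborel (\<lambda>x. u x - v n x) + l2 lborel (\<lambda>x. v n x - h k x)"
    by (intro l2_triangle_diff u sq)
  also have "\<dots> < e" using n k by (simp add: l2_minus_commute[of lborel u "v n"] l2_minus_commute[of lborel "v n" "h k"])
  finally show ?thesis using that[OF hc h0 sq(2)] by blast
qed

text \<open>For a continuous function with compact support this is dominated convergence; translations are
  isometries, so approximation by such functions is uniform in the translation.\<close>

lemma l2_translate_continuous:
  fixes u :: "'a::euclidean_space \<Rightarrow> real"
  assumes u: "sq_int lborel u" and X: "X \<longlonglongrightarrow> 0"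
  shows "(\<lambda>n. l2 lborel (\<lambda>x. u (x + X n) - u x)) \<longlonglongrightarrow> 0"
proof (rule LIMSEQ_I)
  fix e :: real assume e: "e > 0"
  obtain g R where gc: "continuous_on UNIV g" and g0: "\<And>x. norm x > R \<Longrightarrow> g x = 0" and gs: "sq_int lborel g"
    and ug: "l2 lborel (\<lambda>x. u x - g x) < e/3"
    using compactly_supported_continuous_dense[OF u, of "e/3"] e by auto
  obtain B where B: "\<And>x. \<bar>g x\<bar> \<le> B"
  proof -
    have "compact (g ` cball 0 R)" by (intro compact_continuous_image continuous_on_subset[OF gc]) auto
    then obtain B where B: "\<forall>y\<in>g ` cball 0 R. norm y \<le> B" using compact_imp_bounded bounded_iff by metis
    have "\<bar>g x\<bar> \<le> max 0 B" for x
      using B g0[of x] by (cases "norm x > R") (auto simp: le_max_iff_disj)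
    then show ?thesis by (rule that)
  qed
  obtain N1 where N1: "\<And>n. n \<ge> N1 \<Longrightarrow> norm (X n) < 1" using LIMSEQ_D[OF X, of 1] by auto
  have [measurable]: "g \<in> borel_measurable borel" using gc by (rule borel_measurable_continuous_onI)
  have "(\<lambda>n. l2 lborel (\<lambda>x. g (x + X (n + N1)) - g x)) \<longlonglongrightarrow> 0"
  proof (rule l2_dominated_convergence(3)[where w="\<lambda>x. B * indicator (cball 0 (R+1)) x"])
    show "AE x in lborel. (\<lambda>n. g (x + X (n + N1))) \<longlonglongrightarrow> g x"
    proof (intro always_eventually allI)
      fix x
      have "(\<lambda>n. x + X (n + N1)) \<longlonglongrightarrow> x + 0" by (intro tendsto_intros LIMSEQ_ignore_initial_segment X)
      moreover have "isCont g x" using gc by (simp add: continuous_on_eq_continuous_at)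
      ultimately show "(\<lambda>n. g (x + X (n + N1))) \<longlonglongrightarrow> g x" by (intro isCont_tendsto_compose[of x g]) auto
    qed
    show "AE x in lborel. norm (g (x + X (n + N1))) \<le> B * indicator (cball 0 (R + 1)) x" for n
    proof (intro always_eventually allI)
      fix x
      show "norm (g (x + X (n + N1))) \<le> B * indicator (cball 0 (R + 1)) x"
      proof (cases "norm x > R + 1")
        case True
        have "norm x \<le> norm (x + X (n+N1)) + norm (X (n+N1))" using norm_triangle_ineq4[of "x + X (n+N1)" "X (n+N1)"] by simp
        then have "norm (x + X (n + N1)) > R" using True N1[of "n+N1"] by simp
        then show ?thesis using True by (simp add: g0)
      qed (use B in auto)
    qed
  qed (auto simp: sq_int_indicator_cball)
  from LIMSEQ_D[OF this, of "e/3"] e obtain N2 where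
    N2: "\<And>n. n \<ge> N2 \<Longrightarrow> l2 lborel (\<lambda>x. g (x + X (n + N1)) - g x) < e/3" by auto
  have "norm (l2 lborel (\<lambda>x. u (x + X n) - u x) - 0) < e" if "n \<ge> N1 + N2" for n
  proof -
    have *: "l2 lborel (\<lambda>x. u (x + X n) - g (x + X n)) = l2 lborel (\<lambda>x. u x - g x)"
      using sq_int_translate(2)[OF sq_int_diff[OF u gs], of "X n"] by simp
    have "l2 lborel (\<lambda>x. u (x + X n) - u x) \<le> l2 lborel (\<lambda>x. u (x + X n) - g (x + X n)) + l2 lborel (\<lambda>x. g (x + X n) - u x)"
      by (intro l2_triangle_diff sq_int_translate u gs)
    also have "l2 lborel (\<lambda>x. g (x + X n) - u x) \<le> l2 lborel (\<lambda>x. g (x + X n) - g x) + l2 lborel (\<lambda>x. g x - u x)"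
      by (intro l2_triangle_diff sq_int_translate u gs)
    also have "l2 lborel (\<lambda>x. g (x + X n) - g x) < e/3" using N2[of "n - N1"] that by simp
    finally show ?thesis using ug * by (simp add: l2_minus_commute[of lborel g u])
  qed
  then show "\<exists>no. \<forall>n\<ge>no. norm (l2 lborel (\<lambda>x. u (x + X n) - u x) - 0) < e" by blast
qed

section \<open>Plancherel's theorem for integrable functions\<close>

lemma cis_measurable [measurable]: "cis \<in> borel_measurable borel"
  by (intro borel_measurable_continuous_onI continuous_intros)

lemma cis_inner_measurable:
  "(\<lambda>(x::'a::euclidean_space, y). cis (x \<bullet> y)) \<in> borel_measurable (lborel \<Otimes>\<^sub>M lborel)"
  "(\<lambda>(x::'a::euclidean_space, y). cis (- (x \<bullet> y))) \<in> borel_measurable (lborel \<Otimes>\<^sub>M lborel)"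
  by measurable

lemma cnj_measurable [measurable]: "cnj \<in> borel_measurable borel"
  by (intro borel_measurable_continuous_onI continuous_intros)

text \<open>The transform with respect to Borel sets and without the normalising constant. Fubini's theorem is applied on
  this side, since the product of two completed measures is not complete.\<close>

definition ft :: "('a::euclidean_space \<Rightarrow> real) \<Rightarrow> 'a \<Rightarrow> complex" where
  "ft u \<xi> = (LINT x|lborel. cis (- (\<xi> \<bullet> x)) * complex_of_real (u x))"

lemma ft_measurable [measurable]:
  assumes [measurable]: "u \<in> borel_measurable borel"
  shows "ft u \<in> borel_measurable borel"
  unfolding ft_def[abs_def] by measurable

lemma ft_bound:
  assumes "integrable lborel u" shows "cmod (ft u \<xi>) \<le> (LINT x|lborel. \<bar>u x\<bar>)"
  unfolding ft_def by (rule order_trans[OF integral_norm_bound]) (simp add: norm_mult)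

lemma integrable_cis_mult:
  fixes u :: "'a::euclidean_space \<Rightarrow> complex"
  assumes "integrable lborel u"
  shows "integrable lborel (\<lambda>x. cis (s \<bullet> x) * u x)"
proof (rule Bochner_Integration.integrable_bound[OF assms])
  have [measurable]: "u \<in> borel_measurable borel" using assms borel_measurable_integrable by force
  show "(\<lambda>x. cis (s \<bullet> x) * u x) \<in> borel_measurable lborel" by measurable
qed (simp add: norm_mult)

text \<open>The form in which integrals are exchanged below: a product of integrable functions times a unimodular phase.\<close>

lemma Fubini_bounded_kernel:
  fixes m :: "'a::euclidean_space \<Rightarrow> complex" and u :: "'b::euclidean_space \<Rightarrow> complex"
  assumes m: "integrable lborel m" and u: "integrable lborel u"
    and k: "case_prod k \<in> borel_measurable (lborel \<Otimes>\<^sub>M lborel)" and b: "\<And>x y. norm (k x y) \<le> C"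
  shows "(LINT x|lborel. (LINT y|lborel. m x * u y * k x y)) = (LINT y|lborel. (LINT x|lborel. m x * u y * k x y))"
proof -
  have [measurable]: "m \<in> borel_measurable borel" "u \<in> borel_measurable borel"
    using m u borel_measurable_integrable by force+
  note [measurable] = k
  have "integrable (lborel \<Otimes>\<^sub>M lborel) (\<lambda>(x, y). m x * u y)"
  proof (rule lborel_pair.Fubini_integrable)
    show "integrable lborel (\<lambda>x. LINT y|lborel. norm (case (x, y) of (x, y) \<Rightarrow> m x * u y))"
      using m by (simp add: norm_mult)
    show "AE x in lborel. integrable lborel (\<lambda>y. case (x, y) of (x, y) \<Rightarrow> m x * u y)" using u by simp
  qed measurable
  then have "integrable (lborel \<Otimes>\<^sub>M lborel) (\<lambda>z. C * norm (case z of (x, y) \<Rightarrow> m x * u y))" by simp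
  then have "integrable (lborel \<Otimes>\<^sub>M lborel) (\<lambda>(x, y). m x * u y * k x y)"
  proof (rule Bochner_Integration.integrable_bound)
    show "AE z in lborel \<Otimes>\<^sub>M lborel. norm (case z of (x, y) \<Rightarrow> m x * u y * k x y)
        \<le> norm (C * norm (case z of (x, y) \<Rightarrow> m x * u y))"
    proof (intro always_eventually allI, safe)
      fix x y
      have "norm (m x * u y * k x y) = norm (m x * u y) * norm (k x y)" by (simp add: norm_mult)
      also have "\<dots> \<le> norm (m x * u y) * C" by (intro mult_left_mono b) auto
      also have "\<dots> \<le> norm (C * norm (m x * u y))" by (simp add: mult.commute)
      finally show "norm (m x * u y * k x y) \<le> norm (C * norm (m x * u y))" .
    qed
  qed measurable
  then show ?thesis by (rule lborel_pair.Fubini_integral[symmetric])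
qed

lemma integral_mult_left_commute:
  fixes a b :: "'a \<Rightarrow> complex"
  shows "c * (LINT y|M. a y * b y) = (LINT y|M. a y * (c * b y))"
  by (subst integral_mult_right_zero[symmetric]) (simp add: mult.left_commute)

text \<open>The squared modulus is the product of a transform and a conjugate transform. Exchanging the
  integrals leaves the transform of the Gaussian weight at the differences \<open>x - y\<close>.\<close>

lemma gauss_weighted_spectrum:
  fixes u :: "'a::euclidean_space \<Rightarrow> real"
  assumes u: "integrable lborel u" and e: "e > 0"
  shows "(2 * pi) powr (- real DIM('a)) * (LINT \<xi>|lborel. exp (- (norm (e *\<^sub>R \<xi>))\<^sup>2 / 2) * (cmod (ft u \<xi>))\<^sup>2)
    = (LINT x|lborel. u x * (LINT y|lborel. u y * ((1/e) ^ DIM('a) * gauss ((1/e) *\<^sub>R (x - y)))))"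
proof -
  have [measurable]: "u \<in> borel_measurable borel" using u borel_measurable_integrable by force
  let ?c = "complex_of_real ((2 * pi) powr (- real DIM('a)))"
  let ?m = "\<lambda>\<xi>::'a. complex_of_real (exp (- (norm (e *\<^sub>R \<xi>))\<^sup>2 / 2))"
  let ?u = "\<lambda>x. complex_of_real (u x)"
  let ?K = "\<lambda>x y. (1/e) ^ DIM('a) * gauss ((1/e) *\<^sub>R (x - y))"
  have mi: "integrable lborel ?m"
  proof -
    have "integrable lborel (\<lambda>x::'a. gauss (0 + e *\<^sub>R x))"
      using lborel_integral_affine(2)[of "gauss :: 'a \<Rightarrow> real" e 0] gauss_fourier(1) e by auto
    then have "integrable lborel (\<lambda>x::'a. (2 * pi) powr (DIM('a) / 2) * gauss (e *\<^sub>R x))" by simp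
    then show ?thesis by (intro integrable_of_real) (simp add: gauss_def powr_minus field_simps)
  qed
  have ui: "integrable lborel ?u" using u by simp
  have cnjft: "cnj (ft u \<xi>) = (LINT y|lborel. ?u y * cis (\<xi> \<bullet> y))" for \<xi>
    unfolding ft_def by (subst Bochner_Integration.integral_cnj[symmetric]) (simp add: cis_cnj mult.commute)
  have mfi: "integrable lborel (\<lambda>\<xi>. ?m \<xi> * cnj (ft u \<xi>))"
  proof (rule Bochner_Integration.integrable_bound[OF integrable_mult_left[OF mi, of "complex_of_real (LINT x|lborel. \<bar>u x\<bar>)"]])
    show "(\<lambda>\<xi>. ?m \<xi> * cnj (ft u \<xi>)) \<in> borel_measurable lborel" by measurable
    show "AE \<xi> in lborel. norm (?m \<xi> * cnj (ft u \<xi>)) \<le> norm (?m \<xi> * complex_of_real (LINT x|lborel. \<bar>u x\<bar>))"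
      using ft_bound[OF u] by (intro always_eventually allI) (auto simp: norm_mult intro!: mult_left_mono order_trans[OF _ abs_ge_self])
  qed
  \<comment> \<open>with the weight integrated out, the inner integral is a convolution of \<open>u\<close> with a narrow Gaussian\<close>
  have inner: "?c * (LINT \<xi>|lborel. ?m \<xi> * cnj (ft u \<xi>) * cis (- (\<xi> \<bullet> x)))
      = complex_of_real (LINT y|lborel. u y * ?K x y)" for x
  proof -
    have mc: "integrable lborel (\<lambda>\<xi>. ?m \<xi> * cis (- (\<xi> \<bullet> x)))"
      using integrable_cis_mult[OF mi, of "- x"] by (simp add: inner_commute mult.commute)
    have "(LINT \<xi>|lborel. ?m \<xi> * cnj (ft u \<xi>) * cis (- (\<xi> \<bullet> x)))
       = (LINT \<xi>|lborel. (LINT y|lborel. (?m \<xi> * cis (- (\<xi> \<bullet> x))) * ?u y * cis (\<xi> \<bullet> y)))"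
    proof (intro Bochner_Integration.integral_cong refl)
      fix \<xi>
      have "?m \<xi> * cnj (ft u \<xi>) * cis (- (\<xi> \<bullet> x)) = (?m \<xi> * cis (- (\<xi> \<bullet> x))) * (LINT y|lborel. ?u y * cis (\<xi> \<bullet> y))"
        by (simp only: cnjft mult_ac)
      also have "\<dots> = (LINT y|lborel. (?m \<xi> * cis (- (\<xi> \<bullet> x))) * (?u y * cis (\<xi> \<bullet> y)))"
        by (rule integral_mult_right_zero[symmetric])
      finally show "?m \<xi> * cnj (ft u \<xi>) * cis (- (\<xi> \<bullet> x)) = (LINT y|lborel. (?m \<xi> * cis (- (\<xi> \<bullet> x))) * ?u y * cis (\<xi> \<bullet> y))"
        by (simp only: mult.assoc)
    qed
    also have "\<dots> = (LINT y|lborel. (LINT \<xi>|lborel. (?m \<xi> * cis (- (\<xi> \<bullet> x))) * ?u y * cis (\<xi> \<bullet> y)))"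
      by (rule Fubini_bounded_kernel[OF mc ui, where C=1]) (simp_all add: cis_inner_measurable)
    also have "\<dots> = (LINT y|lborel. ?u y * (LINT \<xi>|lborel. ?m \<xi> * cis (- (\<xi> \<bullet> (x - y)))))"
    proof (intro Bochner_Integration.integral_cong refl)
      fix y
      have "(?m \<xi> * cis (- (\<xi> \<bullet> x))) * ?u y * cis (\<xi> \<bullet> y) = ?u y * (?m \<xi> * cis (- (\<xi> \<bullet> (x - y))))" for \<xi>
        by (simp add: mult_ac cis_mult inner_diff_right)
      then show "(LINT \<xi>|lborel. (?m \<xi> * cis (- (\<xi> \<bullet> x))) * ?u y * cis (\<xi> \<bullet> y))
          = ?u y * (LINT \<xi>|lborel. ?m \<xi> * cis (- (\<xi> \<bullet> (x - y))))" by (simp only: integral_mult_right_zero)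
    qed
    finally have "?c * (LINT \<xi>|lborel. ?m \<xi> * cnj (ft u \<xi>) * cis (- (\<xi> \<bullet> x)))
        = (LINT y|lborel. ?u y * (?c * (LINT \<xi>|lborel. ?m \<xi> * cis (- (\<xi> \<bullet> (x - y))))))"
      by (simp only:) (rule integral_mult_left_commute)
    also have "\<dots> = (LINT y|lborel. complex_of_real (u y * ?K x y))"
      unfolding gauss_fourier_scaled[OF e] by (simp only: of_real_mult)
    finally show ?thesis by (simp only: integral_complex_of_real)
  qed
  have "complex_of_real (LINT \<xi>|lborel. exp (- (norm (e *\<^sub>R \<xi>))\<^sup>2 / 2) * (cmod (ft u \<xi>))\<^sup>2)
     = (LINT \<xi>|lborel. (LINT x|lborel. (?m \<xi> * cnj (ft u \<xi>)) * ?u x * cis (- (\<xi> \<bullet> x))))"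
  proof (subst integral_complex_of_real[symmetric], intro Bochner_Integration.integral_cong refl)
    fix \<xi>
    have "complex_of_real (exp (- (norm (e *\<^sub>R \<xi>))\<^sup>2 / 2) * (cmod (ft u \<xi>))\<^sup>2) = (?m \<xi> * cnj (ft u \<xi>)) * ft u \<xi>"
      by (simp only: of_real_mult complex_norm_square mult_ac)
    also have "\<dots> = (LINT x|lborel. (?m \<xi> * cnj (ft u \<xi>)) * ?u x * cis (- (\<xi> \<bullet> x)))"
      unfolding ft_def[of u \<xi>] by (subst integral_mult_right_zero[symmetric]) (simp add: mult_ac)
    finally show "complex_of_real (exp (- (norm (e *\<^sub>R \<xi>))\<^sup>2 / 2) * (cmod (ft u \<xi>))\<^sup>2) = \<dots>" .
  qed
  also have "\<dots> = (LINT x|lborel. (LINT \<xi>|lborel. (?m \<xi> * cnj (ft u \<xi>)) * ?u x * cis (- (\<xi> \<bullet> x))))"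
    by (rule Fubini_bounded_kernel[OF mfi ui, where C=1]) (simp_all add: cis_inner_measurable)
  also have "\<dots> = (LINT x|lborel. ?u x * (LINT \<xi>|lborel. ?m \<xi> * cnj (ft u \<xi>) * cis (- (\<xi> \<bullet> x))))"
    by (intro Bochner_Integration.integral_cong refl) (simp add: mult_ac flip: integral_mult_right_zero)
  finally have "?c * complex_of_real (LINT \<xi>|lborel. exp (- (norm (e *\<^sub>R \<xi>))\<^sup>2 / 2) * (cmod (ft u \<xi>))\<^sup>2)
    = (LINT x|lborel. ?u x * (?c * (LINT \<xi>|lborel. ?m \<xi> * cnj (ft u \<xi>) * cis (- (\<xi> \<bullet> x)))))"
    by (simp only:) (rule integral_mult_left_commute)
  also have "\<dots> = (LINT x|lborel. complex_of_real (u x * (LINT y|lborel. u y * ?K x y)))"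
    unfolding inner by (simp only: of_real_mult)
  also have "\<dots> = complex_of_real (LINT x|lborel. u x * (LINT y|lborel. u y * ?K x y))"
    by (rule integral_complex_of_real)
  finally show ?thesis by (simp only: flip: of_real_mult) (simp only: of_real_eq_iff)
qed

text \<open>Substitute \<open>y = x - e z\<close> and exchange the integrals, which is legitimate because the autocorrelation is
  bounded by Cauchy and Schwarz.\<close>

lemma gauss_mean_autocorrelation:
  fixes u :: "'a::euclidean_space \<Rightarrow> real"
  assumes u: "sq_int lborel u" and e: "e > 0"
  shows "(LINT x|lborel. u x * (LINT y|lborel. u y * ((1/e) ^ DIM('a) * gauss ((1/e) *\<^sub>R (x - y)))))
    = (LINT z|lborel. gauss z * (LINT x|lborel. u x * u (x + (- e) *\<^sub>R z)))"
proof -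
  have [measurable]: "u \<in> borel_measurable borel" using u by (simp add: sq_int_def)
  have sub: "(LINT y|lborel. u y * ((1/e) ^ DIM('a) * gauss ((1/e) *\<^sub>R (x - y)))) = (LINT z|lborel. u (x + (- e) *\<^sub>R z) * gauss z)" for x
  proof -
    have "(LINT y|lborel. u y * ((1/e) ^ DIM('a) * gauss ((1/e) *\<^sub>R (x - y))))
      = \<bar>- e\<bar> ^ DIM('a) *\<^sub>R (LINT z|lborel. u (x + (- e) *\<^sub>R z) * ((1/e) ^ DIM('a) * gauss ((1/e) *\<^sub>R (x - (x + (- e) *\<^sub>R z)))))"
      by (rule lborel_integral_affine(1)) (use e in auto)
    also have "\<dots> = (LINT z|lborel. e ^ DIM('a) * (u (x + (- e) *\<^sub>R z) * ((1/e) ^ DIM('a) * gauss z)))"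
      using e by simp
    also have "\<dots> = (LINT z|lborel. u (x + (- e) *\<^sub>R z) * gauss z)"
      using e by (intro Bochner_Integration.integral_cong refl) (simp add: field_simps)
    finally show ?thesis .
  qed
  have ts: "sq_int lborel (\<lambda>x. u (x + h))" "l2 lborel (\<lambda>x. u (x + h)) = l2 lborel u" for h
    using sq_int_translate[OF u] by auto
  have "integrable (lborel \<Otimes>\<^sub>M lborel) (\<lambda>(z, x). gauss z * (u x * u (x + (- e) *\<^sub>R z)))"
  proof (rule lborel_pair.Fubini_integrable)
    show "AE z in lborel. integrable lborel (\<lambda>x. case (z, x) of (z, x) \<Rightarrow> gauss z * (u x * u (x + (- e) *\<^sub>R z)))"
    proof (intro always_eventually allI)
      fix z show "integrable lborel (\<lambda>x. case (z, x) of (z, x) \<Rightarrow> gauss z * (u x * u (x + (- e) *\<^sub>R z)))"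
        using integrable_inner_sq_int[OF u ts(1)[of "(- e) *\<^sub>R z"]] by simp
    qed
    have ab: "sq_int lborel (\<lambda>x. \<bar>u x\<bar>)" "l2 lborel (\<lambda>x. \<bar>u x\<bar>) = l2 lborel u" using u by (auto simp: sq_int_def l2_def)
    have abt: "sq_int lborel (\<lambda>x. \<bar>u (x + h)\<bar>)" "l2 lborel (\<lambda>x. \<bar>u (x + h)\<bar>) = l2 lborel u" for h
      using sq_int_translate[OF ab(1), of h] ab(2) by auto
    have bd: "\<bar>LINT x|lborel. \<bar>u x\<bar> * \<bar>u (x + h)\<bar>\<bar> \<le> (l2 lborel u)\<^sup>2" for h
      using l2_Cauchy_Schwarz[OF ab(1) abt(1), of h] by (simp add: ab abt power2_eq_square)
    have "integrable lborel (\<lambda>z::'a. gauss z * (LINT x|lborel. \<bar>u x\<bar> * \<bar>u (x + (- e) *\<^sub>R z)\<bar>))"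
    proof (rule Bochner_Integration.integrable_bound[OF integrable_mult_left[OF gauss_fourier(1), of "(l2 lborel u)\<^sup>2"]])
      show "AE z in lborel. norm (gauss z * (LINT x|lborel. \<bar>u x\<bar> * \<bar>u (x + (- e) *\<^sub>R z)\<bar>)) \<le> norm (gauss (z::'a) * (l2 lborel u)\<^sup>2)"
      proof (intro always_eventually allI)
        fix z :: 'a
        show "norm (gauss z * (LINT x|lborel. \<bar>u x\<bar> * \<bar>u (x + (- e) *\<^sub>R z)\<bar>)) \<le> norm (gauss z * (l2 lborel u)\<^sup>2)"
          unfolding real_norm_def abs_mult using bd[of "(- e) *\<^sub>R z"] by (intro mult_left_mono) auto
      qed
    qed measurable
    moreover have "(LINT x|lborel. norm (gauss z * (u x * u (x + (- e) *\<^sub>R z)))) = gauss z * (LINT x|lborel. \<bar>u x\<bar> * \<bar>u (x + (- e) *\<^sub>R z)\<bar>)" for z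
      using gauss_pos[of z] by (simp add: abs_mult)
    ultimately show "integrable lborel (\<lambda>z. LINT x|lborel. norm (case (z, x) of (z, x) \<Rightarrow> gauss z * (u x * u (x + (- e) *\<^sub>R z))))"
      by simp
  qed measurable
  from lborel_pair.Fubini_integral[OF this]
  have "(LINT x|lborel. (LINT z|lborel. gauss z * (u x * u (x + (- e) *\<^sub>R z))))
      = (LINT z|lborel. (LINT x|lborel. gauss z * (u x * u (x + (- e) *\<^sub>R z))))" .
  moreover have "u x * (LINT z|lborel. u (x + (- e) *\<^sub>R z) * gauss z) = (LINT z|lborel. gauss z * (u x * u (x + (- e) *\<^sub>R z)))" for x
    by (subst integral_mult_right_zero[symmetric]) (simp only: mult_ac)
  ultimately show ?thesis unfolding sub by simp
qed

text \<open>Damping the spectrum with a Gaussian turns its square integral into a Gaussian mean of the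
  autocorrelation of \<open>u\<close>. Removing the damping concentrates that mean at the origin, where the
  autocorrelation is the square integral of \<open>u\<close>.\<close>

theorem Plancherel_integrable:
  fixes u :: "'a::euclidean_space \<Rightarrow> real"
  assumes u1: "integrable lborel u" and u2: "sq_int lborel u"
  shows "sq_int lborel (ft u)"
    and "(2 * pi) powr (- real DIM('a)) * (l2 lborel (ft u))\<^sup>2 = (l2 lborel u)\<^sup>2"
proof -
  have [measurable]: "u \<in> borel_measurable borel" using u2 by (simp add: sq_int_def)
  let ?c = "(2 * pi) powr (- real DIM('a))"
  have cpos: "?c > 0" by simp
  define E where "E = (\<lambda>n \<xi>. exp (- (norm ((1 / real (Suc n)) *\<^sub>R (\<xi>::'a)))\<^sup>2 / 2))"
  have [measurable]: "E n \<in> borel_measurable borel" for n unfolding E_def by measurable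
  have E0: "0 \<le> E n \<xi>" "E n \<xi> \<le> 1" for n \<xi> by (auto simp: E_def)
  have El: "(\<lambda>n. E n \<xi>) \<longlonglongrightarrow> 1" for \<xi>
  proof -
    have "(\<lambda>n. exp (- (norm ((1 / real (Suc n)) *\<^sub>R \<xi>))\<^sup>2 / 2)) \<longlonglongrightarrow> exp (- (norm (0 *\<^sub>R \<xi>))\<^sup>2 / 2)"
      by (intro tendsto_intros lim_1_over_n[THEN LIMSEQ_Suc]) auto
    then show ?thesis by (simp add: E_def)
  qed
  \<comment> \<open>the autocorrelation, which is largest at the origin and continuous there\<close>
  define A where "A = (\<lambda>h. LINT x|lborel. u x * u (x + h))"
  have Ab: "\<bar>A h\<bar> \<le> (l2 lborel u)\<^sup>2" for h
    using l2_Cauchy_Schwarz[OF u2 sq_int_translate(1)[OF u2], of h]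
    by (simp add: A_def sq_int_translate(2)[OF u2] power2_eq_square)
  have Ac: "(\<lambda>n. A (X n)) \<longlonglongrightarrow> (l2 lborel u)\<^sup>2" if "X \<longlonglongrightarrow> 0" for X
  proof -
    have *: "norm (A (X n) - (l2 lborel u)\<^sup>2) \<le> l2 lborel u * l2 lborel (\<lambda>x. u (x + X n) - u x)" for n
    proof -
      have "A (X n) - (l2 lborel u)\<^sup>2 = (LINT x|lborel. u x * u (x + X n)) - (LINT x|lborel. u x * u x)"
        unfolding A_def l2_power2 by (simp add: power2_eq_square)
      also have "\<dots> = (LINT x|lborel. u x * (u (x + X n) - u x))"
        by (subst Bochner_Integration.integral_diff[symmetric])
          (auto intro!: integrable_inner_sq_int u2 sq_int_translate simp: right_diff_distrib)
      finally show ?thesis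
        using l2_Cauchy_Schwarz[OF u2 sq_int_diff[OF sq_int_translate(1)[OF u2] u2], of "X n"] by simp
    qed
    have "(\<lambda>n. l2 lborel u * l2 lborel (\<lambda>x. u (x + X n) - u x)) \<longlonglongrightarrow> l2 lborel u * 0"
      by (intro tendsto_intros l2_translate_continuous u2 that)
    then have "(\<lambda>n. A (X n) - (l2 lborel u)\<^sup>2) \<longlonglongrightarrow> 0"
      using Lim_null_comparison[OF always_eventually[OF allI[OF *]]] by simp
    then show ?thesis by (simp add: LIM_zero_iff)
  qed
  have [measurable]: "A \<in> borel_measurable borel" unfolding A_def by measurable
  have eq: "?c * (LINT \<xi>|lborel. E n \<xi> * (cmod (ft u \<xi>))\<^sup>2) = (LINT z|lborel. gauss z * A ((- (1 / real (Suc n))) *\<^sub>R z))" for n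
    unfolding E_def A_def
    by (subst gauss_weighted_spectrum[OF u1]) (simp, rule gauss_mean_autocorrelation[OF u2], simp)
  have "(\<lambda>n. LINT z|lborel. gauss z * A ((- (1 / real (Suc n))) *\<^sub>R z)) \<longlonglongrightarrow> (LINT z|lborel. gauss (z::'a) * (l2 lborel u)\<^sup>2)"
  proof (rule integral_dominated_convergence[where w="\<lambda>z. gauss z * (l2 lborel u)\<^sup>2"])
    show "AE z in lborel. (\<lambda>n. gauss z * A ((- (1 / real (Suc n))) *\<^sub>R z)) \<longlonglongrightarrow> gauss (z::'a) * (l2 lborel u)\<^sup>2"
    proof (intro always_eventually allI tendsto_mult tendsto_const Ac)
      fix z :: 'a
      have "(\<lambda>n. (- (1 / real (Suc n))) *\<^sub>R z) \<longlonglongrightarrow> (- 0) *\<^sub>R z"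
        by (intro tendsto_intros lim_1_over_n[THEN LIMSEQ_Suc])
      then show "(\<lambda>n. (- (1 / real (Suc n))) *\<^sub>R z) \<longlonglongrightarrow> 0" by simp
    qed
    show "AE z in lborel. norm (gauss z * A ((- (1 / real (Suc n))) *\<^sub>R z)) \<le> gauss (z::'a) * (l2 lborel u)\<^sup>2" for n
      using Ab by (intro always_eventually allI) (auto simp: abs_mult less_imp_le[OF gauss_pos] intro!: mult_mono)
    show "integrable lborel (\<lambda>z::'a. gauss z * (l2 lborel u)\<^sup>2)" by (intro integrable_mult_left gauss_fourier)
  qed measurable
  then have lim1: "(\<lambda>n. ?c * (LINT \<xi>|lborel. E n \<xi> * (cmod (ft u \<xi>))\<^sup>2)) \<longlonglongrightarrow> (l2 lborel u)\<^sup>2"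
    by (simp add: eq gauss_fourier(2))
  have Ei: "integrable lborel (\<lambda>\<xi>. E n \<xi> * (cmod (ft u \<xi>))\<^sup>2)" for n
  proof -
    have "integrable lborel (\<lambda>x::'a. gauss (0 + (1 / real (Suc n)) *\<^sub>R x))"
      using lborel_integral_affine(2)[of "gauss :: 'a \<Rightarrow> real" "1 / real (Suc n)" 0] gauss_fourier(1) by auto
    then have "integrable lborel (\<lambda>x::'a. (2 * pi) powr (DIM('a) / 2) * gauss ((1 / real (Suc n)) *\<^sub>R x))" by simp
    then have "integrable lborel (E n)" by (simp add: gauss_def E_def[abs_def] powr_minus field_simps)
    from integrable_mult_left[OF this, of "(LINT x|lborel. \<bar>u x\<bar>)\<^sup>2"]
    show ?thesis
    proof (rule Bochner_Integration.integrable_bound)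
      show "AE x in lborel. norm (E n x * (cmod (ft u x))\<^sup>2) \<le> norm (E n x * (LINT x|lborel. \<bar>u x\<bar>)\<^sup>2)"
        using ft_bound[OF u1] E0 by (intro always_eventually allI) (auto simp: abs_mult intro!: mult_left_mono power_mono)
    qed measurable
  qed
  have l: "AE \<xi> in lborel. (\<lambda>n. E n \<xi> * (cmod (ft u \<xi>))\<^sup>2) \<longlonglongrightarrow> (cmod (ft u \<xi>))\<^sup>2"
    using tendsto_mult[OF El tendsto_const] by (intro always_eventually allI) fastforce
  \<comment> \<open>a majorant is available only once the undamped spectrum is known to be square integrable, so Fatou comes first\<close>
  have "eventually (\<lambda>n. ?c * (LINT \<xi>|lborel. E n \<xi> * (cmod (ft u \<xi>))\<^sup>2) < (l2 lborel u)\<^sup>2 + 1) sequentially"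
    using order_tendstoD(2)[OF lim1] by simp
  then have ev: "eventually (\<lambda>n. (LINT \<xi>|lborel. E n \<xi> * (cmod (ft u \<xi>))\<^sup>2) \<le> ((l2 lborel u)\<^sup>2 + 1) / ?c) sequentially"
    by eventually_elim (use cpos in \<open>simp add: field_simps\<close>)
  have int: "integrable lborel (\<lambda>\<xi>. (cmod (ft u \<xi>))\<^sup>2)"
    by (rule Fatou_integral_bound(1)[OF Ei _ l _ ev]) (use E0 in auto)
  then show sq: "sq_int lborel (ft u)" by (auto simp: sq_int_def)
  have "(\<lambda>n. LINT \<xi>|lborel. E n \<xi> * (cmod (ft u \<xi>))\<^sup>2) \<longlonglongrightarrow> (LINT \<xi>|lborel. (cmod (ft u \<xi>))\<^sup>2)"
    by (rule integral_dominated_convergence[where w="\<lambda>\<xi>. (cmod (ft u \<xi>))\<^sup>2"])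
      (use int l E0 in \<open>auto simp: abs_mult intro!: mult_left_le_one_le\<close>)
  then have "(\<lambda>n. ?c * (LINT \<xi>|lborel. E n \<xi> * (cmod (ft u \<xi>))\<^sup>2)) \<longlonglongrightarrow> ?c * (l2 lborel (ft u))\<^sup>2"
    unfolding l2_power2 by (intro tendsto_intros)
  then show "?c * (l2 lborel (ft u))\<^sup>2 = (l2 lborel u)\<^sup>2" using lim1 LIMSEQ_unique by blast
qed

section \<open>The Fourier transform of square-integrable functions\<close>

lemma tendsto_0_le:
  fixes f g :: "'a \<Rightarrow> real"
  assumes "\<And>x. 0 \<le> f x" "\<And>x. f x \<le> g x" "(g \<longlongrightarrow> 0) F" shows "(f \<longlongrightarrow> 0) F"
  using tendsto_sandwich[OF always_eventually always_eventually tendsto_const assms(3), of f] assms(1,2) by auto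

lemma L2_iff: "u \<in> L2 \<longleftrightarrow> sq_int lebesgue u"
  by (simp add: L2_def sq_int_def)

lemma sq_int_lebesgue_iff:
  fixes u :: "'a::euclidean_space \<Rightarrow> 'b::{banach,second_countable_topology}"
  assumes [measurable]: "u \<in> borel_measurable borel"
  shows "sq_int lebesgue u \<longleftrightarrow> sq_int lborel u" "l2 lebesgue u = l2 lborel u"
proof -
  have [measurable]: "u \<in> borel_measurable lebesgue" by (intro measurable_completion) simp
  show "sq_int lebesgue u \<longleftrightarrow> sq_int lborel u" by (simp add: sq_int_def integrable_completion)
  show "l2 lebesgue u = l2 lborel u" by (simp add: l2_def integral_completion)
qed

lemma lebesgue_borel_representative:
  fixes u :: "'a::euclidean_space \<Rightarrow> real"
  assumes "u \<in> borel_measurable lebesgue"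
  obtains v where "v \<in> borel_measurable borel" "v \<in> borel_measurable lebesgue" "AE x in lebesgue. u x = v x"
proof -
  obtain v where v: "v \<in> borel_measurable lborel" "AE x in lborel. u x = v x"
    using completion_ex_borel_measurable_real[OF assms] by blast
  show ?thesis
    by (rule that[of v]) (use v in \<open>auto intro: AE_completion measurable_completion\<close>)
qed

lemma AE_lebesgue_translate:
  fixes P :: "'a::euclidean_space \<Rightarrow> bool"
  assumes "AE x in lebesgue. P x" shows "AE x in lebesgue. P (x + h)"
proof -
  have "AE x in lborel. P x" using assms by (simp add: AE_completion_iff)
  then obtain N where N: "N \<in> null_sets lborel" "\<And>x. x \<notin> N \<Longrightarrow> P x"
    by (auto elim!: AE_E3)
  have "{x. x - (- h) \<in> N} \<in> null_sets lborel" by (rule null_sets_translation[OF N(1)])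
  then have "AE x in lborel. x \<notin> {x. x - (- h) \<in> N}" by (rule AE_not_in)
  then have "AE x in lborel. P (x + h)" by eventually_elim (use N(2) in auto)
  then show ?thesis by (rule AE_completion)
qed

lemma sq_int_lebesgue_translate:
  fixes u :: "'a::euclidean_space \<Rightarrow> real"
  assumes u: "sq_int lebesgue u"
  shows "sq_int lebesgue (\<lambda>x. u (x + h))" "l2 lebesgue (\<lambda>x. u (x + h)) = l2 lebesgue u"
proof -
  obtain v where v[measurable]: "v \<in> borel_measurable borel" and vl[measurable]: "v \<in> borel_measurable lebesgue"
    and uv: "AE x in lebesgue. u x = v x"
    using lebesgue_borel_representative u by (auto simp: sq_int_def)
  have T: "(\<lambda>x::'a. x + h) \<in> lebesgue \<rightarrow>\<^sub>M lebesgue"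
    using lebesgue_affine_measurable[of "\<lambda>_. 1" h] by (simp add: euclidean_representation add.commute)
  have um: "u \<in> borel_measurable lebesgue" using u by (simp add: sq_int_def)
  have utm[measurable]: "(\<lambda>x. u (x + h)) \<in> borel_measurable lebesgue" by (rule measurable_compose[OF T um])
  have vtm: "(\<lambda>x. v (x + h)) \<in> borel_measurable borel" by measurable
  have vtml[measurable]: "(\<lambda>x. v (x + h)) \<in> borel_measurable lebesgue" by (rule measurable_compose[OF T vl])
  have uvt: "AE x in lebesgue. u (x + h) = v (x + h)" by (rule AE_lebesgue_translate[OF uv])
  have vs: "sq_int lebesgue v"
    by (rule sq_int_dominated(1)[OF vl u, where C=1]) (use uv in auto)
  then have vt: "sq_int lborel (\<lambda>x. v (x + h))" "l2 lborel (\<lambda>x. v (x + h)) = l2 lborel v"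
    using sq_int_translate sq_int_lebesgue_iff[OF v] by auto
  then have vt': "sq_int lebesgue (\<lambda>x. v (x + h))" "l2 lebesgue (\<lambda>x. v (x + h)) = l2 lebesgue v"
    by (simp_all only: sq_int_lebesgue_iff[OF vtm] sq_int_lebesgue_iff[OF v])
  show "sq_int lebesgue (\<lambda>x. u (x + h))"
    by (rule sq_int_dominated(1)[OF utm vt'(1), where C=1]) (use uvt in auto)
  have "l2 lebesgue (\<lambda>x. u (x + h)) = l2 lebesgue (\<lambda>x. v (x + h))"
    by (rule l2_cong_AE) (use uvt utm vtml in auto)
  also have "\<dots> = l2 lebesgue u" unfolding vt'(2)
    by (rule l2_cong_AE) (use uv um vl in auto)
  finally show "l2 lebesgue (\<lambda>x. u (x + h)) = l2 lebesgue u" .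
qed

lemma fourier_integral_borel:
  fixes u v :: "real ^ 'n::finite \<Rightarrow> real"
  assumes "u \<in> borel_measurable lebesgue" "v \<in> borel_measurable borel" "AE x in lebesgue. u x = v x"
  shows "fourier_integral u \<xi> = complex_of_real ((2 * pi) powr (- (real CARD('n) / 2))) * ft v \<xi>"
proof -
  have vl: "v \<in> borel_measurable lebesgue" using assms(2) by (intro measurable_completion) simp
  have e: "(\<lambda>x. cis (- (\<xi> \<bullet> x))) \<in> borel_measurable borel" by measurable
  then have el: "(\<lambda>x. cis (- (\<xi> \<bullet> x))) \<in> borel_measurable lebesgue" by (intro measurable_completion) simp
  have "(LINT x|lebesgue. exp (- (\<i> * complex_of_real (\<xi> \<bullet> x))) * complex_of_real (u x))
      = (LINT x|lebesgue. cis (- (\<xi> \<bullet> x)) * complex_of_real (u x))"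
    by (simp add: cis_conv_exp)
  also have "\<dots> = (LINT x|lebesgue. cis (- (\<xi> \<bullet> x)) * complex_of_real (v x))"
    by (rule integral_cong_AE) (use assms el vl in auto)
  also have "\<dots> = ft v \<xi>"
    unfolding ft_def by (rule integral_completion) (use assms(2) e in measurable)
  finally show ?thesis by (simp add: fourier_integral_def)
qed

lemma Plancherel_fourier_integral:
  fixes u :: "real ^ 'n::finite \<Rightarrow> real"
  assumes u1: "integrable lebesgue u" and u2: "sq_int lebesgue u"
  shows "sq_int lebesgue (fourier_integral u)" "l2 lebesgue (fourier_integral u) = l2 lebesgue u"
    and "fourier_integral (\<lambda>x. u (x + h)) \<xi> = cis (\<xi> \<bullet> h) * fourier_integral u \<xi>"
proof -
  let ?c = "(2 * pi) powr (- (real CARD('n) / 2))"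
  obtain v where v[measurable]: "v \<in> borel_measurable borel" and vl[measurable]: "v \<in> borel_measurable lebesgue"
    and uv: "AE x in lebesgue. u x = v x"
    using lebesgue_borel_representative u2 by (auto simp: sq_int_def)
  have um: "u \<in> borel_measurable lebesgue" using u2 by (simp add: sq_int_def)
  have eq: "fourier_integral u = (\<lambda>\<xi>. complex_of_real ?c * ft v \<xi>)"
    by (intro ext fourier_integral_borel um v uv)
  have "sq_int lebesgue v" by (rule sq_int_dominated(1)[OF vl u2, where C=1]) (use uv in auto)
  then have v2: "sq_int lborel v" by (simp add: sq_int_lebesgue_iff)
  have "integrable lebesgue v"
    by (subst integrable_cong_AE[symmetric, OF um vl]) (use u1 uv in auto)
  then have v1: "integrable lborel v" by (simp add: integrable_completion)
  note P = Plancherel_integrable[OF v1 v2]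
  have m: "(\<lambda>\<xi>. complex_of_real ?c * ft v \<xi>) \<in> borel_measurable borel" by measurable
  show "sq_int lebesgue (fourier_integral u)"
    unfolding eq sq_int_lebesgue_iff[OF m] by (intro sq_int_cmult P)
  have "(l2 lborel (\<lambda>\<xi>. complex_of_real ?c * ft v \<xi>))\<^sup>2 = ?c\<^sup>2 * (l2 lborel (ft v))\<^sup>2"
    by (simp add: l2_cmult power_mult_distrib)
  also have "?c\<^sup>2 = (2 * pi) powr (- real DIM(real^'n))"
    by (simp add: powr_power)
  finally have "(l2 lborel (\<lambda>\<xi>. complex_of_real ?c * ft v \<xi>))\<^sup>2 = (l2 lborel v)\<^sup>2" using P(2) by simp
  then have "l2 lborel (\<lambda>\<xi>. complex_of_real ?c * ft v \<xi>) = l2 lborel v" by (simp add: power2_eq_iff_nonneg)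
  then have "l2 lebesgue (fourier_integral u) = l2 lebesgue v"
    unfolding eq sq_int_lebesgue_iff[OF m] sq_int_lebesgue_iff[OF v] .
  also have "\<dots> = l2 lebesgue u" by (rule l2_cong_AE) (use uv um vl in auto)
  finally show "l2 lebesgue (fourier_integral u) = l2 lebesgue u" .
  have utm: "(\<lambda>x. u (x + h)) \<in> borel_measurable lebesgue"
    using sq_int_lebesgue_translate(1)[OF u2] by (simp add: sq_int_def)
  have vt: "(\<lambda>x. v (x + h)) \<in> borel_measurable borel" by measurable
  have "fourier_integral (\<lambda>x. u (x + h)) \<xi> = complex_of_real ?c * ft (\<lambda>x. v (x + h)) \<xi>"
    by (rule fourier_integral_borel[OF utm vt AE_lebesgue_translate[OF uv]])
  also have "ft (\<lambda>x. v (x + h)) \<xi> = (LINT x|lborel. cis (\<xi> \<bullet> h) * (cis (- (\<xi> \<bullet> (x + h))) * complex_of_real (v (x + h))))"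
    unfolding ft_def by (intro Bochner_Integration.integral_cong refl) (simp add: mult.assoc[symmetric] cis_mult inner_add_right)
  also have "\<dots> = cis (\<xi> \<bullet> h) * (LINT x|lborel. cis (- (\<xi> \<bullet> (x + h))) * complex_of_real (v (x + h)))"
    by (rule integral_mult_right_zero)
  also have "(LINT x|lborel. cis (- (\<xi> \<bullet> (x + h))) * complex_of_real (v (x + h))) = ft v \<xi>"
    unfolding ft_def by (rule lborel_integral_translate(1)) measurable
  finally show "fourier_integral (\<lambda>x. u (x + h)) \<xi> = cis (\<xi> \<bullet> h) * fourier_integral u \<xi>"
    by (simp add: eq)
qed

lemma fourier_integral_linear:
  fixes u v :: "real ^ 'n::finite \<Rightarrow> real"
  assumes "integrable lebesgue u" "integrable lebesgue v"
  shows "fourier_integral (\<lambda>x. a * u x + b * v x) \<xi> = complex_of_real a * fourier_integral u \<xi> + complex_of_real b * fourier_integral v \<xi>"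
proof -
  let ?e = "\<lambda>x. exp (- (\<i> * complex_of_real (\<xi> \<bullet> x)))"
  have i: "integrable lebesgue (\<lambda>x. ?e x * complex_of_real (w x))" if w: "integrable lebesgue w" for w :: "real ^ 'n \<Rightarrow> real"
  proof (rule Bochner_Integration.integrable_bound[OF w])
    have e: "?e \<in> borel_measurable borel" by (intro borel_measurable_continuous_onI continuous_intros)
    have "?e \<in> borel_measurable lebesgue" by (intro measurable_completion) (use e in simp)
    moreover have "w \<in> borel_measurable lebesgue" using w by auto
    ultimately show "(\<lambda>x. ?e x * complex_of_real (w x)) \<in> borel_measurable lebesgue" by measurable
  qed (simp add: norm_mult)
  have "(LINT x|lebesgue. ?e x * complex_of_real (a * u x + b * v x))
     = (LINT x|lebesgue. complex_of_real a * (?e x * complex_of_real (u x)) + complex_of_real b * (?e x * complex_of_real (v x)))"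
    by (intro Bochner_Integration.integral_cong refl) (simp add: algebra_simps)
  also have "\<dots> = complex_of_real a * (LINT x|lebesgue. ?e x * complex_of_real (u x))
      + complex_of_real b * (LINT x|lebesgue. ?e x * complex_of_real (v x))"
    using i[OF assms(1)] i[OF assms(2)] by simp
  finally show ?thesis unfolding fourier_integral_def by (simp add: algebra_simps)
qed

definition truncate :: "real \<Rightarrow> (real ^ 'n::finite \<Rightarrow> real) \<Rightarrow> real ^ 'n \<Rightarrow> real" where
  "truncate R u = (\<lambda>x. indicator (ball 0 R) x * u x)"

lemma truncate_props:
  fixes u :: "real ^ 'n::finite \<Rightarrow> real"
  assumes u: "sq_int lebesgue u"
  shows "sq_int lebesgue (truncate R u)" "integrable lebesgue (truncate R u)"
    and "((\<lambda>R. l2 lebesgue (\<lambda>x. truncate R u x - u x)) \<longlongrightarrow> 0) at_top"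
proof -
  have um[measurable]: "u \<in> borel_measurable lebesgue" using u by (simp add: sq_int_def)
  have bm[measurable]: "ball (0::real^'n) R \<in> sets lebesgue" for R by simp
  have tm: "truncate R u \<in> borel_measurable lebesgue" for R unfolding truncate_def by measurable
  show "sq_int lebesgue (truncate R u)"
    by (rule sq_int_dominated(1)[OF tm u, where C=1]) (auto simp: truncate_def indicator_def)
  have "integrable lebesgue (indicator (ball (0::real^'n) R) :: _ \<Rightarrow> real)"
    using emeasure_bounded_finite[OF bounded_ball, of "0::real^'n" R] by (intro integrable_real_indicator) auto
  moreover have "(\<lambda>x::real^'n. (norm (indicator (ball 0 R) x :: real))\<^sup>2) = indicator (ball 0 R)"
    by (auto simp: indicator_def)
  ultimately have "sq_int lebesgue (indicator (ball (0::real^'n) R) :: _ \<Rightarrow> real)"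
    by (simp add: sq_int_def)
  from integrable_inner_sq_int[OF this u] show "integrable lebesgue (truncate R u)"
    by (simp add: truncate_def)
  show "((\<lambda>R. l2 lebesgue (\<lambda>x. truncate R u x - u x)) \<longlongrightarrow> 0) at_top"
  proof (rule tendsto_at_topI_sequentially)
    fix X :: "nat \<Rightarrow> real" assume X: "filterlim X at_top sequentially"
    show "(\<lambda>n. l2 lebesgue (\<lambda>x. truncate (X n) u x - u x)) \<longlonglongrightarrow> 0"
    proof (rule l2_dominated_convergence(3)[where w="\<lambda>x. \<bar>u x\<bar>"])
      show "sq_int lebesgue (\<lambda>x. \<bar>u x\<bar>)" using u by (simp add: sq_int_def)
      show "AE x in lebesgue. (\<lambda>n. truncate (X n) u x) \<longlonglongrightarrow> u x"
      proof (intro always_eventually allI)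
        fix x :: "real ^ 'n"
        have "eventually (\<lambda>n. norm x < X n) sequentially" using X by (simp add: filterlim_at_top_dense)
        then have "eventually (\<lambda>n. truncate (X n) u x = u x) sequentially"
          by eventually_elim (simp add: truncate_def)
        then show "(\<lambda>n. truncate (X n) u x) \<longlonglongrightarrow> u x" by (rule tendsto_eventually)
      qed
    qed (use tm in \<open>auto simp: truncate_def indicator_def\<close>)
  qed
qed

lemma fourier_integral_isometry_diff:
  fixes u v :: "real ^ 'n::finite \<Rightarrow> real"
  assumes "integrable lebesgue u" "sq_int lebesgue u" "integrable lebesgue v" "sq_int lebesgue v"
  shows "l2 lebesgue (\<lambda>\<xi>. fourier_integral u \<xi> - fourier_integral v \<xi>) = l2 lebesgue (\<lambda>x. u x - v x)"
proof -
  have "fourier_integral (\<lambda>x. u x - v x) = (\<lambda>\<xi>. fourier_integral u \<xi> - fourier_integral v \<xi>)"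
    using fourier_integral_linear[of u v 1 "-1"] assms by (simp add: fun_eq_iff)
  then show ?thesis
    using Plancherel_fourier_integral(2)[of "\<lambda>x. u x - v x"] assms by (simp add: sq_int_diff)
qed

text \<open>Recasts the defining limit as convergence in the square norm, where the triangle inequality is available.\<close>

lemma is_fourier_transform_iff:
  fixes u :: "real ^ 'n::finite \<Rightarrow> real"
  assumes u: "sq_int lebesgue u"
  shows "is_fourier_transform u g \<longleftrightarrow> sq_int lebesgue g \<and>
    ((\<lambda>R. l2 lebesgue (\<lambda>\<xi>. fourier_integral (truncate R u) \<xi> - g \<xi>)) \<longlongrightarrow> 0) at_top"
proof (cases "sq_int lebesgue g")
  case True
  have s: "sq_int lebesgue (\<lambda>\<xi>. fourier_integral (truncate R u) \<xi> - g \<xi>)" for R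
    by (intro sq_int_diff True Plancherel_fourier_integral truncate_props u)
  have "(\<integral>\<^sup>+ \<xi>. ennreal ((cmod (fourier_integral (truncate R u) \<xi> - g \<xi>))\<^sup>2) \<partial>lebesgue)
      = ennreal ((l2 lebesgue (\<lambda>\<xi>. fourier_integral (truncate R u) \<xi> - g \<xi>))\<^sup>2)" for R
    unfolding l2_power2 by (rule nn_integral_eq_integral) (use s[of R] in \<open>auto simp: sq_int_def\<close>)
  moreover have "((\<lambda>R. ennreal ((l2 lebesgue (\<lambda>\<xi>. fourier_integral (truncate R u) \<xi> - g \<xi>))\<^sup>2)) \<longlongrightarrow> 0) at_top
    \<longleftrightarrow> ((\<lambda>R. l2 lebesgue (\<lambda>\<xi>. fourier_integral (truncate R u) \<xi> - g \<xi>)) \<longlongrightarrow> 0) at_top" (is "?L \<longleftrightarrow> ?R")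
  proof
    assume ?L
    then have "((\<lambda>R. (l2 lebesgue (\<lambda>\<xi>. fourier_integral (truncate R u) \<xi> - g \<xi>))\<^sup>2) \<longlongrightarrow> 0) at_top"
      by (intro tendsto_ennrealD) auto
    from tendsto_real_sqrt[OF this] show ?R by simp
  next
    assume ?R
    from tendsto_ennrealI[OF tendsto_power[OF this, of 2]] show ?L by simp
  qed
  ultimately show ?thesis using True
    by (simp add: is_fourier_transform_def truncate_def sq_int_def)
next
  case False then show ?thesis by (auto simp: is_fourier_transform_def sq_int_def)
qed

text \<open>The truncations converge to \<open>u\<close>, so by the isometry their transforms form a Cauchy sequence.\<close>

lemma fourier_transform_exists:
  fixes u :: "real ^ 'n::finite \<Rightarrow> real"
  assumes u: "sq_int lebesgue u"
  shows "\<exists>g. is_fourier_transform u g"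
proof -
  let ?F = "\<lambda>R. fourier_integral (truncate R u)"
  let ?d = "\<lambda>R. l2 lebesgue (\<lambda>x. truncate R u x - u x)"
  note tp = truncate_props[OF u]
  have F: "sq_int lebesgue (?F R)" for R by (intro Plancherel_fourier_integral tp)
  have dF: "l2 lebesgue (\<lambda>\<xi>. ?F R \<xi> - ?F S \<xi>) \<le> ?d R + ?d S" for R S
    using l2_triangle_diff[OF tp(1)[of R] u tp(1)[of S]]
    by (simp add: fourier_integral_isometry_diff tp l2_minus_commute[of lebesgue u "truncate S u"])
  have small: "\<exists>N. \<forall>R\<ge>N. ?d R < e" if "e > 0" for e
    using order_tendstoD(2)[OF tp(3) that] by (auto simp: eventually_at_top_linorder)
  have "\<exists>N. \<forall>m\<ge>N. \<forall>n\<ge>N. l2 lebesgue (\<lambda>\<xi>. ?F (real m) \<xi> - ?F (real n) \<xi>) < e" if e: "e > 0" for e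
  proof -
    obtain N where N: "\<And>R. R \<ge> N \<Longrightarrow> ?d R < e/2" using small[of "e/2"] e by auto
    obtain M :: nat where M: "N \<le> M" using real_arch_simple by blast
    have "l2 lebesgue (\<lambda>\<xi>. ?F (real m) \<xi> - ?F (real n) \<xi>) < e" if "m \<ge> M" "n \<ge> M" for m n
      using dF[of m n] N[of "real m"] N[of "real n"] that M by force
    then show ?thesis by blast
  qed
  then obtain g where g: "sq_int lebesgue g" and lim: "(\<lambda>n. l2 lebesgue (\<lambda>\<xi>. ?F (real n) \<xi> - g \<xi>)) \<longlonglongrightarrow> 0"
    using l2_complete[of lebesgue "\<lambda>n. ?F (real n)"] F by blast
  have "((\<lambda>R. l2 lebesgue (\<lambda>\<xi>. ?F R \<xi> - g \<xi>)) \<longlongrightarrow> 0) at_top"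
  proof (rule tendstoI)
    fix e :: real assume e: "e > 0"
    obtain N where N: "\<And>R. R \<ge> N \<Longrightarrow> ?d R < e/3" using small[of "e/3"] e by auto
    have "eventually (\<lambda>n. l2 lebesgue (\<lambda>\<xi>. ?F (real n) \<xi> - g \<xi>) < e/3 \<and> N \<le> real n) sequentially"
      using order_tendstoD(2)[OF lim, of "e/3"] e filterlim_real_sequentially
      by (intro eventually_conj) (auto simp: filterlim_at_top)
    then obtain n where n: "l2 lebesgue (\<lambda>\<xi>. ?F (real n) \<xi> - g \<xi>) < e/3" "N \<le> real n"
      by (auto simp: eventually_sequentially)
    have "dist (l2 lebesgue (\<lambda>\<xi>. ?F R \<xi> - g \<xi>)) 0 < e" if "R \<ge> N" for R
      using l2_triangle_diff[OF F[of R] F[of n] g] dF[of R n] N[of R] N[of "real n"] n that by simp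
    then show "eventually (\<lambda>R. dist (l2 lebesgue (\<lambda>\<xi>. ?F R \<xi> - g \<xi>)) 0 < e) at_top"
      by (auto simp: eventually_at_top_linorder)
  qed
  with g show ?thesis by (auto simp: is_fourier_transform_iff[OF u])
qed

lemma fourier_props:
  fixes u :: "real ^ 'n::finite \<Rightarrow> real"
  assumes u: "sq_int lebesgue u"
  shows "sq_int lebesgue (fourier u)"
    and "((\<lambda>R. l2 lebesgue (\<lambda>\<xi>. fourier_integral (truncate R u) \<xi> - fourier u \<xi>)) \<longlongrightarrow> 0) at_top"
    and "l2 lebesgue (fourier u) = l2 lebesgue u"
proof -
  have "is_fourier_transform u (fourier u)"
    unfolding fourier_def by (rule someI_ex[OF fourier_transform_exists[OF u]])
  then show s: "sq_int lebesgue (fourier u)"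
    and l: "((\<lambda>R. l2 lebesgue (\<lambda>\<xi>. fourier_integral (truncate R u) \<xi> - fourier u \<xi>)) \<longlongrightarrow> 0) at_top"
    by (auto simp: is_fourier_transform_iff[OF u])
  note tp = truncate_props[OF u]
  have "((\<lambda>R. l2 lebesgue (fourier_integral (truncate R u))) \<longlongrightarrow> l2 lebesgue (fourier u)) at_top"
    by (rule l2_tendsto[OF _ s l]) (intro Plancherel_fourier_integral tp)
  moreover have "((\<lambda>R. l2 lebesgue (truncate R u)) \<longlongrightarrow> l2 lebesgue u) at_top"
    by (rule l2_tendsto[OF tp(1) u tp(3)])
  ultimately show "l2 lebesgue (fourier u) = l2 lebesgue u"
    using tendsto_unique[OF trivial_limit_at_top_linorder] by (simp add: Plancherel_fourier_integral tp)
qed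

lemma fourier_unique:
  fixes u :: "real ^ 'n::finite \<Rightarrow> real"
  assumes u: "sq_int lebesgue u" and g: "sq_int lebesgue g"
    and l: "((\<lambda>R. l2 lebesgue (\<lambda>\<xi>. fourier_integral (truncate R u) \<xi> - g \<xi>)) \<longlongrightarrow> 0) at_top"
  shows "AE \<xi> in lebesgue. fourier u \<xi> = g \<xi>"
proof -
  note fp = fourier_props[OF u]
  have F: "sq_int lebesgue (fourier_integral (truncate R u))" for R
    by (intro Plancherel_fourier_integral truncate_props u)
  have "((\<lambda>R. l2 lebesgue (\<lambda>\<xi>. fourier_integral (truncate R u) \<xi> - fourier u \<xi>)
      + l2 lebesgue (\<lambda>\<xi>. fourier_integral (truncate R u) \<xi> - g \<xi>)) \<longlongrightarrow> 0 + 0) at_top"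
    by (intro tendsto_intros fp l)
  moreover have "l2 lebesgue (\<lambda>\<xi>. fourier u \<xi> - g \<xi>) \<le> l2 lebesgue (\<lambda>\<xi>. fourier_integral (truncate R u) \<xi> - fourier u \<xi>)
      + l2 lebesgue (\<lambda>\<xi>. fourier_integral (truncate R u) \<xi> - g \<xi>)" for R
    using l2_triangle_diff[OF fp(1) F[of R] g] by (simp add: l2_minus_commute[of lebesgue "fourier u" "fourier_integral (truncate R u)"])
  ultimately have "l2 lebesgue (\<lambda>\<xi>. fourier u \<xi> - g \<xi>) \<le> 0 + 0"
    using tendsto_lowerbound[OF _ always_eventually[OF allI] trivial_limit_at_top_linorder] by blast
  then have "l2 lebesgue (\<lambda>\<xi>. fourier u \<xi> - g \<xi>) = 0" using l2_nonneg[of lebesgue "\<lambda>\<xi>. fourier u \<xi> - g \<xi>"] by linarith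
  then show ?thesis using l2_eq_0_iff[OF sq_int_diff[OF fp(1) g]] by simp
qed

lemma fourier_linear:
  fixes u v :: "real ^ 'n::finite \<Rightarrow> real"
  assumes u: "sq_int lebesgue u" and v: "sq_int lebesgue v"
  shows "AE \<xi> in lebesgue. fourier (\<lambda>x. a * u x + b * v x) \<xi> = complex_of_real a * fourier u \<xi> + complex_of_real b * fourier v \<xi>"
proof (rule fourier_unique)
  note fu = fourier_props[OF u] and fv = fourier_props[OF v]
  note tu = truncate_props[OF u] and tv = truncate_props[OF v]
  show w: "sq_int lebesgue (\<lambda>x. a * u x + b * v x)" by (intro sq_int_add sq_int_cmult u v)
  show g: "sq_int lebesgue (\<lambda>\<xi>. complex_of_real a * fourier u \<xi> + complex_of_real b * fourier v \<xi>)"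
    by (intro sq_int_add sq_int_cmult fu fv)
  let ?U = "\<lambda>R \<xi>. fourier_integral (truncate R u) \<xi> - fourier u \<xi>" and ?V = "\<lambda>R \<xi>. fourier_integral (truncate R v) \<xi> - fourier v \<xi>"
  have s: "sq_int lebesgue (?U R)" "sq_int lebesgue (?V R)" for R
    by (intro sq_int_diff Plancherel_fourier_integral tu tv fu fv)+
  have "truncate R (\<lambda>x. a * u x + b * v x) = (\<lambda>x. a * truncate R u x + b * truncate R v x)" for R
    by (auto simp: truncate_def algebra_simps)
  then have eq: "fourier_integral (truncate R (\<lambda>x. a * u x + b * v x)) \<xi> - (complex_of_real a * fourier u \<xi> + complex_of_real b * fourier v \<xi>)
      = complex_of_real a * ?U R \<xi> + complex_of_real b * ?V R \<xi>" for R \<xi>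
    by (simp add: fourier_integral_linear tu tv algebra_simps)
  have le: "l2 lebesgue (\<lambda>\<xi>. complex_of_real a * ?U R \<xi> + complex_of_real b * ?V R \<xi>) \<le> \<bar>a\<bar> * l2 lebesgue (?U R) + \<bar>b\<bar> * l2 lebesgue (?V R)" for R
    using l2_triangle[OF sq_int_cmult[OF s(1)] sq_int_cmult[OF s(2)], of "complex_of_real a" R "complex_of_real b" R]
    unfolding l2_cmult norm_of_real .
  have "((\<lambda>R. \<bar>a\<bar> * l2 lebesgue (?U R) + \<bar>b\<bar> * l2 lebesgue (?V R)) \<longlongrightarrow> \<bar>a\<bar> * 0 + \<bar>b\<bar> * 0) at_top"
    by (intro tendsto_intros fu fv)
  then have "((\<lambda>R. \<bar>a\<bar> * l2 lebesgue (?U R) + \<bar>b\<bar> * l2 lebesgue (?V R)) \<longlongrightarrow> 0) at_top" by simp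
  then show "((\<lambda>R. l2 lebesgue (\<lambda>\<xi>. fourier_integral (truncate R (\<lambda>x. a * u x + b * v x)) \<xi> - (complex_of_real a * fourier u \<xi> + complex_of_real b * fourier v \<xi>))) \<longlongrightarrow> 0) at_top"
    unfolding eq by (rule tendsto_0_le[OF l2_nonneg le])
qed

text \<open>Truncating to a ball and translating commute up to an error that vanishes in the square mean as the
  radius grows.\<close>

lemma fourier_translate:
  fixes u :: "real ^ 'n::finite \<Rightarrow> real"
  assumes u: "sq_int lebesgue u"
  shows "AE \<xi> in lebesgue. fourier (\<lambda>x. u (x + h)) \<xi> = cis (\<xi> \<bullet> h) * fourier u \<xi>"
proof (rule fourier_unique)
  let ?t = "\<lambda>x. u (x + h)"
  show t: "sq_int lebesgue ?t" by (rule sq_int_lebesgue_translate[OF u])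
  note fu = fourier_props[OF u] and tu = truncate_props[OF u] and tt = truncate_props[OF t]
  have cm: "(\<lambda>\<xi>::real^'n. cis (\<xi> \<bullet> h)) \<in> borel_measurable borel" by measurable
  have cm'[measurable]: "(\<lambda>\<xi>::real^'n. cis (\<xi> \<bullet> h)) \<in> borel_measurable lebesgue"
    by (intro measurable_completion) (use cm in simp)
  have cs: "sq_int lebesgue (\<lambda>\<xi>. cis (\<xi> \<bullet> h) * w \<xi>)" "l2 lebesgue (\<lambda>\<xi>. cis (\<xi> \<bullet> h) * w \<xi>) = l2 lebesgue w"
    if w: "sq_int lebesgue w" for w :: "real ^ 'n \<Rightarrow> complex"
  proof -
    have [measurable]: "w \<in> borel_measurable lebesgue" using w by (simp add: sq_int_def)
    show "sq_int lebesgue (\<lambda>\<xi>. cis (\<xi> \<bullet> h) * w \<xi>)" using w by (simp add: sq_int_def norm_mult)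
    show "l2 lebesgue (\<lambda>\<xi>. cis (\<xi> \<bullet> h) * w \<xi>) = l2 lebesgue w" by (simp add: l2_def norm_mult)
  qed
  show g: "sq_int lebesgue (\<lambda>\<xi>. cis (\<xi> \<bullet> h) * fourier u \<xi>)" by (intro cs fu)
  have le: "l2 lebesgue (\<lambda>\<xi>. fourier_integral (truncate R ?t) \<xi> - cis (\<xi> \<bullet> h) * fourier u \<xi>)
    \<le> l2 lebesgue (\<lambda>x. truncate R ?t x - ?t x) + l2 lebesgue (\<lambda>x. truncate R u x - u x)
      + l2 lebesgue (\<lambda>\<xi>. fourier_integral (truncate R u) \<xi> - fourier u \<xi>)" for R
  proof -
    let ?s = "\<lambda>x. truncate R u (x + h)"
    have ss: "sq_int lebesgue ?s" by (rule sq_int_lebesgue_translate[OF tu(1)])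
    have si: "integrable lebesgue ?s"
    proof -
      have "?s = truncate (R + norm h) ?s"
      proof
        fix x
        have "norm x \<le> norm (x + h) + norm h" using norm_triangle_ineq4[of "x + h" h] by simp
        then show "?s x = truncate (R + norm h) ?s x" by (auto simp: truncate_def indicator_def)
      qed
      then show ?thesis using truncate_props(2)[OF ss, of "R + norm h"] by simp
    qed
    have Fs: "fourier_integral ?s = (\<lambda>\<xi>. cis (\<xi> \<bullet> h) * fourier_integral (truncate R u) \<xi>)"
      by (intro ext Plancherel_fourier_integral tu)
    have "l2 lebesgue (\<lambda>\<xi>. fourier_integral (truncate R ?t) \<xi> - cis (\<xi> \<bullet> h) * fourier u \<xi>)
      \<le> l2 lebesgue (\<lambda>\<xi>. fourier_integral (truncate R ?t) \<xi> - fourier_integral ?s \<xi>)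
        + l2 lebesgue (\<lambda>\<xi>. fourier_integral ?s \<xi> - cis (\<xi> \<bullet> h) * fourier u \<xi>)"
      by (intro l2_triangle_diff Plancherel_fourier_integral tt g ss si)
    also have "l2 lebesgue (\<lambda>\<xi>. fourier_integral (truncate R ?t) \<xi> - fourier_integral ?s \<xi>)
      = l2 lebesgue (\<lambda>x. truncate R ?t x - ?s x)"
      by (intro fourier_integral_isometry_diff tt ss si)
    also have "\<dots> \<le> l2 lebesgue (\<lambda>x. truncate R ?t x - ?t x) + l2 lebesgue (\<lambda>x. ?t x - ?s x)"
      by (intro l2_triangle_diff tt t ss)
    also have "l2 lebesgue (\<lambda>x. ?t x - ?s x) = l2 lebesgue (\<lambda>x. truncate R u x - u x)"
      using sq_int_lebesgue_translate(2)[OF sq_int_diff[OF u tu(1)], of h R] by (simp add: l2_minus_commute[of lebesgue u "truncate R u"])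
    also have "l2 lebesgue (\<lambda>\<xi>. fourier_integral ?s \<xi> - cis (\<xi> \<bullet> h) * fourier u \<xi>)
      = l2 lebesgue (\<lambda>\<xi>. cis (\<xi> \<bullet> h) * (fourier_integral (truncate R u) \<xi> - fourier u \<xi>))"
      by (simp add: Fs right_diff_distrib)
    also have "\<dots> = l2 lebesgue (\<lambda>\<xi>. fourier_integral (truncate R u) \<xi> - fourier u \<xi>)"
      by (intro cs sq_int_diff Plancherel_fourier_integral tu fu)
    finally show ?thesis by simp
  qed
  have "((\<lambda>R. l2 lebesgue (\<lambda>x. truncate R ?t x - ?t x) + l2 lebesgue (\<lambda>x. truncate R u x - u x)
      + l2 lebesgue (\<lambda>\<xi>. fourier_integral (truncate R u) \<xi> - fourier u \<xi>)) \<longlongrightarrow> 0 + 0 + 0) at_top"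
    by (intro tendsto_add tt tu fu)
  then have "((\<lambda>R. l2 lebesgue (\<lambda>x. truncate R ?t x - ?t x) + l2 lebesgue (\<lambda>x. truncate R u x - u x)
      + l2 lebesgue (\<lambda>\<xi>. fourier_integral (truncate R u) \<xi> - fourier u \<xi>)) \<longlongrightarrow> 0) at_top" by simp
  then show "((\<lambda>R. l2 lebesgue (\<lambda>\<xi>. fourier_integral (truncate R ?t) \<xi> - cis (\<xi> \<bullet> h) * fourier u \<xi>)) \<longlongrightarrow> 0) at_top"
    by (rule tendsto_0_le[OF l2_nonneg le])
qed

text \<open>A difference operator turns into multiplication by a factor that is small where \<open>\<xi>\<close> is; weighing this factor
  against the kinetic energy yields the translation bound.\<close>

lemma l2_translate_diff_fourier:
  fixes u :: "real ^ 'n::finite \<Rightarrow> real"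
  assumes u: "sq_int lebesgue u"
  shows "integrable lebesgue (\<lambda>\<xi>. (cmod (cis (\<xi> \<bullet> h) - 1))\<^sup>2 * (cmod (fourier u \<xi>))\<^sup>2)"
    and "(l2 lebesgue (\<lambda>x. u (x + h) - u x))\<^sup>2 = (LINT \<xi>|lebesgue. (cmod (cis (\<xi> \<bullet> h) - 1))\<^sup>2 * (cmod (fourier u \<xi>))\<^sup>2)"
proof -
  have t: "sq_int lebesgue (\<lambda>x. u (x + h))" by (rule sq_int_lebesgue_translate[OF u])
  have d: "sq_int lebesgue (\<lambda>x. u (x + h) - u x)" by (intro sq_int_diff t u)
  note fu = fourier_props(1)[OF u] and fd = fourier_props[OF d]
  have [measurable]: "fourier u \<in> borel_measurable lebesgue" "fourier (\<lambda>x. u (x + h) - u x) \<in> borel_measurable lebesgue"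
    using fu fd by (auto simp: sq_int_def)
  have cm: "(\<lambda>\<xi>::real^'n. cis (\<xi> \<bullet> h)) \<in> borel_measurable borel" by measurable
  have cm'[measurable]: "(\<lambda>\<xi>::real^'n. cis (\<xi> \<bullet> h)) \<in> borel_measurable lebesgue"
    by (intro measurable_completion) (use cm in simp)
  have "AE \<xi> in lebesgue. fourier (\<lambda>x. u (x + h) - u x) \<xi> = (cis (\<xi> \<bullet> h) - 1) * fourier u \<xi>"
    using fourier_linear[OF t u, of 1 "-1"] fourier_translate[OF u, of h]
    by eventually_elim (simp add: algebra_simps)
  then have ae: "AE \<xi> in lebesgue. (cmod (fourier (\<lambda>x. u (x + h) - u x) \<xi>))\<^sup>2 = (cmod (cis (\<xi> \<bullet> h) - 1))\<^sup>2 * (cmod (fourier u \<xi>))\<^sup>2"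
    by eventually_elim (simp add: norm_mult power_mult_distrib)
  show "integrable lebesgue (\<lambda>\<xi>. (cmod (cis (\<xi> \<bullet> h) - 1))\<^sup>2 * (cmod (fourier u \<xi>))\<^sup>2)"
    by (subst integrable_cong_AE[symmetric, OF _ _ ae]) (use fd in \<open>auto simp: sq_int_def\<close>)
  show "(l2 lebesgue (\<lambda>x. u (x + h) - u x))\<^sup>2 = (LINT \<xi>|lebesgue. (cmod (cis (\<xi> \<bullet> h) - 1))\<^sup>2 * (cmod (fourier u \<xi>))\<^sup>2)"
    unfolding fd(3)[symmetric] l2_power2 by (rule integral_cong_AE[OF _ _ ae]) auto
qed

section \<open>The energy space\<close>

locale confining_potential =
  fixes \<alpha> :: real and V :: "real ^ 'n::finite \<Rightarrow> real"
  assumes \<alpha>: "0 < \<alpha>" "\<alpha> \<le> 2" "\<alpha> < real CARD('n)" and V: "cond_V V"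
begin

abbreviation "E \<equiv> energy_space \<alpha> V"
abbreviation "nrm \<equiv> energy_norm \<alpha> V"

definition V0 :: real where "V0 = (INF x. V x)"

lemma V_continuous: "continuous_on UNIV V" and V_filterlim: "filterlim V at_top at_infinity" and V0_pos: "0 < V0"
  using V by (auto simp: cond_V_def V0_def)

lemma V_measurable: "V \<in> borel_measurable borel"
  using V_continuous by (rule borel_measurable_continuous_onI)

lemma V_measurable' [measurable]: "V \<in> borel_measurable lebesgue"
  by (intro measurable_completion) (use V_measurable in simp)

text \<open>The infimum is a lower bound only because \<open>V\<close> is bounded below: on a ball by continuity, outside by growth.\<close>

lemma V_ge: "V0 \<le> V x"
  unfolding V0_def
proof (rule cINF_lower)
  show "bdd_below (range V)"
  proof -
    have "eventually (\<lambda>x. 0 \<le> V x) at_infinity" using V_filterlim by (simp add: filterlim_at_top)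
    then obtain R where R: "\<And>x. R \<le> norm x \<Longrightarrow> 0 \<le> V x" by (auto simp: eventually_at_infinity)
    have "compact (V ` cball 0 R)" by (intro compact_continuous_image continuous_on_subset[OF V_continuous]) auto
    then obtain B where B: "\<forall>y\<in>V ` cball 0 R. norm y \<le> B" using compact_imp_bounded bounded_iff by metis
    have "min 0 (- B) \<le> V x" for x
    proof (cases "norm x \<le> R")
      case True then have "norm (V x) \<le> B" using B by simp
      then show ?thesis by (auto simp: min_le_iff_disj)
    next
      case False then show ?thesis using R[of x] by (auto simp: min_le_iff_disj)
    qed
    then show ?thesis by (intro bdd_belowI[of _ "min 0 (- B)"]) auto
  qed
qed simp

lemma V_pos: "0 < V x" using V_ge[of x] V0_pos by linarith

text \<open>The energy norm is the Hilbert sum of the two weighted square norms below; all of its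
  algebra comes from this.\<close>

definition kin :: "(real ^ 'n \<Rightarrow> real) \<Rightarrow> real ^ 'n \<Rightarrow> complex" where
  "kin u \<xi> = (norm \<xi> powr (\<alpha> / 2)) *\<^sub>R fourier u \<xi>"

definition pot :: "(real ^ 'n \<Rightarrow> real) \<Rightarrow> real ^ 'n \<Rightarrow> real" where
  "pot u x = sqrt (V x) * u x"

lemma kin_power2: "(norm (kin u \<xi>))\<^sup>2 = norm \<xi> powr \<alpha> * (cmod (fourier u \<xi>))\<^sup>2"
proof -
  have "(norm \<xi> powr (\<alpha> / 2))\<^sup>2 = norm \<xi> powr \<alpha>"
    by (simp add: power2_eq_square flip: powr_add)
  then show ?thesis by (simp add: kin_def power_mult_distrib)
qed

lemma pot_power2: "(norm (pot u x))\<^sup>2 = V x * (u x)\<^sup>2"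
  using V_pos[of x] by (simp add: pot_def power_mult_distrib)

lemma pot_square: "(pot u x)\<^sup>2 = V x * (u x)\<^sup>2"
  using pot_power2[of u x] by simp

lemma norm_powr_measurable [measurable]: "(\<lambda>\<xi>::real^'n. norm \<xi> powr a) \<in> borel_measurable lebesgue"
proof -
  have "(\<lambda>\<xi>::real^'n. norm \<xi> powr a) \<in> borel_measurable borel" by measurable
  then show ?thesis by (intro measurable_completion) simp
qed

lemma pot_measurable: "u \<in> borel_measurable lebesgue \<Longrightarrow> pot u \<in> borel_measurable lebesgue"
  unfolding pot_def[abs_def] by measurable

lemma kin_measurable: "fourier u \<in> borel_measurable lebesgue \<Longrightarrow> kin u \<in> borel_measurable lebesgue"
  unfolding kin_def[abs_def] by measurable

lemma E_iff: "u \<in> E \<longleftrightarrow> sq_int lebesgue u \<and> sq_int lebesgue (kin u) \<and> sq_int lebesgue (pot u)"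
proof (cases "sq_int lebesgue u")
  case True
  then have "u \<in> borel_measurable lebesgue" "fourier u \<in> borel_measurable lebesgue"
    using fourier_props(1)[OF True] by (auto simp: sq_int_def)
  then show ?thesis
    using True by (simp add: energy_space_def L2_iff sq_int_def[of _ "kin u"] sq_int_def[of _ "pot u"] kin_power2 pot_square
        kin_measurable pot_measurable)
next
  case False then show ?thesis by (simp add: energy_space_def L2_iff)
qed

lemma nrm_power2: "(nrm u)\<^sup>2 = (l2 lebesgue (kin u))\<^sup>2 + (l2 lebesgue (pot u))\<^sup>2"
proof -
  have "0 \<le> (l2 lebesgue (kin u))\<^sup>2 + (l2 lebesgue (pot u))\<^sup>2" by simp
  then show ?thesis unfolding energy_norm_def l2_power2 kin_power2 pot_power2 by simp
qed

lemma nrm_nonneg [simp]: "0 \<le> nrm u"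
proof -
  have "0 \<le> (l2 lebesgue (kin u))\<^sup>2 + (l2 lebesgue (pot u))\<^sup>2" by simp
  then show ?thesis unfolding energy_norm_def l2_power2 kin_power2 pot_power2 by simp
qed

lemma kin_le_nrm: "l2 lebesgue (kin u) \<le> nrm u" and pot_le_nrm: "l2 lebesgue (pot u) \<le> nrm u"
  using power2_le_imp_le[OF _ nrm_nonneg, of _ u] nrm_power2[of u] by auto

lemma kin_linear:
  assumes "sq_int lebesgue u" "sq_int lebesgue v"
  shows "AE \<xi> in lebesgue. kin (\<lambda>x. a * u x + b * v x) \<xi> = a *\<^sub>R kin u \<xi> + b *\<^sub>R kin v \<xi>"
  using fourier_linear[OF assms, of a b]
  by eventually_elim (simp add: kin_def scaleR_conv_of_real algebra_simps)

lemma pot_linear: "pot (\<lambda>x. a * u x + b * v x) = (\<lambda>x. a * pot u x + b * pot v x)"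
  by (simp add: pot_def fun_eq_iff algebra_simps)

lemma E_D:
  assumes "u \<in> E" shows "sq_int lebesgue u" "sq_int lebesgue (kin u)" "sq_int lebesgue (pot u)"
    "u \<in> borel_measurable lebesgue" "kin u \<in> borel_measurable lebesgue" "pot u \<in> borel_measurable lebesgue"
  using assms by (auto simp: E_iff sq_int_def)

lemma E_linear:
  assumes u: "u \<in> E" and v: "v \<in> E" shows "(\<lambda>x. a * u x + b * v x) \<in> E"
  unfolding E_iff
proof (intro conjI)
  note uD = E_D[OF u] and vD = E_D[OF v]
  show w: "sq_int lebesgue (\<lambda>x. a * u x + b * v x)" by (intro sq_int_add sq_int_cmult uD vD)
  show "sq_int lebesgue (pot (\<lambda>x. a * u x + b * v x))"
    unfolding pot_linear by (intro sq_int_add sq_int_cmult uD vD)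
  have "kin (\<lambda>x. a * u x + b * v x) \<in> borel_measurable lebesgue"
    using fourier_props(1)[OF w] by (intro kin_measurable) (simp add: sq_int_def)
  then show "sq_int lebesgue (kin (\<lambda>x. a * u x + b * v x))"
    by (rule sq_int_dominated(1)[where g="\<lambda>\<xi>. a *\<^sub>R kin u \<xi> + b *\<^sub>R kin v \<xi>" and C=1])
      (use kin_linear[OF uD(1) vD(1), of a b] in \<open>auto intro!: sq_int_add sq_int_scaleR uD vD\<close>)
qed

lemma E_add: "u \<in> E \<Longrightarrow> v \<in> E \<Longrightarrow> (\<lambda>x. u x + v x) \<in> E"
  using E_linear[of u v 1 1] by simp

lemma E_diff: "u \<in> E \<Longrightarrow> v \<in> E \<Longrightarrow> (\<lambda>x. u x - v x) \<in> E"
  using E_linear[of u v 1 "-1"] by simp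

lemma E_scale: "u \<in> E \<Longrightarrow> (\<lambda>x. a * u x) \<in> E"
  using E_linear[of u u a 0] by simp

text \<open>The inner product that belongs to the energy norm.\<close>

definition B :: "(real ^ 'n \<Rightarrow> real) \<Rightarrow> (real ^ 'n \<Rightarrow> real) \<Rightarrow> real" where
  "B u v = (LINT \<xi>|lebesgue. kin u \<xi> \<bullet> kin v \<xi>) + (LINT x|lebesgue. pot u x * pot v x)"

lemma integrable_kin_inner:
  assumes u: "u \<in> E" and v: "v \<in> E" shows "integrable lebesgue (\<lambda>\<xi>. kin u \<xi> \<bullet> kin v \<xi>)"
proof -
  note m = E_D[OF u] E_D[OF v]
  have "integrable lebesgue (\<lambda>\<xi>. norm (kin u \<xi>) * norm (kin v \<xi>))"
    using m by (intro integrable_inner_sq_int) (auto simp: sq_int_def)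
  then show ?thesis
  proof (rule Bochner_Integration.integrable_bound)
    show "(\<lambda>\<xi>. kin u \<xi> \<bullet> kin v \<xi>) \<in> borel_measurable lebesgue"
      using m by (intro borel_measurable_inner) auto
  qed (auto simp: Cauchy_Schwarz_ineq2)
qed

lemma integrable_pot_mult:
  assumes u: "u \<in> E" and v: "v \<in> E" shows "integrable lebesgue (\<lambda>x. pot u x * pot v x)"
  using E_D[OF u] E_D[OF v] by (intro integrable_inner_sq_int) auto

lemma B_self: "B u u = (nrm u)\<^sup>2"
  unfolding B_def nrm_power2 l2_power2 by (simp add: dot_square_norm power2_eq_square)

lemma B_commute: "B u v = B v u"
  unfolding B_def by (simp add: inner_commute mult.commute)

lemma B_linear:
  assumes u: "u \<in> E" and v: "v \<in> E" and w: "w \<in> E"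
  shows "B w (\<lambda>x. a * u x + b * v x) = a * B w u + b * B w v"
proof -
  note D = E_D[OF u] E_D[OF v] E_D[OF w] E_D[OF E_linear[OF u v, of a b]]
  have "(LINT \<xi>|lebesgue. kin w \<xi> \<bullet> kin (\<lambda>x. a * u x + b * v x) \<xi>)
    = (LINT \<xi>|lebesgue. a * (kin w \<xi> \<bullet> kin u \<xi>) + b * (kin w \<xi> \<bullet> kin v \<xi>))"
  proof (rule integral_cong_AE)
    show "AE \<xi> in lebesgue. kin w \<xi> \<bullet> kin (\<lambda>x. a * u x + b * v x) \<xi> = a * (kin w \<xi> \<bullet> kin u \<xi>) + b * (kin w \<xi> \<bullet> kin v \<xi>)"
      using kin_linear[OF E_D(1)[OF u] E_D(1)[OF v], of a b] by eventually_elim (simp add: inner_add_right)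
  qed (use D in \<open>auto intro!: borel_measurable_inner borel_measurable_add borel_measurable_times\<close>)
  also have "\<dots> = a * (LINT \<xi>|lebesgue. kin w \<xi> \<bullet> kin u \<xi>) + b * (LINT \<xi>|lebesgue. kin w \<xi> \<bullet> kin v \<xi>)"
    using integrable_kin_inner[OF w u] integrable_kin_inner[OF w v] by simp
  moreover have "(LINT x|lebesgue. pot w x * pot (\<lambda>x. a * u x + b * v x) x)
     = (LINT x|lebesgue. a * (pot w x * pot u x) + b * (pot w x * pot v x))"
    by (simp add: pot_linear algebra_simps)
  moreover have "\<dots> = a * (LINT x|lebesgue. pot w x * pot u x) + b * (LINT x|lebesgue. pot w x * pot v x)"
    using integrable_pot_mult[OF w u] integrable_pot_mult[OF w v] by simp
  ultimately show ?thesis by (simp add: B_def algebra_simps)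
qed

lemma nrm_linear_power2:
  assumes u: "u \<in> E" and v: "v \<in> E"
  shows "(nrm (\<lambda>x. a * u x + b * v x))\<^sup>2 = a\<^sup>2 * (nrm u)\<^sup>2 + 2 * a * b * B u v + b\<^sup>2 * (nrm v)\<^sup>2"
  using B_linear[OF u v E_linear[OF u v, of a b], of a b] B_linear[OF u v u, of a b] B_linear[OF u v v, of a b]
  by (simp add: B_self B_commute[of "\<lambda>x. a * u x + b * v x"] B_commute[of v u] power2_eq_square algebra_simps)

lemma nrm_scale: "u \<in> E \<Longrightarrow> nrm (\<lambda>x. a * u x) = \<bar>a\<bar> * nrm u"
  using nrm_linear_power2[of u u a 0] power2_eq_iff_nonneg[of "nrm (\<lambda>x. a * u x)" "\<bar>a\<bar> * nrm u"]
  by (simp add: power_mult_distrib)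

text \<open>The squared norm of combinations of \<open>u\<close> and \<open>v\<close> is nonnegative. The weights are shifted by \<open>e\<close> so that
  vanishing norms need no separate treatment.\<close>

lemma B_bound:
  assumes u: "u \<in> E" and v: "v \<in> E" shows "\<bar>B u v\<bar> \<le> nrm u * nrm v"
proof -
  have *: "\<bar>B u v\<bar> \<le> (nrm u + e) * (nrm v + e)" if e: "e > 0" for e
  proof -
    have p: "nrm u + e > 0" "nrm v + e > 0" using e nrm_nonneg[of u] nrm_nonneg[of v] by linarith+
    let ?a = "nrm v + e" and ?b = "nrm u + e"
    have le: "?a\<^sup>2 * (nrm u)\<^sup>2 + ?b\<^sup>2 * (nrm v)\<^sup>2 \<le> ?a\<^sup>2 * ?b\<^sup>2 + ?b\<^sup>2 * ?a\<^sup>2"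
      using e by (intro add_mono mult_left_mono power_mono) auto
    have s: "0 \<le> ?a\<^sup>2 * (nrm u)\<^sup>2 + 2 * ?a * (s * ?b) * B u v + (s * ?b)\<^sup>2 * (nrm v)\<^sup>2" for s
      using nrm_linear_power2[OF u v, of ?a "s * ?b"] by (metis zero_le_power2)
    have "(?a * ?b) * \<bar>B u v\<bar> \<le> (?a * ?b) * (?a * ?b)"
      using s[of 1] s[of "-1"] le by (cases "0 \<le> B u v") (simp_all add: power2_eq_square algebra_simps)
    then have "\<bar>B u v\<bar> \<le> ?a * ?b" using mult_left_le_imp_le mult_pos_pos[OF p(2,1)] by blast
    then show ?thesis by (simp add: mult.commute)
  qed
  have "((\<lambda>e. (nrm u + e) * (nrm v + e)) \<longlongrightarrow> (nrm u + 0) * (nrm v + 0)) (at_right 0)"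
    by (intro tendsto_intros)
  moreover have "eventually (\<lambda>e. \<bar>B u v\<bar> \<le> (nrm u + e) * (nrm v + e)) (at_right 0)"
    using * by (simp add: eventually_at_filter)
  ultimately show ?thesis using tendsto_lowerbound[of _ _ "at_right 0"] by fastforce
qed

lemma l2_le_nrm:
  assumes u: "u \<in> E" shows "l2 lebesgue u \<le> nrm u / sqrt V0"
proof -
  have "l2 lebesgue u \<le> (1 / sqrt V0) * l2 lebesgue (pot u)"
  proof (rule sq_int_dominated(2)[OF E_D(4)[OF u] E_D(3)[OF u]])
    have "sqrt V0 * \<bar>u x\<bar> \<le> sqrt (V x) * \<bar>u x\<bar>" for x by (intro mult_right_mono) (auto simp: V_ge)
    then show "AE x in lebesgue. norm (u x) \<le> 1 / sqrt V0 * norm (pot u x)"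
      using V0_pos V_pos less_imp_le[OF V_pos] by (simp add: pot_def abs_mult field_simps)
  qed (use V0_pos in simp)
  also have "\<dots> \<le> (1 / sqrt V0) * nrm u" using pot_le_nrm[of u] V0_pos by (intro mult_left_mono) auto
  finally show ?thesis by simp
qed

lemma nrm_eq_0_imp:
  assumes u: "u \<in> E" and "nrm u = 0" shows "AE x in lebesgue. u x = 0"
proof -
  have "l2 lebesgue u = 0" using l2_le_nrm[OF u] l2_nonneg[of lebesgue u] assms(2) by simp
  then show ?thesis using l2_eq_0_iff[OF E_D(1)[OF u]] by simp
qed

lemma cmod_cis_minus_1: "(cmod (cis t - 1))\<^sup>2 = (2 * sin (t/2))\<^sup>2"
proof -
  have "(cmod (cis t - 1))\<^sup>2 = (cos t - 1)\<^sup>2 + (sin t)\<^sup>2" by (simp add: cmod_power2)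
  also have "\<dots> = 2 - 2 * cos t" using sin_cos_squared_add[of t] by (simp add: power2_eq_square algebra_simps)
  also have "cos t = 1 - 2 * (sin (t/2))\<^sup>2" using cos_double_sin[of "t/2"] by simp
  finally show ?thesis by (simp add: power_mult_distrib)
qed

text \<open>This is where \<open>\<alpha> \<le> 2\<close> enters: near \<open>0\<close> the left-hand side is quadratic.\<close>

lemma cmod_cis_minus_1_le: "(cmod (cis t - 1))\<^sup>2 \<le> 4 * \<bar>t\<bar> powr \<alpha>"
proof (cases "\<bar>t\<bar> \<le> 1")
  case True
  have "\<bar>2 * sin (t/2)\<bar> \<le> \<bar>t\<bar>" using abs_sin_x_le_abs_x[of "t/2"] by simp
  then have "(2 * sin (t/2))\<^sup>2 \<le> \<bar>t\<bar>\<^sup>2" by (metis abs_ge_zero power2_abs power_mono)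
  also have "\<dots> \<le> \<bar>t\<bar> powr \<alpha>"
  proof (cases "t = 0")
    case False
    then have "\<bar>t\<bar>\<^sup>2 = \<bar>t\<bar> powr 2" by simp
    also have "\<dots> \<le> \<bar>t\<bar> powr \<alpha>" using True \<alpha> by (intro powr_mono') auto
    finally show ?thesis .
  qed (use \<alpha> in simp)
  finally show ?thesis unfolding cmod_cis_minus_1 using powr_ge_zero[of "\<bar>t\<bar>" \<alpha>] by linarith
next
  case False
  have "\<bar>2 * sin (t/2)\<bar> \<le> 2" using abs_sin_le_one[of "t/2"] by (simp only: abs_mult)
  then have "(2 * sin (t/2))\<^sup>2 \<le> 2\<^sup>2" by (metis abs_ge_zero power2_abs power_mono)
  moreover have "1 \<le> \<bar>t\<bar> powr \<alpha>" using False \<alpha> by (intro ge_one_powr_ge_zero) auto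
  ultimately show ?thesis by (simp add: cmod_cis_minus_1)
qed

text \<open>The kinetic energy makes translations Hoelder continuous in the square mean; this decides how fast
  dyadic averages approximate.\<close>

lemma l2_translate_le:
  assumes u: "u \<in> E"
  shows "(l2 lebesgue (\<lambda>x. u (x + h) - u x))\<^sup>2 \<le> 4 * norm h powr \<alpha> * (nrm u)\<^sup>2"
proof -
  have k: "integrable lebesgue (\<lambda>\<xi>. (norm (kin u \<xi>))\<^sup>2)" using E_D(2)[OF u] by (simp add: sq_int_def)
  have "(l2 lebesgue (\<lambda>x. u (x + h) - u x))\<^sup>2 = (LINT \<xi>|lebesgue. (cmod (cis (\<xi> \<bullet> h) - 1))\<^sup>2 * (cmod (fourier u \<xi>))\<^sup>2)"
    by (rule l2_translate_diff_fourier(2)[OF E_D(1)[OF u]])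
  also have "\<dots> \<le> (LINT \<xi>|lebesgue. 4 * norm h powr \<alpha> * (norm (kin u \<xi>))\<^sup>2)"
  proof (rule integral_mono)
    fix \<xi> :: "real ^ 'n"
    have "(cmod (cis (\<xi> \<bullet> h) - 1))\<^sup>2 \<le> 4 * \<bar>\<xi> \<bullet> h\<bar> powr \<alpha>" by (rule cmod_cis_minus_1_le)
    also have "\<bar>\<xi> \<bullet> h\<bar> powr \<alpha> \<le> (norm \<xi> * norm h) powr \<alpha>"
      using \<alpha> by (intro powr_mono2) (auto simp: Cauchy_Schwarz_ineq2)
    finally have "(cmod (cis (\<xi> \<bullet> h) - 1))\<^sup>2 \<le> 4 * (norm \<xi> powr \<alpha> * norm h powr \<alpha>)" by (simp add: powr_mult)
    then have "(cmod (cis (\<xi> \<bullet> h) - 1))\<^sup>2 * (cmod (fourier u \<xi>))\<^sup>2 \<le> 4 * (norm \<xi> powr \<alpha> * norm h powr \<alpha>) * (cmod (fourier u \<xi>))\<^sup>2"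
      by (intro mult_right_mono) auto
    then show "(cmod (cis (\<xi> \<bullet> h) - 1))\<^sup>2 * (cmod (fourier u \<xi>))\<^sup>2 \<le> 4 * norm h powr \<alpha> * (norm (kin u \<xi>))\<^sup>2"
      by (simp add: kin_power2 mult_ac)
  qed (use k l2_translate_diff_fourier(1)[OF E_D(1)[OF u]] in auto)
  also have "\<dots> = 4 * norm h powr \<alpha> * (l2 lebesgue (kin u))\<^sup>2" by (simp add: l2_power2)
  also have "\<dots> \<le> 4 * norm h powr \<alpha> * (nrm u)\<^sup>2"
    using kin_le_nrm[of u] by (intro mult_left_mono power_mono) auto
  finally show ?thesis .
qed

text \<open>A Lipschitz function with compact support has finite energy: its difference quotients are
  bounded in the square mean, and Fatou's lemma turns this into a bound on the second moments of
  the spectrum.\<close>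

lemma E_nontrivial: "\<exists>u\<in>E. \<not> (AE x in lebesgue. u x = 0)"
proof
  define u where "u = (\<lambda>x::real^'n. max 0 (1 - norm x))"
  have uc: "continuous_on UNIV u" unfolding u_def by (intro continuous_intros)
  have um[measurable]: "u \<in> borel_measurable lebesgue"
    by (intro measurable_completion) (use borel_measurable_continuous_onI[OF uc] in simp)
  have u0: "u x = 0" if "norm x > 1" for x using that by (simp add: u_def)
  have ub: "\<bar>u x\<bar> \<le> 1" for x by (simp add: u_def)
  have ind: "sq_int lebesgue (\<lambda>x::real^'n. b * indicator (cball 0 R) x :: real)" for b R
    using sq_int_indicator_cball[of b R] by (subst sq_int_lebesgue_iff) (auto simp: sq_int_def)
  have us: "sq_int lebesgue u"
    by (rule sq_int_dominated(1)[OF um ind[of 1 1], where C=1]) (auto simp: indicator_def u_def)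
  have pots: "sq_int lebesgue (pot u)"
  proof -
    have "compact (V ` cball 0 1)" by (intro compact_continuous_image continuous_on_subset[OF V_continuous]) auto
    then obtain b where b: "\<forall>y\<in>V ` cball 0 1. norm y \<le> b" using compact_imp_bounded bounded_iff by metis
    show ?thesis
    proof (rule sq_int_dominated(1)[OF pot_measurable[OF um] ind[of "sqrt b" 1], where C=1])
      have "norm (pot u x) \<le> 1 * norm (sqrt b * indicator (cball 0 1) x)" for x
      proof (cases "norm x \<le> 1")
        case True
        then have "\<bar>V x\<bar> \<le> b" using b by simp
        then have "sqrt (V x) * \<bar>u x\<bar> \<le> sqrt b * 1" using ub[of x] V_pos[of x] by (intro mult_mono) auto
        then show ?thesis using True V_pos[of x] \<open>\<bar>V x\<bar> \<le> b\<close> by (simp add: pot_def abs_mult)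
      qed (simp add: pot_def u0)
      then show "AE x in lebesgue. norm (pot u x) \<le> 1 * norm (sqrt b * indicator (cball 0 1) x)" by simp
    qed simp
  qed
  note fu = fourier_props(1)[OF us]
  have [measurable]: "fourier u \<in> borel_measurable lebesgue" using fu by (simp add: sq_int_def)
  define K where "K = l2 lebesgue (\<lambda>x::real^'n. 1 * indicator (cball 0 2) x :: real)"
  have diff: "l2 lebesgue (\<lambda>x. u (x + h) - u x) \<le> norm h * K" if h: "norm h \<le> 1" for h
    unfolding K_def
  proof (rule sq_int_dominated(2)[OF _ ind])
    show "(\<lambda>x. u (x + h) - u x) \<in> borel_measurable lebesgue"
      using sq_int_diff[OF sq_int_lebesgue_translate(1)[OF us] us] by (simp add: sq_int_def)
    have "norm (u (x + h) - u x) \<le> norm h * norm (1 * indicator (cball 0 2) x :: real)" for x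
    proof (cases "norm x \<le> 2")
      case True
      have "\<bar>u (x + h) - u x\<bar> \<le> \<bar>norm (x + h) - norm x\<bar>" by (auto simp: u_def max_def)
      also have "\<dots> \<le> norm h" using norm_triangle_ineq3[of "x + h" x] by simp
      finally show ?thesis using True by simp
    next
      case False
      have "norm (x + h) \<ge> norm x - norm h" using norm_triangle_ineq4[of "x + h" h] by simp
      then show ?thesis using False h by (simp add: u0)
    qed
    then show "AE x in lebesgue. norm (u (x + h) - u x) \<le> norm h * norm (1 * indicator (cball 0 2) x :: real)" by simp
  qed simp
  have mom: "integrable lebesgue (\<lambda>\<xi>. (\<xi> $ i)\<^sup>2 * (cmod (fourier u \<xi>))\<^sup>2)" for i
  proof -
    \<comment> \<open>difference quotients along an axis turn into multiplication by its coordinate\<close>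
    let ?h = "\<lambda>n. (1 / real (Suc n)) *\<^sub>R (axis i 1 :: real ^ 'n)"
    have nh: "norm (?h n) = 1 / real (Suc n)" for n by simp
    have ip: "\<xi> \<bullet> ?h n = \<xi> $ i / real (Suc n)" for \<xi> n by (simp add: inner_axis)
    have cm[measurable]: "(\<lambda>\<xi>::real^'n. \<xi> $ i) \<in> borel_measurable lebesgue"
    proof -
      have "(\<lambda>\<xi>::real^'n. \<xi> $ i) \<in> borel_measurable borel" by measurable
      then show ?thesis by (intro measurable_completion) simp
    qed
    let ?g = "\<lambda>n \<xi>. (real (Suc n))\<^sup>2 * ((cmod (cis (\<xi> \<bullet> ?h n) - 1))\<^sup>2 * (cmod (fourier u \<xi>))\<^sup>2)"
    show ?thesis
    proof (rule Fatou_integral_bound(1)[where g="?g" and C="K\<^sup>2"])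
      show "integrable lebesgue (?g n)" for n
        using l2_translate_diff_fourier(1)[OF us, of "?h n"] by simp
      show "AE \<xi> in lebesgue. (\<lambda>n. ?g n \<xi>) \<longlonglongrightarrow> (\<xi> $ i)\<^sup>2 * (cmod (fourier u \<xi>))\<^sup>2"
      proof (intro always_eventually allI)
        fix \<xi> :: "real ^ 'n"
        have "((\<lambda>s. sin (\<xi> $ i * s / 2)) has_real_derivative (\<xi> $ i / 2)) (at 0)"
          by (auto intro!: derivative_eq_intros)
        then have d: "((\<lambda>s. sin (\<xi> $ i * s / 2) / s) \<longlongrightarrow> \<xi> $ i / 2) (at 0)"
          by (simp add: DERIV_def)
        have "filterlim (\<lambda>n. 1 / real (Suc n)) (at 0) sequentially"
          unfolding filterlim_at using lim_1_over_n[THEN LIMSEQ_Suc] by auto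
        from filterlim_compose[OF d this]
        have "(\<lambda>n. 4 * (sin (\<xi> $ i * (1 / real (Suc n)) / 2) / (1 / real (Suc n)))\<^sup>2 * (cmod (fourier u \<xi>))\<^sup>2) \<longlonglongrightarrow> 4 * (\<xi> $ i / 2)\<^sup>2 * (cmod (fourier u \<xi>))\<^sup>2"
          by (intro tendsto_mult tendsto_power tendsto_const)
        moreover have "4 * (sin (\<xi> $ i * (1 / real (Suc n)) / 2) / (1 / real (Suc n)))\<^sup>2 * (cmod (fourier u \<xi>))\<^sup>2 = ?g n \<xi>" for n
          unfolding ip cmod_cis_minus_1 by (simp add: power_mult_distrib mult_ac)
        moreover have "4 * (\<xi> $ i / 2)\<^sup>2 = (\<xi> $ i)\<^sup>2" by (simp add: power_divide)
        ultimately show "(\<lambda>n. ?g n \<xi>) \<longlonglongrightarrow> (\<xi> $ i)\<^sup>2 * (cmod (fourier u \<xi>))\<^sup>2"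
          by (simp only:)
      qed
      show "eventually (\<lambda>n. (LINT \<xi>|lebesgue. ?g n \<xi>) \<le> K\<^sup>2) sequentially"
      proof (intro always_eventually allI)
        fix n
        have "(LINT \<xi>|lebesgue. ?g n \<xi>) = (real (Suc n))\<^sup>2 * (l2 lebesgue (\<lambda>x. u (x + ?h n) - u x))\<^sup>2"
          by (simp only: integral_mult_right_zero l2_translate_diff_fourier(2)[OF us])
        also have "\<dots> \<le> (real (Suc n))\<^sup>2 * (norm (?h n) * K)\<^sup>2"
          by (intro mult_left_mono power_mono diff) (auto simp: nh)
        also have "\<dots> = K\<^sup>2" unfolding nh by (simp add: power_mult_distrib power_divide)
        finally show "(LINT \<xi>|lebesgue. ?g n \<xi>) \<le> K\<^sup>2" .
      qed
    qed auto
  qed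
  have "sq_int lebesgue (kin u)"
  proof -
    have "integrable lebesgue (\<lambda>\<xi>. (cmod (fourier u \<xi>))\<^sup>2 + (\<Sum>i\<in>UNIV. (\<xi> $ i)\<^sup>2 * (cmod (fourier u \<xi>))\<^sup>2))"
      using mom fu by (intro Bochner_Integration.integrable_add Bochner_Integration.integrable_sum) (auto simp: sq_int_def)
    then have "integrable lebesgue (\<lambda>\<xi>. (norm (kin u \<xi>))\<^sup>2)"
    proof (rule Bochner_Integration.integrable_bound)
      show "(\<lambda>\<xi>. (norm (kin u \<xi>))\<^sup>2) \<in> borel_measurable lebesgue" unfolding kin_power2 by measurable
      have "norm ((norm (kin u \<xi>))\<^sup>2) \<le> norm ((cmod (fourier u \<xi>))\<^sup>2 + (\<Sum>i\<in>UNIV. (\<xi> $ i)\<^sup>2 * (cmod (fourier u \<xi>))\<^sup>2))" for \<xi>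
      proof -
        have "norm \<xi> powr \<alpha> \<le> 1 + (norm \<xi>)\<^sup>2"
        proof (cases "norm \<xi> \<le> 1")
          case True then have "norm \<xi> powr \<alpha> \<le> 1 powr \<alpha>" using \<alpha> by (intro powr_mono2) auto
          then have "norm \<xi> powr \<alpha> \<le> 1" by simp
          then show ?thesis using zero_le_power2[of "norm \<xi>"] by linarith
        next
          case False then have "norm \<xi> powr \<alpha> \<le> norm \<xi> powr 2" using \<alpha> by (intro powr_mono) auto
          also have "norm \<xi> powr 2 = (norm \<xi>)\<^sup>2" using False powr_numeral[of "norm \<xi>" "num.Bit0 num.One"] by simp
          finally show ?thesis by simp
        qed
        also have "(norm \<xi>)\<^sup>2 = (\<Sum>i\<in>UNIV. (\<xi> $ i)\<^sup>2)"
          by (simp add: norm_vec_def L2_set_def sum_nonneg)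
        finally have "norm \<xi> powr \<alpha> * (cmod (fourier u \<xi>))\<^sup>2 \<le> (1 + (\<Sum>i\<in>UNIV. (\<xi> $ i)\<^sup>2)) * (cmod (fourier u \<xi>))\<^sup>2"
          by (intro mult_right_mono) auto
        then show ?thesis unfolding kin_power2 by (simp add: algebra_simps sum_distrib_left)
      qed
      then show "AE \<xi> in lebesgue. norm ((norm (kin u \<xi>))\<^sup>2) \<le> norm ((cmod (fourier u \<xi>))\<^sup>2 + (\<Sum>i\<in>UNIV. (\<xi> $ i)\<^sup>2 * (cmod (fourier u \<xi>))\<^sup>2))" by simp
    qed
    then show ?thesis using kin_measurable[of u] by (simp add: sq_int_def)
  qed
  then show "u \<in> E" using us pots by (simp add: E_iff)
  show "\<not> (AE x in lebesgue. u x = 0)"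
  proof
    assume "AE x in lebesgue. u x = 0"
    then have "AE x in lborel. u x = 0" by (simp add: AE_completion_iff)
    then have "AE x in lborel. x \<notin> ball (0::real^'n) 1"
      by eventually_elim (auto simp: u_def max_def split: if_splits)
    then have "ball (0::real^'n) 1 \<in> null_sets lborel"
      by (subst AE_iff_null_sets) auto
    then have "emeasure lborel (ball (0::real^'n) 1) = 0" by auto
    then show False using content_ball_pos[of 1 "0::real^'n"] by (simp add: measure_def)
  qed
qed

end

section \<open>Averages over dyadic cubes\<close>

text \<open>The index of the dyadic cube of side \<open>2\<close> to the power \<open>- k\<close> that contains \<open>x\<close>; the cubes are half open, so that
  they partition the space.\<close>

definition cell :: "nat \<Rightarrow> real ^ 'n::finite \<Rightarrow> int ^ 'n" where
  "cell k x = (\<chi> i. \<lfloor>2 ^ k * x $ i\<rfloor>)"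

definition avg :: "nat \<Rightarrow> (real ^ 'n::finite \<Rightarrow> real) \<Rightarrow> real ^ 'n \<Rightarrow> real" where
  "avg k u x = 2 ^ (k * CARD('n)) * (LINT y|lebesgue. indicator {y. cell k y = cell k x} y * u y)"

lemma cell_eq_iff: "cell k y = z \<longleftrightarrow> (\<forall>i. of_int (z $ i) \<le> 2 ^ k * y $ i \<and> 2 ^ k * y $ i < of_int (z $ i) + 1)"
  by (auto simp: cell_def vec_eq_iff floor_eq_iff)

lemma cell_sets [measurable]: "{y::real^'n::finite. cell k y = z} \<in> sets borel"
proof -
  have "{y::real^'n. cell k y = z} = (\<Inter>i\<in>UNIV. {y. of_int (z $ i) \<le> 2 ^ k * y $ i} \<inter> {y. 2 ^ k * y $ i < of_int (z $ i) + 1})"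
    by (auto simp: cell_eq_iff)
  also have "\<dots> \<in> sets borel"
    by (intro sets.finite_INT sets.Int borel_closed borel_open closed_Collect_le open_Collect_less continuous_intros) auto
  finally show ?thesis .
qed

lemma cell_sets_lebesgue [measurable]: "{y::real^'n::finite. cell k y = z} \<in> sets lebesgue"
  using cell_sets by (intro sets_completionI_sets) simp

lemma cell_refine:
  assumes "cell (Suc k) x = cell (Suc k) y" shows "cell k x = cell k y"
proof -
  have le: "\<lfloor>s\<rfloor> \<le> \<lfloor>t\<rfloor>" if "\<lfloor>2 * s\<rfloor> = \<lfloor>2 * t\<rfloor>" for s t :: real
  proof -
    have "2 * \<lfloor>s\<rfloor> \<le> \<lfloor>2 * s\<rfloor>" using of_int_floor_le[of s] by (simp add: le_floor_iff)
    then have "2 * \<lfloor>s\<rfloor> \<le> \<lfloor>2 * t\<rfloor>" using that by simp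
    then show ?thesis by (simp add: le_floor_iff)
  qed
  have eq: "\<lfloor>s\<rfloor> = \<lfloor>t\<rfloor>" if "\<lfloor>2 * s\<rfloor> = \<lfloor>2 * t\<rfloor>" for s t :: real
    using le[OF that] le[OF that[symmetric]] by simp
  have "cell k x $ i = cell k y $ i" for i
  proof -
    have "cell (Suc k) x $ i = cell (Suc k) y $ i" using assms by simp
    then have "\<lfloor>2 * (2 ^ k * x $ i)\<rfloor> = \<lfloor>2 * (2 ^ k * y $ i)\<rfloor>"
      by (simp only: cell_def vec_lambda_beta power_Suc mult.assoc)
    from eq[OF this] show ?thesis by (simp only: cell_def vec_lambda_beta)
  qed
  then show ?thesis unfolding vec_eq_iff by blast
qed

text \<open>The half open cube lies between an open and a closed box of equal measure.\<close>

lemma cell_measure: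
  shows "emeasure lborel {y::real^'n::finite. cell k y = z} = ennreal (1 / 2 ^ (k * CARD('n)))"
proof -
  let ?l = "(\<chi> i. of_int (z $ i) / 2 ^ k) :: real ^ 'n" and ?h = "(\<chi> i. (of_int (z $ i) + 1) / 2 ^ k) :: real ^ 'n"
  let ?C = "{y::real^'n. cell k y = z}"
  have "box ?l ?h \<subseteq> ?C"
    by (auto simp: mem_box_cart cell_eq_iff pos_divide_less_eq pos_less_divide_eq mult.commute less_imp_le)
  then have 1: "emeasure lborel (box ?l ?h) \<le> emeasure lborel ?C" by (intro emeasure_mono) auto
  have "?C \<subseteq> cbox ?l ?h"
    by (auto simp: mem_box_cart cell_eq_iff pos_divide_le_eq pos_le_divide_eq mult.commute less_imp_le)
  then have 2: "emeasure lborel ?C \<le> emeasure lborel (cbox ?l ?h)" by (intro emeasure_mono) auto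
  have e: "emeasure lborel (box ?l ?h) = emeasure lborel (cbox ?l ?h)"
    by (simp add: emeasure_lborel_box_eq emeasure_lborel_cbox_eq)
  have ne: "cbox ?l ?h \<noteq> {}" by (simp add: interval_ne_empty_cart divide_right_mono)
  have "emeasure lborel (cbox ?l ?h) = ennreal (measure lborel (cbox ?l ?h))"
    by (intro emeasure_eq_ennreal_measure) (simp add: emeasure_lborel_cbox_eq)
  also have "measure lborel (cbox ?l ?h) = (\<Prod>i\<in>(UNIV::'n set). 1 / 2 ^ k)"
    unfolding content_cbox_cart[OF ne] by (intro prod.cong refl) (simp add: field_simps)
  also have "\<dots> = 1 / 2 ^ (k * CARD('n))" by (simp add: power_mult power_divide)
  finally show ?thesis using 1 2 e by (metis order_antisym)
qed

lemma cell_indicator: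
  fixes z :: "int ^ 'n::finite"
  shows "sq_int lborel (indicator {y::real^'n. cell k y = z} :: _ \<Rightarrow> real)"
    and "l2 lborel (indicator {y::real^'n. cell k y = z} :: _ \<Rightarrow> real) = sqrt (1 / 2 ^ (k * CARD('n)))"
    and "integrable lborel (indicator {y::real^'n. cell k y = z} :: _ \<Rightarrow> real)"
    and "(LINT y|lborel. (indicator {y::real^'n. cell k y = z} y :: real)) = 1 / 2 ^ (k * CARD('n))"
proof -
  let ?C = "{y::real^'n. cell k y = z}"
  have sq: "(\<lambda>y. (norm (indicator ?C y :: real))\<^sup>2) = indicator ?C" by (auto simp: indicator_def)
  show i: "integrable lborel (indicator ?C :: _ \<Rightarrow> real)"
    by (intro integrable_real_indicator) (simp_all add: cell_measure)
  have "measure lborel ?C = 1 / 2 ^ (k * CARD('n))" by (simp add: measure_def cell_measure)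
  then show I: "(LINT y|lborel. (indicator ?C y :: real)) = 1 / 2 ^ (k * CARD('n))" by simp
  show "sq_int lborel (indicator ?C :: _ \<Rightarrow> real)" unfolding sq_int_def sq using i by simp
  show "l2 lborel (indicator ?C :: _ \<Rightarrow> real) = sqrt (1 / 2 ^ (k * CARD('n)))" unfolding l2_def sq I ..
qed

lemma indicator_cell_measurable [measurable]:
  "(indicator {y::real^'n::finite. cell k y = z} :: _ \<Rightarrow> real) \<in> borel_measurable borel"
  by measurable

lemma cell_indicator_lebesgue:
  fixes z :: "int ^ 'n::finite"
  shows "sq_int lebesgue (indicator {y::real^'n. cell k y = z} :: _ \<Rightarrow> real)"
    and "l2 lebesgue (indicator {y::real^'n. cell k y = z} :: _ \<Rightarrow> real) = sqrt (1 / 2 ^ (k * CARD('n)))"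
    and "(LINT y|lebesgue. (indicator {y::real^'n. cell k y = z} y :: real)) = 1 / 2 ^ (k * CARD('n))"
  using cell_indicator[of k z] integral_completion[of "indicator {y::real^'n. cell k y = z} :: _ \<Rightarrow> real" lborel]
  by (simp_all add: sq_int_lebesgue_iff)

lemma cell_integral_bound:
  assumes u: "sq_int lebesgue (u :: real^'n::finite \<Rightarrow> real)"
  shows "\<bar>LINT y|lebesgue. indicator {y. cell k y = z} y * u y\<bar> \<le> sqrt (1 / 2 ^ (k * CARD('n))) * l2 lebesgue u"
  using l2_Cauchy_Schwarz[OF cell_indicator_lebesgue(1) u, of k z] by (simp only: cell_indicator_lebesgue)

lemma avg_bound:
  fixes u :: "real^'n::finite \<Rightarrow> real"
  assumes u: "sq_int lebesgue u"
  shows "\<bar>avg k u x\<bar> \<le> sqrt (2 ^ (k * CARD('n))) * l2 lebesgue u"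
proof -
  let ?c = "2 ^ (k * CARD('n)) :: real"
  have "\<bar>avg k u x\<bar> \<le> ?c * (sqrt (1 / ?c) * l2 lebesgue u)"
    unfolding avg_def abs_mult using cell_integral_bound[OF u] by (intro mult_mono) auto
  also have "\<dots> = (?c * sqrt (1 / ?c)) * l2 lebesgue u" by (simp only: mult.assoc)
  also have "?c * sqrt (1 / ?c) = sqrt ?c"
    by (simp add: real_sqrt_divide real_div_sqrt)
  finally show ?thesis .
qed

lemma avg_diff:
  assumes u: "sq_int lebesgue u" and v: "sq_int lebesgue v"
  shows "avg k (\<lambda>x. u x - v x) x = avg k u x - avg k v x"
  using integrable_inner_sq_int[OF cell_indicator_lebesgue(1) u] integrable_inner_sq_int[OF cell_indicator_lebesgue(1) v]
  by (simp add: avg_def right_diff_distrib)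

lemma avg_measurable: "avg k u \<in> borel_measurable borel"
proof -
  have c: "cell k \<in> (borel :: (real^'n) measure) \<rightarrow>\<^sub>M count_space UNIV"
  proof (subst measurable_count_space_eq_countable, simp, intro conjI ballI)
    fix z show "cell k -` {z} \<inter> space (borel :: (real^'n) measure) \<in> sets borel"
      using cell_sets[of k z] by (simp add: vimage_def)
  qed simp
  have "(\<lambda>x. (\<lambda>z. 2 ^ (k * CARD('n)) * (LINT y|lebesgue. indicator {y. cell k y = z} y * u y)) (cell k x)) \<in> borel_measurable borel"
    by (rule measurable_compose[OF c]) simp
  then show ?thesis by (simp add: avg_def[abs_def])
qed

lemma avg_measurable_lebesgue: "avg k u \<in> borel_measurable lebesgue"
  by (intro measurable_completion) (use avg_measurable in simp)

text \<open>An average over large cubes is constant on the smaller ones.\<close>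

lemma avg_avg: "avg (Suc k) (avg k u) x = avg k u (x::real^'n::finite)"
proof -
  have "indicator {y. cell (Suc k) y = cell (Suc k) x} y * avg k u y = indicator {y. cell (Suc k) y = cell (Suc k) x} y * avg k u x" for y
    using cell_refine[of k y x] by (auto simp: indicator_def avg_def)
  then have "(LINT y|lebesgue. indicator {y. cell (Suc k) y = cell (Suc k) x} y * avg k u y)
      = (LINT y|lebesgue. indicator {y. cell (Suc k) y = cell (Suc k) x} y * avg k u x)" by (simp only:)
  also have "\<dots> = (LINT y|lebesgue. indicator {y. cell (Suc k) y = cell (Suc k) x} y) * avg k u x"
    by (rule integral_mult_left_zero)
  finally show ?thesis unfolding avg_def[of "Suc k"] cell_indicator_lebesgue by simp
qed

lemma nn_integral_lborel_shift:
  fixes f :: "'a::euclidean_space \<Rightarrow> ennreal"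
  assumes [measurable]: "f \<in> borel_measurable borel"
  shows "(\<integral>\<^sup>+y. f y \<partial>lborel) = (\<integral>\<^sup>+h. f (x + h) \<partial>lborel)"
  by (subst lborel_distr_plus[symmetric, of x]) (simp add: nn_integral_distr)

text \<open>By Jensen, the distance to the average over a cube is at most the mean distance to the
  translates by vectors of the size of the cube.\<close>

lemma avg_approx:
  fixes u :: "real^'n::finite \<Rightarrow> real"
  assumes u: "sq_int lebesgue u" and D0: "0 \<le> D"
    and D: "\<And>h. (\<And>i. \<bar>h $ i\<bar> \<le> 1 / 2 ^ k) \<Longrightarrow> (l2 lebesgue (\<lambda>x. u (x + h) - u x))\<^sup>2 \<le> D"
  shows "sq_int lebesgue (\<lambda>x. u x - avg k u x)" "(l2 lebesgue (\<lambda>x. u x - avg k u x))\<^sup>2 \<le> 2 ^ CARD('n) * D"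
proof -
  let ?c = "2 ^ (k * CARD('n)) :: real"
  obtain v where v[measurable]: "v \<in> borel_measurable borel" and vl[measurable]: "v \<in> borel_measurable lebesgue"
    and uv: "AE x in lebesgue. u x = v x"
    using lebesgue_borel_representative u by (auto simp: sq_int_def)
  have um: "u \<in> borel_measurable lebesgue" using u by (simp add: sq_int_def)
  have "sq_int lebesgue v" by (rule sq_int_dominated(1)[OF vl u, where C=1]) (use uv in auto)
  then have vs: "sq_int lborel v" by (simp add: sq_int_lebesgue_iff)
  have ind: "(indicator {y::real^'n. cell k y = z} :: _ \<Rightarrow> real) \<in> borel_measurable lebesgue" for z by measurable
  \<comment> \<open>exchanging the integrals over \<open>x\<close> and \<open>h\<close> needs joint measurability of \<open>u (x + h)\<close>, hence the Borel representative \<open>v\<close>\<close>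
  have av: "avg k u = avg k v"
    unfolding avg_def using uv um vl ind by (intro ext arg_cong2[where f="(*)"] refl integral_cong_AE) auto
  let ?I = "\<lambda>x y. indicator {y. cell k y = cell k x} y :: real"
  have avb: "avg k v x = ?c * (LINT y|lborel. ?I x y * v y)" for x
    unfolding avg_def by (subst integral_completion) auto
  have pw: "ennreal ((v x - avg k v x)\<^sup>2) \<le> ennreal ?c * (\<integral>\<^sup>+y. ennreal (?I x y * (v x - v y)\<^sup>2) \<partial>lborel)" for x
  proof -
    have s1: "sq_int lborel (\<lambda>y. ?I x y * v x)"
      using sq_int_scaleR[OF cell_indicator(1), of "v x" k "cell k x"] by (simp add: mult.commute)
    have s2: "sq_int lborel (\<lambda>y. ?I x y * v y)"
    proof (rule sq_int_dominated(1)[OF _ vs, where C=1])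
      show "(\<lambda>y. ?I x y * v y) \<in> borel_measurable lborel" by measurable
    qed (auto simp: indicator_def)
    have s3: "sq_int lborel (\<lambda>y. ?I x y * (v x - v y))"
      using sq_int_diff[OF s1 s2] by (simp add: right_diff_distrib)
    have i1: "integrable lborel (\<lambda>y. ?I x y * v x)" using cell_indicator(3) by (rule integrable_mult_left)
    have i2: "integrable lborel (\<lambda>y. ?I x y * v y)" by (rule integrable_inner_sq_int[OF cell_indicator(1) vs])
    have "(LINT y|lborel. ?I x y * (v x - v y)) = v x / ?c - (LINT y|lborel. ?I x y * v y)"
      using i1 i2 by (simp add: right_diff_distrib cell_indicator(4) del: Bochner_Integration.integral_indicator)
    then have "v x - avg k v x = ?c * (LINT y|lborel. ?I x y * (v x - v y))"
      unfolding avb by (simp add: right_diff_distrib)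
    also have "(LINT y|lborel. ?I x y * (v x - v y)) = (LINT y|lborel. ?I x y * (?I x y * (v x - v y)))"
      by (intro Bochner_Integration.integral_cong refl) (auto simp: indicator_def)
    finally have "\<bar>v x - avg k v x\<bar> = ?c * \<bar>LINT y|lborel. ?I x y * (?I x y * (v x - v y))\<bar>"
      by (simp add: abs_mult)
    also have "\<dots> \<le> ?c * (sqrt (1 / ?c) * l2 lborel (\<lambda>y. ?I x y * (v x - v y)))"
      using l2_Cauchy_Schwarz[OF cell_indicator(1) s3, of k "cell k x"] by (intro mult_left_mono) (auto simp: cell_indicator(2))
    finally have ab: "\<bar>v x - avg k v x\<bar> \<le> ?c * (sqrt (1 / ?c) * l2 lborel (\<lambda>y. ?I x y * (v x - v y)))" .
    have "(v x - avg k v x)\<^sup>2 \<le> (?c * (sqrt (1 / ?c) * l2 lborel (\<lambda>y. ?I x y * (v x - v y))))\<^sup>2"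
      using power_mono[OF ab abs_ge_zero, of 2] by (simp only: power2_abs)
    also have "\<dots> = ?c * (l2 lborel (\<lambda>y. ?I x y * (v x - v y)))\<^sup>2"
    proof -
      have "(c * (sqrt (1 / c) * L))\<^sup>2 = c * L\<^sup>2" if "c > 0" for c L :: real
      proof -
        have "(c * (sqrt (1 / c) * L))\<^sup>2 = c\<^sup>2 * (1 / c) * L\<^sup>2"
          using that by (simp only: power_mult_distrib real_sqrt_pow2 zero_le_divide_1_iff less_imp_le mult.assoc)
        then show ?thesis using that by (simp add: power2_eq_square)
      qed
      then show ?thesis by simp
    qed
    also have "(l2 lborel (\<lambda>y. ?I x y * (v x - v y)))\<^sup>2 = (LINT y|lborel. ?I x y * (v x - v y)\<^sup>2)"
      unfolding l2_power2 by (intro Bochner_Integration.integral_cong refl) (auto simp: indicator_def)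
    finally have le: "(v x - avg k v x)\<^sup>2 \<le> ?c * (LINT y|lborel. ?I x y * (v x - v y)\<^sup>2)" .
    have "(\<lambda>y. (norm (?I x y * (v x - v y)))\<^sup>2) = (\<lambda>y. ?I x y * (v x - v y)\<^sup>2)" by (auto simp: indicator_def)
    then have "integrable lborel (\<lambda>y. ?I x y * (v x - v y)\<^sup>2)" using s3 by (simp add: sq_int_def)
    then have "(\<integral>\<^sup>+y. ennreal (?I x y * (v x - v y)\<^sup>2) \<partial>lborel) = ennreal (LINT y|lborel. ?I x y * (v x - v y)\<^sup>2)"
      by (intro nn_integral_eq_integral) auto
    then show ?thesis using le by (simp add: ennreal_mult'[symmetric] ennreal_leI)
  qed
  \<comment> \<open>the differences of points in one cube lie in this box, whose volume is \<open>2 ^ N\<close> times that of the cube\<close>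
  let ?Q = "cbox (\<chi> i. - (1 / 2 ^ k)) (\<chi> i. 1 / 2 ^ k) :: (real ^ 'n) set"
  have Qm: "h \<in> ?Q \<longleftrightarrow> (\<forall>i. \<bar>h $ i\<bar> \<le> 1 / 2 ^ k)" for h
  proof -
    have "- (1 / 2 ^ k) \<le> h $ i \<and> h $ i \<le> 1 / 2 ^ k \<longleftrightarrow> \<bar>h $ i\<bar> \<le> 1 / 2 ^ k" for i by linarith
    then show ?thesis by (simp only: mem_box_cart vec_lambda_beta)
  qed
  have shift: "(\<integral>\<^sup>+y. ennreal (?I x y * (v x - v y)\<^sup>2) \<partial>lborel) \<le> (\<integral>\<^sup>+h. indicator ?Q h * ennreal ((v (x + h) - v x)\<^sup>2) \<partial>lborel)" for x
  proof -
    have "(\<integral>\<^sup>+y. ennreal (?I x y * (v x - v y)\<^sup>2) \<partial>lborel) = (\<integral>\<^sup>+h. ennreal (?I x (x + h) * (v x - v (x + h))\<^sup>2) \<partial>lborel)"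
      by (rule nn_integral_lborel_shift) measurable
    also have "\<dots> \<le> (\<integral>\<^sup>+h. indicator ?Q h * ennreal ((v (x + h) - v x)\<^sup>2) \<partial>lborel)"
    proof (rule nn_integral_mono)
      fix h
      show "ennreal (?I x (x + h) * (v x - v (x + h))\<^sup>2) \<le> indicator ?Q h * ennreal ((v (x + h) - v x)\<^sup>2)"
      proof (cases "cell k (x + h) = cell k x")
        case True
        have "\<bar>h $ i\<bar> \<le> 1 / 2 ^ k" for i
        proof -
          have *: "\<lfloor>2 ^ k * (x $ i + h $ i)\<rfloor> = \<lfloor>2 ^ k * x $ i\<rfloor>" using True by (simp add: cell_def vec_eq_iff)
          have "\<bar>2 ^ k * (x $ i + h $ i) - 2 ^ k * x $ i\<bar> \<le> 1" using * by linarith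
          then have "2 ^ k * \<bar>h $ i\<bar> \<le> 1" by (simp add: distrib_left abs_mult)
          then show ?thesis by (simp add: field_simps)
        qed
        then have "h \<in> ?Q" by (simp add: Qm)
        then show ?thesis using True by (simp add: power2_commute)
      qed simp
    qed
    finally show ?thesis .
  qed
  have tr: "(\<integral>\<^sup>+x. ennreal ((v (x + h) - v x)\<^sup>2) \<partial>lborel) \<le> ennreal D" if "h \<in> ?Q" for h
  proof -
    have s: "sq_int lborel (\<lambda>x. v (x + h) - v x)" by (intro sq_int_diff sq_int_translate vs)
    have "(\<lambda>x. v (x + h) - v x) \<in> borel_measurable borel" by measurable
    then have l: "(\<lambda>x. v (x + h) - v x) \<in> borel_measurable lebesgue" by (intro measurable_completion) simp
    have "l2 lborel (\<lambda>x. v (x + h) - v x) = l2 lebesgue (\<lambda>x. v (x + h) - v x)" by (intro sq_int_lebesgue_iff(2)[symmetric]) simp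
    also have "\<dots> = l2 lebesgue (\<lambda>x. u (x + h) - u x)"
    proof (rule l2_cong_AE[OF l])
      show "(\<lambda>x. u (x + h) - u x) \<in> borel_measurable lebesgue"
        using sq_int_diff[OF sq_int_lebesgue_translate(1)[OF u] u] by (simp add: sq_int_def)
      show "AE x in lebesgue. norm (v (x + h) - v x) = norm (u (x + h) - u x)"
        using uv AE_lebesgue_translate[OF uv, of h] by eventually_elim simp
    qed
    finally have "(l2 lborel (\<lambda>x. v (x + h) - v x))\<^sup>2 \<le> D" using D[of h] that by (simp add: Qm)
    moreover have "(\<integral>\<^sup>+x. ennreal ((v (x + h) - v x)\<^sup>2) \<partial>lborel) = ennreal ((l2 lborel (\<lambda>x. v (x + h) - v x))\<^sup>2)"
      unfolding l2_power2 using s by (subst nn_integral_eq_integral[symmetric]) (auto simp: sq_int_def)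
    ultimately show ?thesis by (simp add: ennreal_leI)
  qed
  have QE: "emeasure lborel ?Q = ennreal (2 ^ CARD('n) / ?c)"
  proof -
    have ne: "?Q \<noteq> {}" unfolding interval_ne_empty_cart by (simp add: order_trans[of _ 0])
    have "emeasure lborel ?Q = ennreal (measure lborel ?Q)"
      by (intro emeasure_eq_ennreal_measure) (simp add: emeasure_lborel_cbox_eq)
    also have "measure lborel ?Q = (\<Prod>i\<in>(UNIV::'n set). 2 / 2 ^ k)"
      unfolding content_cbox_cart[OF ne] by (intro prod.cong refl) (simp add: field_simps)
    also have "\<dots> = 2 ^ CARD('n) / ?c" by (simp add: power_mult power_divide)
    finally show ?thesis .
  qed
  have am: "(\<lambda>x. v x - avg k v x) \<in> borel_measurable borel"
    using avg_measurable v by (intro borel_measurable_diff) 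
  have "(\<integral>\<^sup>+x. ennreal ((v x - avg k v x)\<^sup>2) \<partial>lborel)
     \<le> (\<integral>\<^sup>+x. ennreal ?c * (\<integral>\<^sup>+h. indicator ?Q h * ennreal ((v (x + h) - v x)\<^sup>2) \<partial>lborel) \<partial>lborel)"
    by (intro nn_integral_mono order_trans[OF pw] mult_left_mono shift) auto
  also have "\<dots> = ennreal ?c * (\<integral>\<^sup>+x. (\<integral>\<^sup>+h. indicator ?Q h * ennreal ((v (x + h) - v x)\<^sup>2) \<partial>lborel) \<partial>lborel)"
    by (rule nn_integral_cmult) measurable
  also have "(\<integral>\<^sup>+x. (\<integral>\<^sup>+h. indicator ?Q h * ennreal ((v (x + h) - v x)\<^sup>2) \<partial>lborel) \<partial>lborel)
      = (\<integral>\<^sup>+h. (\<integral>\<^sup>+x. indicator ?Q h * ennreal ((v (x + h) - v x)\<^sup>2) \<partial>lborel) \<partial>lborel)"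
    by (rule lborel_pair.Fubini'[symmetric]) measurable
  also have "\<dots> \<le> (\<integral>\<^sup>+h. ennreal D * indicator ?Q h \<partial>lborel)"
  proof (rule nn_integral_mono)
    fix h
    have "(\<integral>\<^sup>+x. indicator ?Q h * ennreal ((v (x + h) - v x)\<^sup>2) \<partial>lborel) = indicator ?Q h * (\<integral>\<^sup>+x. ennreal ((v (x + h) - v x)\<^sup>2) \<partial>lborel)"
      by (rule nn_integral_cmult) measurable
    also have "\<dots> \<le> ennreal D * indicator ?Q h" using tr[of h] by (auto simp: indicator_def)
    finally show "(\<integral>\<^sup>+x. indicator ?Q h * ennreal ((v (x + h) - v x)\<^sup>2) \<partial>lborel) \<le> ennreal D * indicator ?Q h" .
  qed
  also have "\<dots> = ennreal D * ennreal (2 ^ CARD('n) / ?c)" by (subst nn_integral_cmult_indicator) (auto simp: QE)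
  finally have le: "(\<integral>\<^sup>+x. ennreal ((v x - avg k v x)\<^sup>2) \<partial>lborel) \<le> ennreal ?c * (ennreal D * ennreal (2 ^ CARD('n) / ?c))"
    by (simp add: mult_left_mono)
  also have "\<dots> = ennreal (2 ^ CARD('n) * D)" using D0 by (simp add: ennreal_mult'[symmetric])
  finally have le: "(\<integral>\<^sup>+x. ennreal ((v x - avg k v x)\<^sup>2) \<partial>lborel) \<le> ennreal (2 ^ CARD('n) * D)" .
  have int: "integrable lborel (\<lambda>x. (v x - avg k v x)\<^sup>2)"
    by (rule integrableI_nonneg) (use le am in \<open>auto simp: less_top[symmetric] top_unique\<close>)
  then have sqv: "sq_int lborel (\<lambda>x. v x - avg k v x)" using am by (simp add: sq_int_def)
  then have sql: "sq_int lebesgue (\<lambda>x. v x - avg k v x)" by (simp add: sq_int_lebesgue_iff[OF am])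
  have uam: "(\<lambda>x. u x - avg k u x) \<in> borel_measurable lebesgue"
    by (intro borel_measurable_diff um avg_measurable_lebesgue)
  show "sq_int lebesgue (\<lambda>x. u x - avg k u x)"
    by (rule sq_int_dominated(1)[OF uam sql, where C=1]) (use uv in \<open>auto simp: av\<close>)
  have "l2 lebesgue (\<lambda>x. u x - avg k u x) = l2 lebesgue (\<lambda>x. v x - avg k v x)"
    by (rule l2_cong_AE[OF uam]) (use uv sql in \<open>auto simp: av sq_int_def\<close>)
  also have "(l2 lebesgue (\<lambda>x. v x - avg k v x))\<^sup>2 = (LINT x|lborel. (v x - avg k v x)\<^sup>2)"
    by (simp add: sq_int_lebesgue_iff[OF am] l2_power2)
  also have "\<dots> \<le> 2 ^ CARD('n) * D"
    using le nn_integral_eq_integral[OF int] D0 by simp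
  finally show "(l2 lebesgue (\<lambda>x. u x - avg k u x))\<^sup>2 \<le> 2 ^ CARD('n) * D" .
qed

section \<open>Embedding into subcritical powers\<close>

text \<open>After rescaling by a geometric sequence the largest term controls the sum. This replaces Minkowski's
  inequality when the terms decay geometrically.\<close>

lemma power_sum_le:
  fixes a :: "nat \<Rightarrow> real"
  assumes a: "\<And>k. 0 \<le> a k" and \<mu>: "0 < \<mu>" "\<mu> < 1" and p: "0 < p"
  shows "(\<Sum>k\<le>K. a k) powr p \<le> (1 / (1 - \<mu>)) powr p * (\<Sum>k\<le>K. (a k / \<mu> ^ k) powr p)"
proof -
  define m where "m = Max ((\<lambda>k. a k / \<mu> ^ k) ` {..K})"
  have am: "a k / \<mu> ^ k \<le> m" if "k \<le> K" for k unfolding m_def using that by (intro Max_ge) auto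
  have "m \<in> (\<lambda>k. a k / \<mu> ^ k) ` {..K}" unfolding m_def by (intro Max_in) auto
  then obtain j where j: "j \<le> K" "m = a j / \<mu> ^ j" by auto
  have m0: "0 \<le> m" using j a[of j] \<mu> by simp
  have "(\<Sum>k\<le>K. a k) \<le> (\<Sum>k\<le>K. m * \<mu> ^ k)"
    using am \<mu> by (intro sum_mono) (simp add: pos_divide_le_eq)
  also have "\<dots> = m * (\<Sum>k\<le>K. \<mu> ^ k)" by (simp add: sum_distrib_left)
  also have "\<dots> \<le> m * (1 / (1 - \<mu>))"
  proof (rule mult_left_mono[OF _ m0])
    have "(\<Sum>k\<le>K. \<mu> ^ k) \<le> (\<Sum>k. \<mu> ^ k)" using \<mu> by (intro sum_le_suminf summable_geometric) auto
    then show "(\<Sum>k\<le>K. \<mu> ^ k) \<le> 1 / (1 - \<mu>)" using \<mu> by (simp add: suminf_geometric)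
  qed
  finally have le: "(\<Sum>k\<le>K. a k) \<le> (1 / (1 - \<mu>)) * m" by (simp only: mult.commute)
  have "(\<Sum>k\<le>K. a k) powr p \<le> ((1 / (1 - \<mu>)) * m) powr p"
    using le p a by (intro powr_mono2 sum_nonneg) auto
  also have "\<dots> = (1 / (1 - \<mu>)) powr p * m powr p" by (simp only: powr_mult)
  also have "\<dots> \<le> (1 / (1 - \<mu>)) powr p * (\<Sum>k\<le>K. (a k / \<mu> ^ k) powr p)"
  proof (rule mult_left_mono)
    show "m powr p \<le> (\<Sum>k\<le>K. (a k / \<mu> ^ k) powr p)"
      unfolding j(2) using j(1) by (intro member_le_sum[of j "{..K}" "\<lambda>k. (a k / \<mu> ^ k) powr p"]) auto
  qed simp
  finally show ?thesis .
qed

lemma powr_split2: "\<bar>w\<bar> powr p = \<bar>w\<bar> powr (p - 2) * w\<^sup>2" for w p :: real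
proof (cases "w = 0")
  case False
  have "\<bar>w\<bar> powr p = \<bar>w\<bar> powr ((p - 2) + 2)" by simp
  also have "\<dots> = \<bar>w\<bar> powr (p - 2) * \<bar>w\<bar> powr 2" by (rule powr_add)
  also have "\<bar>w\<bar> powr 2 = w\<^sup>2" using False by simp
  finally show ?thesis .
qed simp

text \<open>The series of the functions has a finite integral, so its sum is an integrable majorant and its terms
  tend to zero almost everywhere.\<close>

lemma fast_convergence_dominated:
  fixes f :: "nat \<Rightarrow> 'a \<Rightarrow> real"
  assumes int: "\<And>n. integrable M (f n)" and nn: "\<And>n x. 0 \<le> f n x" and b: "\<And>n. (LINT x|M. f n x) \<le> (1/2) ^ n"
  obtains S where "integrable M S" "AE x in M. (\<lambda>n. f n x) \<longlonglongrightarrow> 0" "AE x in M. \<forall>n. f n x \<le> S x"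
proof -
  have [measurable]: "f n \<in> borel_measurable M" for n using int by auto
  have "(\<integral>\<^sup>+x. (\<Sum>n. ennreal (f n x)) \<partial>M) = (\<Sum>n. \<integral>\<^sup>+x. ennreal (f n x) \<partial>M)"
    by (rule nn_integral_suminf) measurable
  also have "\<dots> \<le> (\<Sum>n. ennreal ((1/2) ^ n))"
    by (intro suminf_le summableI) (use nn_integral_eq_integral[OF int] nn b in \<open>auto simp: ennreal_leI\<close>)
  also have "\<dots> = ennreal (\<Sum>n. (1/2) ^ n)" by (rule suminf_ennreal2) auto
  finally have fin: "(\<integral>\<^sup>+x. (\<Sum>n. ennreal (f n x)) \<partial>M) \<noteq> \<infinity>" by (auto simp: top_unique)
  then have "AE x in M. (\<Sum>n. ennreal (f n x)) \<noteq> \<infinity>"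
    by (intro nn_integral_noteq_infinite) auto
  then have sm: "AE x in M. summable (\<lambda>n. f n x)"
    by eventually_elim (auto intro: summable_suminf_not_top nn)
  define S where "S = (\<lambda>x. \<Sum>n. f n x)"
  have Sm[measurable]: "S \<in> borel_measurable M" unfolding S_def by measurable
  have SE: "AE x in M. ennreal (S x) = (\<Sum>n. ennreal (f n x))"
    using sm unfolding S_def by eventually_elim (simp add: suminf_ennreal2 nn)
  have S0: "AE x in M. 0 \<le> S x" using sm unfolding S_def by eventually_elim (simp add: suminf_nonneg nn)
  have "integrable M S"
  proof (rule integrableI_nonneg[OF Sm S0])
    have "(\<integral>\<^sup>+x. ennreal (S x) \<partial>M) = (\<integral>\<^sup>+x. (\<Sum>n. ennreal (f n x)) \<partial>M)"
      using SE by (rule nn_integral_cong_AE)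
    then show "(\<integral>\<^sup>+x. ennreal (S x) \<partial>M) < \<infinity>" using fin by (simp add: less_top)
  qed
  moreover have "AE x in M. (\<lambda>n. f n x) \<longlonglongrightarrow> 0" using sm by eventually_elim (rule summable_LIMSEQ_zero)
  moreover have "AE x in M. \<forall>n. f n x \<le> S x"
    using sm unfolding S_def
  proof eventually_elim
    case (elim x)
    show ?case using sum_le_suminf[OF elim, of "{n}" for n] nn by simp
  qed
  ultimately show ?thesis by (rule that)
qed

lemma fast_subsequence:
  fixes X :: "nat \<Rightarrow> real"
  assumes "X \<longlonglongrightarrow> 0"
  obtains r where "strict_mono r" "\<And>n. X (r n) \<le> (1/2) ^ n"
proof -
  have ex: "\<exists>m>l. X m \<le> (1/2) ^ n" for n l
  proof -
    have "eventually (\<lambda>m. X m < (1/2) ^ n \<and> l < m) sequentially"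
      by (intro eventually_conj order_tendstoD(2)[OF assms] eventually_gt_at_top) simp
    then obtain m where "X m < (1/2) ^ n" "l < m" by (auto simp: eventually_sequentially)
    then show ?thesis by (auto intro: less_imp_le)
  qed
  have "\<exists>r. \<forall>k. X (r k) \<le> (1/2) ^ k \<and> r k < r (Suc k)"
  proof (rule dependent_nat_choice[where P="\<lambda>k m. X m \<le> (1/2) ^ k" and Q="\<lambda>_ m n. m < n"])
    show "\<exists>x. X x \<le> (1/2) ^ 0" using ex[of 0 0] by auto
    show "\<exists>y. X y \<le> (1/2) ^ Suc n \<and> x < y" for x n using ex[of x "Suc n"] by auto
  qed
  then obtain r where "\<And>k. X (r k) \<le> (1/2) ^ k" "\<And>k. r k < r (Suc k)" by blast
  then show ?thesis using that[of r] by (simp add: strict_mono_Suc_iff)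
qed

context confining_potential
begin

text \<open>The factor by which the distance to the averages shrinks when the cubes are halved.\<close>

definition \<sigma> :: real where "\<sigma> = 2 powr (- \<alpha> / 2)"

lemma \<sigma>: "0 < \<sigma>" "\<sigma> < 1"
  using \<alpha> powr_less_mono[of "- \<alpha> / 2" 0 2] by (auto simp: \<sigma>_def)

text \<open>The constant \<open>2 ^ N\<close> is lost in \<open>avg_approx\<close>; the rest is the translation bound for vectors of the size
  of the unit cube.\<close>

definition CA :: real where "CA = sqrt (2 ^ CARD('n) * (4 * real CARD('n) powr \<alpha>))"

lemma CA_nonneg: "0 \<le> CA" by (simp add: CA_def)

lemma avg_rate:
  assumes u: "u \<in> E"
  shows "sq_int lebesgue (\<lambda>x. u x - avg k u x)" "l2 lebesgue (\<lambda>x. u x - avg k u x) \<le> CA * \<sigma> ^ k * nrm u"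
proof -
  let ?N = "real CARD('n)"
  let ?D = "4 * (?N / 2 ^ k) powr \<alpha> * (nrm u)\<^sup>2"
  have D: "(l2 lebesgue (\<lambda>x. u (x + h) - u x))\<^sup>2 \<le> ?D" if "\<And>i. \<bar>h $ i\<bar> \<le> 1 / 2 ^ k" for h
  proof -
    have "norm h \<le> (\<Sum>i\<in>UNIV. \<bar>h $ i\<bar>)" by (rule norm_le_l1_cart)
    also have "\<dots> \<le> (\<Sum>i\<in>(UNIV::'n set). 1 / 2 ^ k)" by (intro sum_mono that)
    finally have "norm h powr \<alpha> \<le> (?N / 2 ^ k) powr \<alpha>" using \<alpha> by (intro powr_mono2) auto
    then have "4 * norm h powr \<alpha> * (nrm u)\<^sup>2 \<le> ?D" by (intro mult_right_mono mult_left_mono) auto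
    then show ?thesis using l2_translate_le[OF u, of h] by linarith
  qed
  have D0: "0 \<le> ?D" by simp
  show "sq_int lebesgue (\<lambda>x. u x - avg k u x)" by (rule avg_approx(1)[OF E_D(1)[OF u] D0 D])
  have "(l2 lebesgue (\<lambda>x. u x - avg k u x))\<^sup>2 \<le> 2 ^ CARD('n) * ?D" by (rule avg_approx(2)[OF E_D(1)[OF u] D0 D])
  also have "\<dots> = (CA * \<sigma> ^ k * nrm u)\<^sup>2"
  proof -
    have "(\<sigma> ^ k)\<^sup>2 = 2 powr (- \<alpha> * real k)" by (simp add: \<sigma>_def powr_power power_mult[symmetric] mult.commute)
    also have "\<dots> = inverse ((2 ^ k) powr \<alpha>)" by (simp add: powr_minus powr_realpow[symmetric] powr_powr mult.commute)
    finally have s: "(\<sigma> ^ k)\<^sup>2 = inverse ((2 ^ k) powr \<alpha>)" .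
    have c: "CA\<^sup>2 = 2 ^ CARD('n) * (4 * ?N powr \<alpha>)" unfolding CA_def by (rule real_sqrt_pow2) simp
    show ?thesis unfolding power_mult_distrib s c by (simp add: powr_divide field_simps)
  qed
  finally show "l2 lebesgue (\<lambda>x. u x - avg k u x) \<le> CA * \<sigma> ^ k * nrm u"
    by (rule power2_le_imp_le) (use CA_nonneg \<sigma> in auto)
qed

lemma avg_sq_int: "u \<in> E \<Longrightarrow> sq_int lebesgue (avg k u)"
  using sq_int_diff[OF E_D(1) avg_rate(1), of u u k] by simp

lemma avg_tendsto:
  assumes u: "u \<in> E" shows "(\<lambda>k. l2 lebesgue (\<lambda>x. avg k u x - u x)) \<longlonglongrightarrow> 0"
proof (rule tendsto_0_le[OF l2_nonneg])
  show "l2 lebesgue (\<lambda>x. avg k u x - u x) \<le> CA * \<sigma> ^ k * nrm u" for k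
    using avg_rate(2)[OF u, of k] by (simp add: l2_minus_commute[of lebesgue u "avg k u"])
  have "(\<lambda>k. CA * \<sigma> ^ k * nrm u) \<longlonglongrightarrow> CA * 0 * nrm u"
    using \<sigma> by (intro tendsto_intros LIMSEQ_power_zero) auto
  then show "(\<lambda>k. CA * \<sigma> ^ k * nrm u) \<longlonglongrightarrow> 0" by simp
qed

text \<open>The factor by which the uniform bound on the increments of the averages grows. An exponent \<open>p\<close> is subcritical
  exactly if \<open>\<rho> powr (p - 2) * \<sigma>\<^sup>2 < 1\<close>.\<close>

definition \<rho> :: real where "\<rho> = 2 powr ((real CARD('n) - \<alpha>) / 2)"

definition A :: real where "A = (1 / sqrt V0 + 2 * CA) / \<sigma>"

definition incr :: "(real ^ 'n \<Rightarrow> real) \<Rightarrow> nat \<Rightarrow> real ^ 'n \<Rightarrow> real" where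
  "incr u k x = (case k of 0 \<Rightarrow> avg 0 u x | Suc j \<Rightarrow> avg (Suc j) u x - avg j u x)"

lemma incr_simps: "incr u 0 = avg 0 u" "incr u (Suc j) = (\<lambda>x. avg (Suc j) u x - avg j u x)"
  by (simp_all add: incr_def fun_eq_iff)

text \<open>The increments of the dyadic averages are small in the square mean because of the
  smoothness of \<open>u\<close>, and since an increment is itself an average of
  \<open>u - avg k u\<close> over a cube, it is bounded by its square mean divided by the square root of the
  volume of the cube. Interpolating the two bounds gives a geometric series in every
  subcritical power.\<close>

lemma increment_bounds:
  assumes u: "u \<in> E"
  shows "sq_int lebesgue (incr u k)" "\<bar>incr u k x\<bar> \<le> A * \<rho> ^ k * nrm u" "l2 lebesgue (incr u k) \<le> A * \<sigma> ^ k * nrm u"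
    "(\<Sum>k\<le>K. incr u k x) = avg K u x"
proof -
  note uD = E_D(1)[OF u]
  have sV: "0 < sqrt V0" using V0_pos by simp
  have A0: "1 / sqrt V0 + 2 * CA \<le> A"
    unfolding A_def using \<sigma> CA_nonneg sV by (simp add: pos_le_divide_eq mult_left_le)
  show "(\<Sum>k\<le>K. incr u k x) = avg K u x" by (induction K) (auto simp: incr_simps)
  \<comment> \<open>\<open>avg j u\<close> is its own average over the smaller cubes\<close>
  have e: "avg (Suc j) u y - avg j u y = avg (Suc j) (\<lambda>x. u x - avg j u x) y" for j y
    using avg_diff[OF uD avg_sq_int[OF u], of "Suc j" j y] by (simp add: avg_avg)
  show "sq_int lebesgue (incr u k)"
    by (cases k) (auto simp: incr_simps intro: avg_sq_int u sq_int_diff)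
  show "\<bar>incr u k x\<bar> \<le> A * \<rho> ^ k * nrm u"
  proof (cases k)
    case 0
    have "\<bar>avg 0 u x\<bar> \<le> l2 lebesgue u" using avg_bound[OF uD, of 0 x] by simp
    also have "\<dots> \<le> (1 / sqrt V0) * nrm u" using l2_le_nrm[OF u] by simp
    also have "\<dots> \<le> A * nrm u" using A0 CA_nonneg by (intro mult_right_mono) auto
    finally show ?thesis using 0 by (simp add: incr_simps)
  next
    case (Suc j)
    have "\<bar>incr u k x\<bar> = \<bar>avg (Suc j) (\<lambda>x. u x - avg j u x) x\<bar>" using Suc by (simp add: incr_simps e)
    also have "\<dots> \<le> sqrt (2 ^ (Suc j * CARD('n))) * l2 lebesgue (\<lambda>x. u x - avg j u x)"
      by (rule avg_bound[OF avg_rate(1)[OF u]])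
    also have "\<dots> \<le> sqrt (2 ^ (Suc j * CARD('n))) * (CA * \<sigma> ^ j * nrm u)"
      by (intro mult_left_mono avg_rate u) auto
    also have "sqrt (2 ^ (Suc j * CARD('n))) = (2 powr (real CARD('n) / 2)) ^ Suc j"
    proof -
      have "(2 powr (real CARD('n) / 2)) ^ Suc j = 2 powr (real (Suc j * CARD('n)) * (1/2))"
      proof -
        have "(2 powr (real CARD('n) / 2)) ^ Suc j = (2 powr (real CARD('n) / 2)) powr real (Suc j)"
          by (rule powr_realpow[symmetric]) simp
        also have "\<dots> = 2 powr (real CARD('n) / 2 * real (Suc j))" by (rule powr_powr)
        also have "real CARD('n) / 2 * real (Suc j) = real (Suc j * CARD('n)) * (1/2)" by (simp add: algebra_simps)
        finally show ?thesis .
      qed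
      also have "\<dots> = (2 powr real (Suc j * CARD('n))) powr (1/2)" by (rule powr_powr[symmetric])
      also have "\<dots> = sqrt (2 powr real (Suc j * CARD('n)))" by (rule powr_half_sqrt) simp
      also have "2 powr real (Suc j * CARD('n)) = 2 ^ (Suc j * CARD('n))" by (rule powr_realpow) simp
      finally show ?thesis by (rule sym)
    qed
    also have "(2 powr (real CARD('n) / 2)) ^ Suc j * (CA * \<sigma> ^ j * nrm u) = (CA / \<sigma>) * \<rho> ^ Suc j * nrm u"
    proof -
      have "\<rho> = 2 powr (real CARD('n) / 2) * \<sigma>"
        by (simp add: \<rho>_def \<sigma>_def powr_add[symmetric] diff_divide_distrib)
      then have "\<rho> ^ Suc j = (2 powr (real CARD('n) / 2)) ^ Suc j * (\<sigma> * \<sigma> ^ j)"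
        by (simp only: power_mult_distrib power_Suc[of \<sigma>])
      then show ?thesis using \<sigma> by simp
    qed
    also have "\<dots> \<le> A * \<rho> ^ Suc j * nrm u"
      unfolding A_def using \<sigma> CA_nonneg sV by (intro mult_right_mono divide_right_mono) (auto simp: \<rho>_def)
    finally show ?thesis using Suc by simp
  qed
  show "l2 lebesgue (incr u k) \<le> A * \<sigma> ^ k * nrm u"
  proof (cases k)
    case 0
    have "l2 lebesgue (avg 0 u) \<le> l2 lebesgue (\<lambda>x. avg 0 u x - u x) + l2 lebesgue u"
      using l2_triangle[OF sq_int_diff[OF avg_sq_int[OF u] uD] uD, of 0] by simp
    also have "\<dots> \<le> CA * nrm u + (1 / sqrt V0) * nrm u"
      using avg_rate(2)[OF u, of 0] l2_le_nrm[OF u] by (intro add_mono) (auto simp: l2_minus_commute[of lebesgue "avg 0 u" u])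
    also have "\<dots> = (CA + 1 / sqrt V0) * nrm u" by (simp add: algebra_simps)
    also have "\<dots> \<le> A * nrm u" using A0 CA_nonneg by (intro mult_right_mono) auto
    finally show ?thesis using 0 by (simp add: incr_simps)
  next
    case (Suc j)
    have "l2 lebesgue (incr u k) = l2 lebesgue (\<lambda>x. avg (Suc j) u x - avg j u x)" using Suc by (simp add: incr_simps)
    also have "\<dots> \<le> l2 lebesgue (\<lambda>x. avg (Suc j) u x - u x) + l2 lebesgue (\<lambda>x. u x - avg j u x)"
      by (intro l2_triangle_diff avg_sq_int u uD)
    also have "\<dots> \<le> CA * \<sigma> ^ Suc j * nrm u + CA * \<sigma> ^ j * nrm u"
      using avg_rate(2)[OF u, of "Suc j"] avg_rate(2)[OF u, of j]
      by (intro add_mono) (auto simp: l2_minus_commute[of lebesgue "avg (Suc j) u" u])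
    also have "\<dots> \<le> CA * \<sigma> ^ j * nrm u + CA * \<sigma> ^ j * nrm u"
      using \<sigma> CA_nonneg by (intro add_mono mult_right_mono mult_left_mono order_refl) (auto simp: mult_left_le_one_le)
    also have "\<dots> = (2 * CA / \<sigma>) * \<sigma> ^ Suc j * nrm u" using \<sigma> by simp
    also have "\<dots> \<le> A * \<sigma> ^ Suc j * nrm u"
      unfolding A_def using \<sigma> sV by (intro mult_right_mono divide_right_mono) auto
    finally show ?thesis using Suc by simp
  qed
qed

text \<open>The integral of the power \<open>p\<close> of an increment is at most its uniform bound to the power \<open>p - 2\<close> times its
  squared norm, which is a geometric sequence with ratio below \<open>1\<close>. The powers are summed with
  \<open>power_sum_le\<close>, whose weights use up the square root of the ratio.\<close>

theorem subcritical_embedding: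
  assumes p: "2 \<le> p" "p < 2 * real CARD('n) / (real CARD('n) - \<alpha>)"
  shows "\<exists>C\<ge>0. \<forall>u\<in>E. integrable lebesgue (\<lambda>x. \<bar>u x\<bar> powr p) \<and> (LINT x|lebesgue. \<bar>u x\<bar> powr p) \<le> C * nrm u powr p"
proof -
  note wb = increment_bounds
  have A0: "0 \<le> A" unfolding A_def using \<sigma> CA_nonneg V0_pos by simp
  have \<rho>0: "0 < \<rho>" by (simp add: \<rho>_def)
  define \<theta> where "\<theta> = \<rho> powr (p - 2) * \<sigma>\<^sup>2"
  have \<theta>0: "0 < \<theta>" using \<rho>0 \<sigma> by (simp add: \<theta>_def)
  have \<theta>1: "\<theta> < 1"
  proof -
    have "\<theta> = 2 powr ((real CARD('n) - \<alpha>) / 2 * (p - 2) + (- \<alpha>))"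
      by (simp add: \<theta>_def \<rho>_def \<sigma>_def powr_powr powr_add power2_eq_square powr_add[symmetric])
    also have "(real CARD('n) - \<alpha>) / 2 * (p - 2) + (- \<alpha>) < 0"
      using p \<alpha> by (simp add: pos_less_divide_eq algebra_simps)
    then have "2 powr ((real CARD('n) - \<alpha>) / 2 * (p - 2) + (- \<alpha>)) < 2 powr (0::real)" by (intro powr_less_mono) auto
    finally show ?thesis by simp
  qed
  \<comment> \<open>the weight for which \<open>\<mu> powr p\<close> is the square root of the ratio, so that a convergent geometric series remains\<close>
  define \<mu> where "\<mu> = \<theta> powr (1 / (2 * p))"
  have \<mu>: "0 < \<mu>" "\<mu> < 1" using \<theta>0 \<theta>1 p powr_less_mono2[of "1 / (2*p)" \<theta> 1] by (auto simp: \<mu>_def)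
  have \<mu>p: "\<mu> powr p = sqrt \<theta>"
    using p \<theta>0 by (simp add: \<mu>_def powr_powr powr_half_sqrt)
  have sq1: "sqrt \<theta> < 1" using \<theta>0 \<theta>1 by simp
  define C where "C = (1 / (1 - \<mu>)) powr p * (A powr p * (1 / (1 - sqrt \<theta>)))"
  have C0: "0 \<le> C" unfolding C_def using sq1 by (intro mult_nonneg_nonneg) auto
  have "integrable lebesgue (\<lambda>x. \<bar>u x\<bar> powr p) \<and> (LINT x|lebesgue. \<bar>u x\<bar> powr p) \<le> C * nrm u powr p" if u: "u \<in> E" for u
  proof -
    have wm[measurable]: "incr u k \<in> borel_measurable lebesgue" for k using wb(1)[OF u, of k] by (simp add: sq_int_def)
    have um[measurable]: "u \<in> borel_measurable lebesgue" using E_D(4)[OF u] .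
    have am[measurable]: "avg k u \<in> borel_measurable lebesgue" for k by (rule avg_measurable_lebesgue)
    let ?n = "nrm u"
    have wp: "integrable lebesgue (\<lambda>x. \<bar>incr u k x\<bar> powr p) \<and> (LINT x|lebesgue. \<bar>incr u k x\<bar> powr p) \<le> A powr p * ?n powr p * \<theta> ^ k" for k
    proof -
      let ?b = "(A * \<rho> ^ k * ?n) powr (p - 2)"
      have pw: "\<bar>incr u k x\<bar> powr p \<le> ?b * (incr u k x)\<^sup>2" for x
        unfolding powr_split2[of "incr u k x" p] using wb(2)[OF u, of k x] p by (intro mult_right_mono powr_mono2) auto
      have i2: "integrable lebesgue (\<lambda>x. ?b * (incr u k x)\<^sup>2)" using wb(1)[OF u, of k] by (auto simp: sq_int_def)
      have i: "integrable lebesgue (\<lambda>x. \<bar>incr u k x\<bar> powr p)"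
        by (rule Bochner_Integration.integrable_bound[OF i2]) (use pw in auto)
      have "(LINT x|lebesgue. \<bar>incr u k x\<bar> powr p) \<le> (LINT x|lebesgue. ?b * (incr u k x)\<^sup>2)"
        by (intro integral_mono i i2 pw)
      also have "\<dots> = ?b * (l2 lebesgue (incr u k))\<^sup>2" by (simp add: l2_power2)
      also have "\<dots> \<le> ?b * (A * \<sigma> ^ k * ?n)\<^sup>2"
        using wb(3)[OF u, of k] by (intro mult_left_mono power_mono) auto
      also have "\<dots> = A powr p * ?n powr p * \<theta> ^ k"
      proof -
        have pp: "x powr (p - 2) * x\<^sup>2 = x powr p" if "0 \<le> x" for x :: real
          using powr_split2[of x p] that by simp
        have "?b = A powr (p - 2) * (\<rho> powr (p - 2)) ^ k * ?n powr (p - 2)"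
          using A0 \<rho>0 by (simp add: powr_mult powr_power powr_powr powr_realpow[symmetric] mult.commute)
        then have "?b * (A * \<sigma> ^ k * ?n)\<^sup>2 = (A powr (p - 2) * A\<^sup>2) * (?n powr (p - 2) * ?n\<^sup>2) * ((\<rho> powr (p - 2)) ^ k * (\<sigma>\<^sup>2) ^ k)"
          by (simp add: power_mult_distrib power_mult[symmetric] mult_ac)
        also have "\<dots> = A powr p * ?n powr p * \<theta> ^ k"
          using A0 by (simp only: pp nrm_nonneg \<theta>_def power_mult_distrib)
        finally show ?thesis .
      qed
      finally show ?thesis using i by simp
    qed
    have avgb: "integrable lebesgue (\<lambda>x. \<bar>avg K u x\<bar> powr p) \<and> (LINT x|lebesgue. \<bar>avg K u x\<bar> powr p) \<le> C * ?n powr p" for K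
    proof -
      let ?s = "\<lambda>x. (1 / (1 - \<mu>)) powr p * (\<Sum>k\<le>K. (1 / sqrt \<theta>) ^ k * \<bar>incr u k x\<bar> powr p)"
      have pw: "\<bar>avg K u x\<bar> powr p \<le> ?s x" for x
      proof -
        have "\<bar>avg K u x\<bar> \<le> (\<Sum>k\<le>K. \<bar>incr u k x\<bar>)" unfolding wb(4)[OF u, symmetric] by (rule sum_abs)
        then have "\<bar>avg K u x\<bar> powr p \<le> (\<Sum>k\<le>K. \<bar>incr u k x\<bar>) powr p" using p by (intro powr_mono2) auto
        also have "\<dots> \<le> (1 / (1 - \<mu>)) powr p * (\<Sum>k\<le>K. (\<bar>incr u k x\<bar> / \<mu> ^ k) powr p)"
          by (rule power_sum_le) (use \<mu> p in auto)
        also have "(\<Sum>k\<le>K. (\<bar>incr u k x\<bar> / \<mu> ^ k) powr p) = (\<Sum>k\<le>K. (1 / sqrt \<theta>) ^ k * \<bar>incr u k x\<bar> powr p)"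
        proof (intro sum.cong refl)
          fix k
          have "(\<mu> ^ k) powr p = (\<mu> powr p) ^ k"
            using \<mu> by (simp add: powr_power powr_powr powr_realpow[symmetric] mult.commute)
          then show "(\<bar>incr u k x\<bar> / \<mu> ^ k) powr p = (1 / sqrt \<theta>) ^ k * \<bar>incr u k x\<bar> powr p"
            using \<mu> by (simp add: powr_divide \<mu>p power_divide)
        qed
        finally show ?thesis .
      qed
      have ints: "integrable lebesgue ?s" using wp by (intro integrable_mult_right Bochner_Integration.integrable_sum) auto
      have i: "integrable lebesgue (\<lambda>x. \<bar>avg K u x\<bar> powr p)"
        by (rule Bochner_Integration.integrable_bound[OF ints]) (use pw in \<open>auto intro: order_trans[OF _ abs_ge_self]\<close>)
      have "(LINT x|lebesgue. \<bar>avg K u x\<bar> powr p) \<le> (LINT x|lebesgue. ?s x)" by (intro integral_mono i ints pw)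
      also have "\<dots> = (1 / (1 - \<mu>)) powr p * (\<Sum>k\<le>K. (1 / sqrt \<theta>) ^ k * (LINT x|lebesgue. \<bar>incr u k x\<bar> powr p))"
        using wp by (simp add: Bochner_Integration.integral_sum)
      also have "\<dots> \<le> (1 / (1 - \<mu>)) powr p * (\<Sum>k\<le>K. (1 / sqrt \<theta>) ^ k * (A powr p * ?n powr p * \<theta> ^ k))"
        using wp \<theta>0 by (intro mult_left_mono sum_mono) auto
      also have "(\<Sum>k\<le>K. (1 / sqrt \<theta>) ^ k * (A powr p * ?n powr p * \<theta> ^ k)) = A powr p * ?n powr p * (\<Sum>k\<le>K. sqrt \<theta> ^ k)"
      proof -
        have "(1 / sqrt \<theta>) ^ k * \<theta> ^ k = sqrt \<theta> ^ k" for k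
          using \<theta>0 by (simp add: power_mult_distrib[symmetric] real_div_sqrt)
        then have "(1 / sqrt \<theta>) ^ k * (A powr p * ?n powr p * \<theta> ^ k) = A powr p * ?n powr p * sqrt \<theta> ^ k" for k
          by (metis mult.left_commute)
        then show ?thesis by (simp only: sum_distrib_left)
      qed
      also have "(\<Sum>k\<le>K. sqrt \<theta> ^ k) \<le> 1 / (1 - sqrt \<theta>)"
      proof -
        have "(\<Sum>k\<le>K. sqrt \<theta> ^ k) \<le> (\<Sum>k. sqrt \<theta> ^ k)" using \<theta>0 sq1 by (intro sum_le_suminf summable_geometric) auto
        then show ?thesis using \<theta>0 sq1 by (simp add: suminf_geometric)
      qed
      finally have "(LINT x|lebesgue. \<bar>avg K u x\<bar> powr p) \<le> (1 / (1 - \<mu>)) powr p * (A powr p * ?n powr p * (1 / (1 - sqrt \<theta>)))"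
        by (simp add: mult_left_mono)
      then show ?thesis using i by (simp add: C_def mult_ac)
    qed
    obtain r where "strict_mono (r :: nat \<Rightarrow> nat)" and r: "AE x in lebesgue. (\<lambda>n. avg (r n) u x) \<longlonglongrightarrow> u x"
      using l2_tendsto_AE_subseq[OF avg_sq_int[OF u] E_D(1)[OF u] avg_tendsto[OF u]] by blast
    have l: "AE x in lebesgue. (\<lambda>n. \<bar>avg (r n) u x\<bar> powr p) \<longlonglongrightarrow> \<bar>u x\<bar> powr p"
      using r by eventually_elim (use p in \<open>auto intro!: tendsto_powr' tendsto_rabs\<close>)
    have m: "(\<lambda>x. \<bar>u x\<bar> powr p) \<in> borel_measurable lebesgue" by measurable
    have ev: "eventually (\<lambda>n. (LINT x|lebesgue. \<bar>avg (r n) u x\<bar> powr p) \<le> C * ?n powr p) sequentially"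
      using avgb by simp
    show ?thesis
      using Fatou_integral_bound[OF _ _ l m ev] avgb by auto
  qed
  with C0 show ?thesis by blast
qed

end

section \<open>Compactness\<close>

lemma sq_int_indicator_cball_lebesgue:
  "sq_int lebesgue (\<lambda>x::'a::euclidean_space. b * indicator (cball 0 R) x :: real)"
  using sq_int_indicator_cball[of b R] by (subst sq_int_lebesgue_iff) (auto simp: sq_int_def)

lemma l2_lower_semicontinuous:
  fixes f :: "nat \<Rightarrow> 'a \<Rightarrow> 'b::{banach,second_countable_topology}"
  assumes f: "\<And>n. sq_int M (f n)" and w: "w \<in> borel_measurable M"
    and l: "AE x in M. (\<lambda>n. f n x) \<longlonglongrightarrow> w x" and c: "(\<lambda>n. l2 M (f n)) \<longlonglongrightarrow> c"
  shows "sq_int M w \<and> (l2 M w)\<^sup>2 \<le> c\<^sup>2"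
proof -
  have i: "integrable M (\<lambda>x. (norm (f n x))\<^sup>2)" for n using f by (simp add: sq_int_def)
  have l: "AE x in M. (\<lambda>n. (norm (f n x))\<^sup>2) \<longlonglongrightarrow> (norm (w x))\<^sup>2"
    using l by eventually_elim (intro tendsto_intros)
  have m: "(\<lambda>x. (norm (w x))\<^sup>2) \<in> borel_measurable M" using w by measurable
  have c2: "(\<lambda>n. (l2 M (f n))\<^sup>2) \<longlonglongrightarrow> c\<^sup>2" by (intro tendsto_intros c)
  have F: "integrable M (\<lambda>x. (norm (w x))\<^sup>2)" "(LINT x|M. (norm (w x))\<^sup>2) \<le> c\<^sup>2 + e" if e: "e > 0" for e
  proof -
    have "eventually (\<lambda>n. (l2 M (f n))\<^sup>2 < c\<^sup>2 + e) sequentially"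
      using order_tendstoD(2)[OF c2] e by simp
    then have ev: "eventually (\<lambda>n. (LINT x|M. (norm (f n x))\<^sup>2) \<le> c\<^sup>2 + e) sequentially"
      unfolding l2_power2 by eventually_elim simp
    show "integrable M (\<lambda>x. (norm (w x))\<^sup>2)" "(LINT x|M. (norm (w x))\<^sup>2) \<le> c\<^sup>2 + e"
      using Fatou_integral_bound[OF i _ l m ev] by auto
  qed
  have "(LINT x|M. (norm (w x))\<^sup>2) \<le> c\<^sup>2" using F(2) by (rule field_le_epsilon)
  then show ?thesis using F(1)[of 1] w by (simp add: sq_int_def l2_power2)
qed

lemma truncate_diff: "truncate R (\<lambda>x. u x - v x) = (\<lambda>x. truncate R u x - truncate R v x)"
  by (auto simp: truncate_def indicator_def)

lemma l2_truncate_le: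
  assumes u: "sq_int lebesgue u" shows "l2 lebesgue (truncate R u) \<le> l2 lebesgue u"
  using sq_int_dominated(2)[OF _ u, of "truncate R u" 1] truncate_props(1)[OF u, of R]
  by (auto simp: sq_int_def truncate_def indicator_def)

context confining_potential
begin

lemma nrm_triangle:
  assumes u: "u \<in> E" and v: "v \<in> E" shows "nrm (\<lambda>x. u x + v x) \<le> nrm u + nrm v"
proof (rule power2_le_imp_le)
  have "(nrm (\<lambda>x. u x + v x))\<^sup>2 = (nrm u)\<^sup>2 + 2 * B u v + (nrm v)\<^sup>2"
    using nrm_linear_power2[OF u v, of 1 1] by simp
  also have "\<dots> \<le> (nrm u + nrm v)\<^sup>2" using B_bound[OF u v] by (simp add: power2_sum)
  finally show "(nrm (\<lambda>x. u x + v x))\<^sup>2 \<le> (nrm u + nrm v)\<^sup>2" .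
qed simp

lemma nrm_triangle_diff:
  assumes u: "u \<in> E" and v: "v \<in> E" shows "nrm (\<lambda>x. u x - v x) \<le> nrm u + nrm v"
  using nrm_triangle[OF u E_scale[OF v, of "-1"]] nrm_scale[OF v, of "-1"] by simp

text \<open>Outside a large ball \<open>V\<close> is at least the inverse square of \<open>e\<close>.\<close>

lemma uniform_tail:
  assumes e: "e > 0" shows "\<exists>R. \<forall>u\<in>E. l2 lebesgue (\<lambda>x. u x - truncate R u x) \<le> e * nrm u"
proof -
  have "eventually (\<lambda>x. 1 / e\<^sup>2 \<le> V x) at_infinity" using V_filterlim by (simp add: filterlim_at_top)
  then obtain R where R: "\<And>x. R \<le> norm x \<Longrightarrow> 1 / e\<^sup>2 \<le> V x" by (auto simp: eventually_at_infinity)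
  have "l2 lebesgue (\<lambda>x. u x - truncate R u x) \<le> e * nrm u" if u: "u \<in> E" for u
  proof -
    have "l2 lebesgue (\<lambda>x. u x - truncate R u x) \<le> e * l2 lebesgue (pot u)"
    proof (rule sq_int_dominated(2)[OF _ E_D(3)[OF u]])
      show "(\<lambda>x. u x - truncate R u x) \<in> borel_measurable lebesgue"
        using sq_int_diff[OF E_D(1)[OF u] truncate_props(1)[OF E_D(1)[OF u]]] by (simp add: sq_int_def)
      have "norm (u x - truncate R u x) \<le> e * norm (pot u x)" for x
      proof (cases "norm x < R")
        case True then show ?thesis using e by (simp add: truncate_def)
      next
        case False
        then have "1 / e\<^sup>2 \<le> V x" using R by simp
        then have "sqrt (1 / e\<^sup>2) \<le> sqrt (V x)" by (simp only: real_sqrt_le_iff)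
        then have "1 / e \<le> sqrt (V x)" using e by (simp add: real_sqrt_divide)
        then have "1 \<le> e * sqrt (V x)" using e by (simp add: pos_divide_le_eq mult.commute)
        then have "1 * \<bar>u x\<bar> \<le> (e * sqrt (V x)) * \<bar>u x\<bar>" by (intro mult_right_mono) auto
        then show ?thesis using False V_pos[of x] by (simp add: truncate_def pot_def abs_mult mult.assoc)
      qed
      then show "AE x in lebesgue. norm (u x - truncate R u x) \<le> e * norm (pot u x)" by simp
    qed (use e in simp)
    also have "\<dots> \<le> e * nrm u" using e pot_le_nrm by (intro mult_left_mono) auto
    finally show ?thesis .
  qed
  then show ?thesis by blast
qed

text \<open>The countably many integrals over dyadic cubes converge along a diagonal subsequence, so
  all averages converge pointwise; the averages approximate uniformly, and the confining
  potential controls the tails.\<close>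

lemma compact_embedding_L2:
  assumes u: "\<And>n. u n \<in> E" and M: "\<And>n. nrm (u n) \<le> M"
  obtains r g where "strict_mono (r :: nat \<Rightarrow> nat)" "sq_int lebesgue g" "(\<lambda>n. l2 lebesgue (\<lambda>x. u (r n) x - g x)) \<longlonglongrightarrow> 0"
proof -
  \<comment> \<open>a bounded sequence of functions on a countable index set, to which the diagonal argument applies\<close>
  define f where "f = (\<lambda>n (k :: nat, z). LINT y|lebesgue. indicator {y. cell k y = z} y * u n y)"
  have M0: "0 \<le> M" using M[of 0] nrm_nonneg[of "u 0"] by linarith
  have lM: "l2 lebesgue (u n) \<le> M / sqrt V0" for n
    using l2_le_nrm[OF u[of n]] M[of n] V0_pos by (meson divide_right_mono order_trans real_sqrt_ge_zero less_imp_le)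
  have fb: "norm (f n kz) \<le> M / sqrt V0" for n kz
  proof (cases kz)
    case (Pair k z)
    have "norm (f n kz) \<le> sqrt (1 / 2 ^ (k * CARD('n))) * l2 lebesgue (u n)"
      using cell_integral_bound[OF E_D(1)[OF u[of n]], of k z] by (simp add: f_def Pair)
    also have "\<dots> \<le> 1 * l2 lebesgue (u n)" by (intro mult_right_mono) auto
    finally show ?thesis using lM[of n] by simp
  qed
  obtain r :: "nat \<Rightarrow> nat" where r: "strict_mono r" and conv: "\<And>kz. \<exists>l. (\<lambda>n. f (r n) kz) \<longlonglongrightarrow> l"
    using function_convergent_subsequence[of UNIV f "M / sqrt V0"] fb by auto
  have avc: "convergent (\<lambda>n. truncate R (avg k (u (r n))) x)" for R k x
  proof -
    obtain l where "(\<lambda>n. f (r n) (k, cell k x)) \<longlonglongrightarrow> l" using conv by blast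
    then have "(\<lambda>n. indicator (ball 0 R) x * (2 ^ (k * CARD('n)) * f (r n) (k, cell k x))) \<longlonglongrightarrow> indicator (ball 0 R) x * (2 ^ (k * CARD('n)) * l)"
      by (intro tendsto_intros)
    then show ?thesis by (auto simp: f_def truncate_def avg_def intro: convergentI)
  qed
  \<comment> \<open>the tolerance is shared between the tails, the averaging error and the truncated averages \<open>T\<close>, which converge dominatedly\<close>
  have C: "\<exists>N. \<forall>m\<ge>N. \<forall>n\<ge>N. l2 lebesgue (\<lambda>x. u (r m) x - u (r n) x) < e" if e: "e > 0" for e
  proof -
    obtain R where R: "\<And>u. u \<in> E \<Longrightarrow> l2 lebesgue (\<lambda>x. u x - truncate R u x) \<le> (e / (6 * (M + 1))) * nrm u"
      using uniform_tail[of "e / (6 * (M + 1))"] e M0 by auto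
    have R': "l2 lebesgue (\<lambda>x. u n x - truncate R (u n) x) \<le> e / 6" for n
    proof -
      have "(e / (6 * (M + 1))) * nrm (u n) \<le> (e / (6 * (M + 1))) * (M + 1)"
        using e M0 M[of n] by (intro mult_left_mono) auto
      also have "\<dots> = e / 6" using M0 by (simp add: field_simps)
      finally show ?thesis using R[OF u[of n]] by linarith
    qed
    have "(\<lambda>k. CA * \<sigma> ^ k * M) \<longlonglongrightarrow> CA * 0 * M"
      using \<sigma> by (intro tendsto_intros LIMSEQ_power_zero) auto
    then have "eventually (\<lambda>k. CA * \<sigma> ^ k * M < e / 6) sequentially" by (rule order_tendstoD) (use e in simp)
    then obtain k where k: "CA * \<sigma> ^ k * M < e / 6" by (auto simp: eventually_sequentially)
    define T where "T = (\<lambda>n. truncate R (avg k (u (r n))))"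
    have Ts: "sq_int lebesgue (T n)" for n unfolding T_def by (intro truncate_props avg_sq_int u)
    then have Tm[measurable]: "T n \<in> borel_measurable lebesgue" for n by (simp add: sq_int_def)
    have uT: "l2 lebesgue (\<lambda>x. u (r n) x - T n x) \<le> e / 3" for n
    proof -
      let ?u = "u (r n)"
      note us = E_D(1)[OF u[of "r n"]]
      have "l2 lebesgue (\<lambda>x. ?u x - T n x) \<le> l2 lebesgue (\<lambda>x. ?u x - truncate R ?u x) + l2 lebesgue (\<lambda>x. truncate R ?u x - T n x)"
        by (intro l2_triangle_diff us truncate_props Ts)
      also have "(\<lambda>x. truncate R ?u x - T n x) = truncate R (\<lambda>x. ?u x - avg k ?u x)" by (simp add: T_def truncate_diff)
      also have "l2 lebesgue (truncate R (\<lambda>x. ?u x - avg k ?u x)) \<le> l2 lebesgue (\<lambda>x. ?u x - avg k ?u x)"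
        by (rule l2_truncate_le[OF avg_rate(1)[OF u]])
      also have "\<dots> \<le> CA * \<sigma> ^ k * nrm ?u" by (rule avg_rate(2)[OF u])
      also have "\<dots> \<le> CA * \<sigma> ^ k * M" using CA_nonneg \<sigma> M[of "r n"] by (intro mult_left_mono) auto
      finally show ?thesis using R'[of "r n"] k by linarith
    qed
    define g where "g = (\<lambda>x. lim (\<lambda>n. T n x))"
    have gm: "g \<in> borel_measurable lebesgue" unfolding g_def by measurable
    let ?b = "sqrt (2 ^ (k * CARD('n))) * (M / sqrt V0)"
    have dom: "norm (T n x) \<le> ?b * indicator (cball 0 R) x" for n x
    proof -
      have "\<bar>avg k (u (r n)) x\<bar> \<le> sqrt (2 ^ (k * CARD('n))) * l2 lebesgue (u (r n))" by (rule avg_bound[OF E_D(1)[OF u]])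
      also have "\<dots> \<le> ?b" by (intro mult_left_mono lM) auto
      finally show ?thesis using M0 V0_pos by (auto simp: T_def truncate_def indicator_def)
    qed
    have lim: "(\<lambda>n. T n x) \<longlonglongrightarrow> g x" for x
      using avc[of R k x] by (simp add: g_def T_def convergent_LIMSEQ_iff)
    have limAE: "AE x in lebesgue. (\<lambda>n. T n x) \<longlonglongrightarrow> g x" by (intro always_eventually allI lim)
    have domAE: "AE x in lebesgue. norm (T n x) \<le> ?b * indicator (cball 0 R) x" for n
      by (intro always_eventually allI dom)
    note dc = l2_dominated_convergence[OF Tm gm sq_int_indicator_cball_lebesgue[of ?b R] limAE domAE]
    have gs: "sq_int lebesgue g" by (rule dc(1))
    have gl: "(\<lambda>n. l2 lebesgue (\<lambda>x. T n x - g x)) \<longlonglongrightarrow> 0" by (rule dc(3))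
    from order_tendstoD(2)[OF gl, of "e/6"] e obtain N where N: "\<And>n. n \<ge> N \<Longrightarrow> l2 lebesgue (\<lambda>x. T n x - g x) < e / 6"
      by (auto simp: eventually_sequentially)
    have "l2 lebesgue (\<lambda>x. u (r m) x - u (r n) x) < e" if "m \<ge> N" "n \<ge> N" for m n
    proof -
      note um = E_D(1)[OF u[of "r m"]] and un = E_D(1)[OF u[of "r n"]]
      have "l2 lebesgue (\<lambda>x. u (r m) x - u (r n) x) \<le> l2 lebesgue (\<lambda>x. u (r m) x - T m x) + l2 lebesgue (\<lambda>x. T m x - u (r n) x)"
        by (intro l2_triangle_diff um un Ts)
      moreover have "l2 lebesgue (\<lambda>x. T m x - u (r n) x) \<le> l2 lebesgue (\<lambda>x. T m x - g x) + l2 lebesgue (\<lambda>x. g x - u (r n) x)"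
        by (intro l2_triangle_diff Ts gs un)
      moreover have "l2 lebesgue (\<lambda>x. g x - u (r n) x) \<le> l2 lebesgue (\<lambda>x. g x - T n x) + l2 lebesgue (\<lambda>x. T n x - u (r n) x)"
        by (intro l2_triangle_diff Ts gs un)
      ultimately show ?thesis
        using N[OF that(1)] N[OF that(2)] uT[of m] uT[of n]
        by (simp add: l2_minus_commute[of lebesgue g "T n"] l2_minus_commute[of lebesgue "T n" "u (r n)"])
    qed
    then show ?thesis by blast
  qed
  obtain g where "sq_int lebesgue g" "(\<lambda>n. l2 lebesgue (\<lambda>x. u (r n) x - g x)) \<longlonglongrightarrow> 0"
    using l2_complete[of lebesgue "\<lambda>n. u (r n)"] E_D(1)[OF u] C by blast
  with r show ?thesis by (rule that)
qed

text \<open>Split at the level \<open>K\<close>: below it the power \<open>p\<close> is controlled by the square, above it by a slightly larger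
  subcritical power, which is bounded and gains a negative power of \<open>K\<close>.\<close>

lemma L2_convergence_imp_Lp:
  assumes p: "2 \<le> p" "p < 2 * real CARD('n) / (real CARD('n) - \<alpha>)"
    and d: "\<And>n. d n \<in> E" and M: "\<And>n. nrm (d n) \<le> M" and l: "(\<lambda>n. l2 lebesgue (d n)) \<longlonglongrightarrow> 0"
  shows "(\<lambda>n. LINT x|lebesgue. \<bar>d n x\<bar> powr p) \<longlonglongrightarrow> 0"
proof (rule LIMSEQ_I)
  fix e :: real assume e: "e > 0"
  obtain p' where p': "p < p'" "p' < 2 * real CARD('n) / (real CARD('n) - \<alpha>)" using dense[OF p(2)] by blast
  then have p'2: "2 \<le> p'" using p by simp
  obtain C where C0: "C \<ge> 0" and C: "\<And>u. u \<in> E \<Longrightarrow> integrable lebesgue (\<lambda>x. \<bar>u x\<bar> powr p')"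
    "\<And>u. u \<in> E \<Longrightarrow> (LINT x|lebesgue. \<bar>u x\<bar> powr p') \<le> C * nrm u powr p'"
    using subcritical_embedding[OF p'2 p'(2)] by blast
  have ip: "integrable lebesgue (\<lambda>x. \<bar>u x\<bar> powr p)" if "u \<in> E" for u
    using subcritical_embedding[OF p] that by blast
  have "((\<lambda>K. K powr (p - p') * (C * M powr p')) \<longlongrightarrow> 0 * (C * M powr p')) at_top"
    using p' by (intro tendsto_mult tendsto_const tendsto_neg_powr filterlim_ident) auto
  then have "eventually (\<lambda>K. K powr (p - p') * (C * M powr p') < e / 2 \<and> 0 < K) at_top"
    using e by (intro eventually_conj order_tendstoD(2)[where y="0 * (C * M powr p')"] eventually_gt_at_top) auto
  then obtain K where K: "K powr (p - p') * (C * M powr p') < e / 2" "0 < K"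
    by (auto simp: eventually_at_top_linorder)
  have "(\<lambda>n. K powr (p - 2) * (l2 lebesgue (d n))\<^sup>2) \<longlonglongrightarrow> K powr (p - 2) * 0\<^sup>2" by (intro tendsto_intros l)
  from order_tendstoD(2)[OF this, of "e/2"] e obtain N where N: "\<And>n. n \<ge> N \<Longrightarrow> K powr (p - 2) * (l2 lebesgue (d n))\<^sup>2 < e / 2"
    by (auto simp: eventually_sequentially)
  have "norm ((LINT x|lebesgue. \<bar>d n x\<bar> powr p) - 0) < e" if "n \<ge> N" for n
  proof -
    have pw: "\<bar>t\<bar> powr p \<le> K powr (p - 2) * t\<^sup>2 + K powr (p - p') * \<bar>t\<bar> powr p'" for t :: real
    proof (cases "\<bar>t\<bar> \<le> K")
      case True
      then have "\<bar>t\<bar> powr (p - 2) * t\<^sup>2 \<le> K powr (p - 2) * t\<^sup>2" using p by (intro mult_right_mono powr_mono2) auto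
      then show ?thesis using powr_split2[of t p] by (simp add: add_increasing2)
    next
      case False
      then have "\<bar>t\<bar> powr p = \<bar>t\<bar> powr (p - p') * \<bar>t\<bar> powr p'" by (simp add: powr_add[symmetric])
      also have "\<dots> \<le> K powr (p - p') * \<bar>t\<bar> powr p'" using False K p' by (intro mult_right_mono powr_mono2') auto
      finally show ?thesis by (simp add: add_increasing)
    qed
    have i2: "integrable lebesgue (\<lambda>x. (d n x)\<^sup>2)" using E_D(1)[OF d[of n]] by (auto simp: sq_int_def)
    have "(LINT x|lebesgue. \<bar>d n x\<bar> powr p) \<le> (LINT x|lebesgue. K powr (p - 2) * (d n x)\<^sup>2 + K powr (p - p') * \<bar>d n x\<bar> powr p')"
      using i2 C(1)[OF d[of n]] by (intro integral_mono ip d pw) auto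
    also have "\<dots> = K powr (p - 2) * (l2 lebesgue (d n))\<^sup>2 + K powr (p - p') * (LINT x|lebesgue. \<bar>d n x\<bar> powr p')"
      using i2 C(1)[OF d[of n]] by (simp add: l2_power2)
    also have "\<dots> \<le> K powr (p - 2) * (l2 lebesgue (d n))\<^sup>2 + K powr (p - p') * (C * M powr p')"
    proof (intro add_left_mono mult_left_mono)
      have "(LINT x|lebesgue. \<bar>d n x\<bar> powr p') \<le> C * nrm (d n) powr p'" by (rule C(2)[OF d])
      also have "\<dots> \<le> C * M powr p'" using M[of n] p'2 C0 by (intro mult_left_mono powr_mono2) auto
      finally show "(LINT x|lebesgue. \<bar>d n x\<bar> powr p') \<le> C * M powr p'" .
    qed simp
    also have "\<dots> < e" using N[OF that] K(1) by linarith
    finally have "(LINT x|lebesgue. \<bar>d n x\<bar> powr p) < e" .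
    moreover have "0 \<le> (LINT x|lebesgue. \<bar>d n x\<bar> powr p)" by simp
    ultimately show ?thesis by simp
  qed
  then show "\<exists>no. \<forall>n\<ge>no. norm ((LINT x|lebesgue. \<bar>d n x\<bar> powr p) - 0) < e" by blast
qed

lemma abs_powr_add_le:
  fixes a b :: real
  assumes "0 \<le> p" shows "\<bar>a + b\<bar> powr p \<le> 2 powr p * (\<bar>a\<bar> powr p + \<bar>b\<bar> powr p)"
proof -
  have "\<bar>a + b\<bar> powr p \<le> (2 * max \<bar>a\<bar> \<bar>b\<bar>) powr p" using assms by (intro powr_mono2) auto
  also have "\<dots> = 2 powr p * max \<bar>a\<bar> \<bar>b\<bar> powr p" by (simp only: powr_mult)
  also have "\<dots> \<le> 2 powr p * (\<bar>a\<bar> powr p + \<bar>b\<bar> powr p)" by (intro mult_left_mono) (auto simp: max_def)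
  finally show ?thesis .
qed

text \<open>Convergence is delivered as almost everywhere convergence under a majorant, so that nonlinear
  functionals can be treated by dominated convergence alone.\<close>

theorem bounded_sequence_compact:
  assumes p: "2 \<le> p" "p < 2 * real CARD('n) / (real CARD('n) - \<alpha>)"
    and u: "\<And>n. u n \<in> E" and M: "\<And>n. nrm (u n) \<le> M"
  obtains r v L k where "strict_mono (r :: nat \<Rightarrow> nat)" "v \<in> E" "AE x in lebesgue. (\<lambda>n. u (r n) x) \<longlonglongrightarrow> v x"
    "integrable lebesgue k" "\<And>n. AE x in lebesgue. (u (r n) x)\<^sup>2 + \<bar>u (r n) x\<bar> powr p \<le> k x"
    "(\<lambda>n. nrm (u (r n))) \<longlonglongrightarrow> L" "nrm v \<le> L"
proof -
  obtain r1 v where r1: "strict_mono (r1 :: nat \<Rightarrow> nat)" and vs: "sq_int lebesgue v"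
    and l1: "(\<lambda>n. l2 lebesgue (\<lambda>x. u (r1 n) x - v x)) \<longlonglongrightarrow> 0"
    by (rule compact_embedding_L2[OF u M])
  have M0: "0 \<le> M" using M[of 0] nrm_nonneg[of "u 0"] by linarith
  \<comment> \<open>a further subsequence makes both parts of the norm converge, as each is compared with its limit separately\<close>
  have "bounded (range (\<lambda>n. (l2 lebesgue (kin (u (r1 n))), l2 lebesgue (pot (u (r1 n))))))"
  proof (rule boundedI)
    fix z assume "z \<in> range (\<lambda>n. (l2 lebesgue (kin (u (r1 n))), l2 lebesgue (pot (u (r1 n)))))"
    then obtain n where z: "z = (l2 lebesgue (kin (u (r1 n))), l2 lebesgue (pot (u (r1 n))))" by blast
    have "norm z = sqrt ((nrm (u (r1 n)))\<^sup>2)" unfolding z norm_Pair by (simp add: nrm_power2)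
    then show "norm z \<le> M" using M[of "r1 n"] by simp
  qed
  then obtain ab and r2 :: "nat \<Rightarrow> nat" where r2: "strict_mono r2"
    and ab: "((\<lambda>n. (l2 lebesgue (kin (u (r1 n))), l2 lebesgue (pot (u (r1 n))))) \<circ> r2) \<longlonglongrightarrow> ab"
    using bounded_imp_convergent_subsequence by blast
  define s where "s = r1 \<circ> r2"
  have s: "strict_mono s" unfolding s_def using r1 r2 by (rule strict_mono_o)
  have ka: "(\<lambda>n. l2 lebesgue (kin (u (s n)))) \<longlonglongrightarrow> fst ab" and pb: "(\<lambda>n. l2 lebesgue (pot (u (s n)))) \<longlonglongrightarrow> snd ab"
    using tendsto_fst[OF ab] tendsto_snd[OF ab] by (simp_all add: s_def o_def)
  have ls: "(\<lambda>n. l2 lebesgue (\<lambda>x. u (s n) x - v x)) \<longlonglongrightarrow> 0"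
    using LIMSEQ_subseq_LIMSEQ[OF l1 r2] by (simp add: s_def o_def)
  define L where "L = sqrt ((fst ab)\<^sup>2 + (snd ab)\<^sup>2)"
  have Ll: "(\<lambda>n. nrm (u (s n))) \<longlonglongrightarrow> L"
  proof -
    have "(\<lambda>n. sqrt ((l2 lebesgue (kin (u (s n))))\<^sup>2 + (l2 lebesgue (pot (u (s n))))\<^sup>2)) \<longlonglongrightarrow> L"
      unfolding L_def by (intro tendsto_intros ka pb)
    then show ?thesis by (simp add: nrm_power2[symmetric])
  qed
  note us = E_D(1)[OF u]
  \<comment> \<open>lower semicontinuity: both square norms pass to the limit along an almost everywhere convergent subsequence\<close>
  obtain t where t: "strict_mono (t :: nat \<Rightarrow> nat)" and tu: "AE x in lebesgue. (\<lambda>n. u (s (t n)) x) \<longlonglongrightarrow> v x"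
    using l2_tendsto_AE_subseq[OF us vs ls] by blast
  have "(\<lambda>n. l2 lebesgue (\<lambda>\<xi>. fourier (u (s n)) \<xi> - fourier v \<xi>)) \<longlonglongrightarrow> 0"
  proof -
    have "l2 lebesgue (\<lambda>\<xi>. fourier (u (s n)) \<xi> - fourier v \<xi>) = l2 lebesgue (\<lambda>x. u (s n) x - v x)" for n
    proof -
      note d = sq_int_diff[OF us vs, of "s n"]
      have "l2 lebesgue (\<lambda>\<xi>. fourier (u (s n)) \<xi> - fourier v \<xi>) = l2 lebesgue (fourier (\<lambda>x. u (s n) x - v x))"
      proof (rule l2_cong_AE)
        show "AE \<xi> in lebesgue. norm (fourier (u (s n)) \<xi> - fourier v \<xi>) = norm (fourier (\<lambda>x. u (s n) x - v x) \<xi>)"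
          using fourier_linear[OF us[of "s n"] vs, of 1 "-1"] by eventually_elim simp
        show "(\<lambda>\<xi>. fourier (u (s n)) \<xi> - fourier v \<xi>) \<in> borel_measurable lebesgue"
          using sq_int_diff[OF fourier_props(1)[OF us[of "s n"]] fourier_props(1)[OF vs]] by (simp add: sq_int_def)
        show "fourier (\<lambda>x. u (s n) x - v x) \<in> borel_measurable lebesgue"
          using fourier_props(1)[OF d] by (simp add: sq_int_def)
      qed
      then show ?thesis by (simp add: fourier_props(3)[OF d])
    qed
    then show ?thesis using ls by simp
  qed
  then obtain t' where t': "strict_mono (t' :: nat \<Rightarrow> nat)" and tf: "AE \<xi> in lebesgue. (\<lambda>n. fourier (u (s (t' n))) \<xi>) \<longlonglongrightarrow> fourier v \<xi>"
    using l2_tendsto_AE_subseq[OF fourier_props(1)[OF us] fourier_props(1)[OF vs], of s] by blast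
  have vm: "v \<in> borel_measurable lebesgue" "fourier v \<in> borel_measurable lebesgue"
    using vs fourier_props(1)[OF vs] by (auto simp: sq_int_def)
  have K: "sq_int lebesgue (kin v) \<and> (l2 lebesgue (kin v))\<^sup>2 \<le> (fst ab)\<^sup>2"
  proof (rule l2_lower_semicontinuous)
    show "sq_int lebesgue (kin (u (s (t' n))))" for n by (rule E_D(2)[OF u])
    show "kin v \<in> borel_measurable lebesgue" by (rule kin_measurable[OF vm(2)])
    show "AE x in lebesgue. (\<lambda>n. kin (u (s (t' n))) x) \<longlonglongrightarrow> kin v x"
      using tf unfolding kin_def by eventually_elim (intro tendsto_intros)
    show "(\<lambda>n. l2 lebesgue (kin (u (s (t' n))))) \<longlonglongrightarrow> fst ab"
      using LIMSEQ_subseq_LIMSEQ[OF ka t'] by (simp add: o_def)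
  qed
  have P: "sq_int lebesgue (pot v) \<and> (l2 lebesgue (pot v))\<^sup>2 \<le> (snd ab)\<^sup>2"
  proof (rule l2_lower_semicontinuous)
    show "sq_int lebesgue (pot (u (s (t n))))" for n by (rule E_D(3)[OF u])
    show "pot v \<in> borel_measurable lebesgue" by (rule pot_measurable[OF vm(1)])
    show "AE x in lebesgue. (\<lambda>n. pot (u (s (t n))) x) \<longlonglongrightarrow> pot v x"
      using tu unfolding pot_def by eventually_elim (intro tendsto_intros)
    show "(\<lambda>n. l2 lebesgue (pot (u (s (t n))))) \<longlonglongrightarrow> snd ab"
      using LIMSEQ_subseq_LIMSEQ[OF pb t] by (simp add: o_def)
  qed
  have vE: "v \<in> E" using vs K P by (simp add: E_iff)
  have vL: "nrm v \<le> L"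
    unfolding L_def using K P nrm_power2[of v] by (intro real_le_rsqrt) simp
  \<comment> \<open>a rapidly converging subsequence is dominated\<close>
  have dE: "(\<lambda>x. u (s n) x - v x) \<in> E" for n by (intro E_diff u vE)
  have dM: "nrm (\<lambda>x. u (s n) x - v x) \<le> M + L" for n
    using nrm_triangle_diff[OF u vE, of "s n"] M[of "s n"] vL by linarith
  have "(\<lambda>n. (l2 lebesgue (\<lambda>x. u (s n) x - v x))\<^sup>2 + (LINT x|lebesgue. \<bar>u (s n) x - v x\<bar> powr p)) \<longlonglongrightarrow> 0\<^sup>2 + 0"
    by (intro tendsto_add tendsto_power ls L2_convergence_imp_Lp[OF p dE dM])
  then have "(\<lambda>n. (l2 lebesgue (\<lambda>x. u (s n) x - v x))\<^sup>2 + (LINT x|lebesgue. \<bar>u (s n) x - v x\<bar> powr p)) \<longlonglongrightarrow> 0" by simp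
  then obtain q where q: "strict_mono q" and
    qb: "\<And>n. (l2 lebesgue (\<lambda>x. u (s (q n)) x - v x))\<^sup>2 + (LINT x|lebesgue. \<bar>u (s (q n)) x - v x\<bar> powr p) \<le> (1/2) ^ n"
    using fast_subsequence by blast
  define r where "r = s \<circ> q"
  define D where "D = (\<lambda>n x. (u (r n) x - v x)\<^sup>2 + \<bar>u (r n) x - v x\<bar> powr p)"
  have ip: "integrable lebesgue (\<lambda>x. \<bar>w x\<bar> powr p)" if "w \<in> E" for w
    using subcritical_embedding[OF p] that by blast
  have i2: "integrable lebesgue (\<lambda>x. (w x)\<^sup>2)" if "w \<in> E" for w
    using E_D(1)[OF that] by (simp add: sq_int_def)
  have Di: "integrable lebesgue (D n)" for n
    unfolding D_def r_def o_def by (intro Bochner_Integration.integrable_add i2 ip dE)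
  have Db: "(LINT x|lebesgue. D n x) \<le> (1/2) ^ n" for n
    unfolding D_def r_def o_def using qb[of n] i2[OF dE[of "q n"]] ip[OF dE[of "q n"]] by (simp add: l2_power2)
  obtain S where Si: "integrable lebesgue S" and D0: "AE x in lebesgue. (\<lambda>n. D n x) \<longlonglongrightarrow> 0" and DS: "AE x in lebesgue. \<forall>n. D n x \<le> S x"
    using fast_convergence_dominated[OF Di _ Db] by (auto simp: D_def)
  show ?thesis
  proof (rule that)
    show "strict_mono r" unfolding r_def using s q by (rule strict_mono_o)
    show "v \<in> E" by fact
    show "nrm v \<le> L" by fact
    show "(\<lambda>n. nrm (u (r n))) \<longlonglongrightarrow> L" using LIMSEQ_subseq_LIMSEQ[OF Ll q] by (simp add: r_def o_def)
    show "AE x in lebesgue. (\<lambda>n. u (r n) x) \<longlonglongrightarrow> v x"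
      using D0
    proof eventually_elim
      case (elim x)
      have "(\<lambda>n. (u (r n) x - v x)\<^sup>2) \<longlonglongrightarrow> 0" by (rule tendsto_0_le[OF _ _ elim]) (auto simp: D_def)
      from tendsto_real_sqrt[OF this] have "(\<lambda>n. \<bar>u (r n) x - v x\<bar>) \<longlonglongrightarrow> 0" by simp
      then show ?case by (simp add: tendsto_rabs_zero_iff LIM_zero_iff)
    qed
    let ?k = "\<lambda>x. 2 * (v x)\<^sup>2 + 2 powr p * \<bar>v x\<bar> powr p + (2 + 2 powr p) * S x"
    show "integrable lebesgue ?k" using i2[OF vE] ip[OF vE] Si by simp
    show "AE x in lebesgue. (u (r n) x)\<^sup>2 + \<bar>u (r n) x\<bar> powr p \<le> ?k x" for n
      using DS
    proof eventually_elim
      case (elim x)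
      let ?d = "u (r n) x - v x"
      have d: "?d\<^sup>2 + \<bar>?d\<bar> powr p \<le> S x" using elim by (simp add: D_def)
      then have d2: "?d\<^sup>2 \<le> S x" "\<bar>?d\<bar> powr p \<le> S x" using zero_le_power2[of ?d] powr_ge_zero[of "\<bar>?d\<bar>" p] by linarith+
      have "(u (r n) x)\<^sup>2 \<le> 2 * (v x)\<^sup>2 + 2 * ?d\<^sup>2"
        using norm_add_power2_le[of 1 "v x" ?d] by simp
      moreover have "\<bar>u (r n) x\<bar> powr p \<le> 2 powr p * (\<bar>v x\<bar> powr p + \<bar>?d\<bar> powr p)"
        using abs_powr_add_le[of p "v x" ?d] p by simp
      moreover have "2 powr p * \<bar>?d\<bar> powr p \<le> 2 powr p * S x" using d2 by (intro mult_left_mono) auto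
      ultimately show ?case using d2(1) unfolding distrib_left distrib_right by linarith
    qed
  qed
qed

end

section \<open>Superposition operators\<close>

text \<open>Round \<open>u\<close> down to multiples of the inverse of \<open>n + 1\<close>.\<close>

lemma Caratheodory_measurable:
  fixes h :: "'a \<Rightarrow> real \<Rightarrow> real"
  assumes h: "\<And>s. (\<lambda>x. h x s) \<in> borel_measurable M" and c: "\<And>x. continuous_on UNIV (h x)"
    and u [measurable]: "u \<in> borel_measurable M"
  shows "(\<lambda>x. h x (u x)) \<in> borel_measurable M"
proof (rule borel_measurable_LIMSEQ_real)
  show "(\<lambda>x. h x (of_int \<lfloor>real (Suc n) * u x\<rfloor> / real (Suc n))) \<in> borel_measurable M" for n
  proof (rule measurable_compose_countable[where g="\<lambda>x. \<lfloor>real (Suc n) * u x\<rfloor>" and f="\<lambda>i x. h x (of_int i / real (Suc n))"])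
    show "(\<lambda>x. \<lfloor>real (Suc n) * u x\<rfloor>) \<in> M \<rightarrow>\<^sub>M count_space UNIV" by measurable
  qed (rule h)
  fix x
  have "(\<lambda>n. of_int \<lfloor>real (Suc n) * u x\<rfloor> / real (Suc n) - u x) \<longlonglongrightarrow> 0"
  proof (rule Lim_null_comparison[OF always_eventually[OF allI]])
    show "(\<lambda>n. 1 / real (Suc n)) \<longlonglongrightarrow> 0" by (rule lim_1_over_n[THEN LIMSEQ_Suc])
    fix n
    have "of_int \<lfloor>real (Suc n) * u x\<rfloor> / real (Suc n) - u x = (of_int \<lfloor>real (Suc n) * u x\<rfloor> - real (Suc n) * u x) / real (Suc n)"
      by (simp add: diff_divide_distrib)
    moreover have "\<bar>of_int \<lfloor>real (Suc n) * u x\<rfloor> - real (Suc n) * u x\<bar> \<le> 1" by linarith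
    ultimately show "norm (of_int \<lfloor>real (Suc n) * u x\<rfloor> / real (Suc n) - u x) \<le> 1 / real (Suc n)"
      by (simp add: divide_right_mono)
  qed
  then have "(\<lambda>n. of_int \<lfloor>real (Suc n) * u x\<rfloor> / real (Suc n)) \<longlonglongrightarrow> u x" by (simp only: LIM_zero_iff)
  moreover have "isCont (h x) (u x)" using c by (simp add: continuous_on_eq_continuous_at)
  ultimately show "(\<lambda>n. h x (of_int \<lfloor>real (Suc n) * u x\<rfloor> / real (Suc n))) \<longlonglongrightarrow> h x (u x)"
    by (rule isCont_tendsto_compose[rotated])
qed

text \<open>A function that is measurable for the completed product measure need not have measurable sections, but
  almost every section is measurable. A set of full measure is dense, so continuity in \<open>s\<close> gives the
  remaining sections.\<close>

lemma section_lebesgue_measurable: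
  fixes f :: "'a::euclidean_space \<Rightarrow> real \<Rightarrow> real"
  assumes f: "(\<lambda>(x, s). f x s) \<in> borel_measurable lebesgue"
    and c: "AE x in lebesgue. continuous_on UNIV (f x)"
  shows "(\<lambda>x. f x s) \<in> borel_measurable lebesgue"
proof -
  obtain h where h: "h \<in> borel_measurable lborel" and fh: "AE z in lborel. (case z of (x, s) \<Rightarrow> f x s) = h z"
    using completion_ex_borel_measurable_real[OF f] by blast
  obtain N where N: "N \<in> null_sets lborel" "\<And>z. z \<notin> N \<Longrightarrow> (case z of (x, s) \<Rightarrow> f x s) = h z"
    using fh by (auto elim!: AE_E3)
  have hp [measurable]: "h \<in> borel_measurable (lborel \<Otimes>\<^sub>M lborel)" using h by (simp add: lborel_prod)
  have Np [measurable]: "N \<in> sets (lborel \<Otimes>\<^sub>M lborel)" using null_setsD2[OF N(1)] by (simp only: lborel_prod)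
  have "AE z in lborel \<Otimes>\<^sub>M lborel. z \<notin> N" using AE_not_in[OF N(1)] by (simp only: lborel_prod)
  from lborel_pair.AE_pair[OF this] have "AE x in lborel. AE s in lborel. (x, s) \<notin> N" .
  moreover have "{z \<in> space (lborel \<Otimes>\<^sub>M lborel). (fst z, snd z) \<notin> N} \<in> sets (lborel \<Otimes>\<^sub>M lborel)"
    unfolding prod.collapse using sets.compl_sets[OF Np] by (simp only: set_diff_eq)
  ultimately have "AE s in lborel. AE x in lborel. (x, s) \<notin> N"
    by (simp only: lborel_pair.AE_commute)
  then have ms: "AE s in lborel. (\<lambda>x. f x s) \<in> borel_measurable lebesgue"
  proof eventually_elim
    case (elim s)
    have "(\<lambda>x. h (x, s)) \<in> borel_measurable lborel" by measurable
    then have "(\<lambda>x. h (x, s)) \<in> borel_measurable lebesgue" by (rule measurable_completion)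
    moreover have "AE x in lebesgue. h (x, s) = f x s"
      using AE_completion[OF elim] by eventually_elim (use N(2) in fastforce)
    ultimately show ?case by (rule borel_measurable_AE)
  qed
  have "\<exists>t. s < t \<and> t < s + 1 / real (Suc n) \<and> (\<lambda>x. f x t) \<in> borel_measurable lebesgue" for n
  proof (rule ccontr)
    assume *: "\<not> ?thesis"
    have "AE t in lborel. t \<notin> {s<..<s + 1 / real (Suc n)}"
      using ms by eventually_elim (use * in auto)
    then have "{s<..<s + 1 / real (Suc n)} \<in> null_sets lborel" by (subst AE_iff_null_sets) auto
    then have "emeasure lborel {s<..<s + 1 / real (Suc n)} = 0" by auto
    then show False by simp
  qed
  then obtain t where t: "\<And>n. s < t n" "\<And>n. t n < s + 1 / real (Suc n)" "\<And>n. (\<lambda>x. f x (t n)) \<in> borel_measurable lebesgue"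
    by metis
  have tl: "t \<longlonglongrightarrow> s"
  proof (rule tendsto_sandwich[OF always_eventually always_eventually tendsto_const])
    show "\<forall>n. s \<le> t n" "\<forall>n. t n \<le> s + 1 / real (Suc n)" using t by (auto intro: less_imp_le)
    have "(\<lambda>n. s + 1 / real (Suc n)) \<longlonglongrightarrow> s + 0" by (intro tendsto_intros lim_1_over_n[THEN LIMSEQ_Suc])
    then show "(\<lambda>n. s + 1 / real (Suc n)) \<longlonglongrightarrow> s" by simp
  qed
  have "(\<lambda>x. lim (\<lambda>n. f x (t n))) \<in> borel_measurable lebesgue" using t(3) by measurable
  moreover have "AE x in lebesgue. lim (\<lambda>n. f x (t n)) = f x s"
    using c
  proof eventually_elim
    case (elim x)
    then have "isCont (f x) s" by (simp add: continuous_on_eq_continuous_at)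
    from isCont_tendsto_compose[OF this tl] show ?case by (rule limI)
  qed
  ultimately show ?thesis by (rule borel_measurable_AE)
qed

text \<open>At \<open>0\<close> the difference quotient is \<open>\<bar>s\<bar> powr (q - 2) * s\<close> itself, evaluated at the increment, and tends to \<open>0\<close>.\<close>

lemma abs_powr_has_derivative:
  fixes q :: real assumes q: "2 < q"
  shows "((\<lambda>s. \<bar>s\<bar> powr q) has_real_derivative q * (\<bar>s\<bar> powr (q - 2) * s)) (at s)"
proof -
  have cont: "continuous_on UNIV (\<lambda>s::real. \<bar>s\<bar> powr (q - 2) * s)"
    using q by (intro continuous_intros continuous_on_powr') auto
  consider "s > 0" | "s < 0" | "s = 0" by linarith
  then show ?thesis
  proof cases
    case 1
    have "((\<lambda>s. s powr q) has_real_derivative q * s powr (q - 1)) (at s)"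
      using 1 by (rule has_real_derivative_powr)
    moreover have "eventually (\<lambda>t. \<bar>t\<bar> powr q = t powr q) (nhds s)"
      using 1 eventually_nhds_in_open[of "{0<..}" s] by (auto elim!: eventually_mono)
    ultimately have "((\<lambda>s. \<bar>s\<bar> powr q) has_real_derivative q * s powr (q - 1)) (at s)"
      by (subst DERIV_cong_ev[OF refl _ refl])
    moreover have "s powr (q - 1) = s powr (q - 2) * s" using 1 powr_mult_base[of s "q - 2"] by (simp add: mult.commute)
    ultimately show ?thesis using 1 by simp
  next
    case 2
    have "((\<lambda>s. (- s) powr q) has_real_derivative (q * (- s) powr (q - 1)) * (- 1)) (at s)"
      using 2 by (intro DERIV_chain2[where f="\<lambda>s. s powr q" and g=uminus] has_real_derivative_powr) (auto intro!: derivative_eq_intros)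
    moreover have "eventually (\<lambda>t. \<bar>t\<bar> powr q = (- t) powr q) (nhds s)"
      using 2 eventually_nhds_in_open[of "{..<0}" s] by (auto elim!: eventually_mono)
    ultimately have "((\<lambda>s. \<bar>s\<bar> powr q) has_real_derivative (q * (- s) powr (q - 1)) * (- 1)) (at s)"
      by (subst DERIV_cong_ev[OF refl _ refl])
    moreover have "(- s) powr (q - 1) = (- s) powr (q - 2) * (- s)" using 2 powr_mult_base[of "- s" "q - 2"] by (simp add: mult.commute)
    ultimately show ?thesis using 2 by (simp add: algebra_simps)
  next
    case 3
    have "((\<lambda>h::real. \<bar>h\<bar> powr (q - 2) * h) \<longlongrightarrow> \<bar>0\<bar> powr (q - 2) * 0) (at 0)"
      using cont[unfolded continuous_on_def, rule_format, of 0] by (simp only: UNIV_I)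
    moreover have "\<bar>h\<bar> powr (q - 2) * h = (\<bar>0 + h\<bar> powr q - \<bar>0\<bar> powr q) / h" if "h \<noteq> 0" for h :: real
      using that powr_split2[of h q] by (simp add: power2_eq_square)
    ultimately have "((\<lambda>h. (\<bar>0 + h\<bar> powr q - \<bar>0\<bar> powr q) / h) \<longlongrightarrow> 0) (at (0::real))"
      by (subst tendsto_cong[where g="\<lambda>h. \<bar>h\<bar> powr (q - 2) * h"]) (auto simp: eventually_at_filter)
    then show ?thesis using 3 by (simp add: DERIV_def)
  qed
qed

lemma primitive_has_derivative:
  assumes c: "continuous_on UNIV (f x)"
  shows "(primitive f x has_real_derivative f x s) (at s)" "primitive f x 0 = 0"
proof -
  let ?a = "- (\<bar>s\<bar> + 1)" and ?b = "\<bar>s\<bar> + 1"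
  have "((\<lambda>u. LBINT y=ereal 0..ereal u. f x y) has_vector_derivative f x s) (at s within {?a..?b})"
    by (rule interval_integral_FTC2) (auto intro: continuous_on_subset[OF c])
  then have "(primitive f x has_vector_derivative f x s) (at s within {?a..?b})"
    unfolding primitive_def .
  moreover have "at s within {?a..?b} = at s" by (rule at_within_interior) auto
  ultimately show "(primitive f x has_real_derivative f x s) (at s)"
    by (simp add: has_real_derivative_iff_has_vector_derivative)
  show "primitive f x 0 = 0" by (simp add: primitive_def)
qed

section \<open>The nonlinearity\<close>

text \<open>The exponent and the constant of the growth condition are fixed as parameters.\<close>

locale nehari_problem = confining_potential \<alpha> V for \<alpha> and V :: "real ^ 'n::finite \<Rightarrow> real" +
  fixes q p c0 :: real and \<Gamma> :: "real ^ 'n \<Rightarrow> real" and f :: "real ^ 'n \<Rightarrow> real \<Rightarrow> real"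
  assumes \<Gamma>: "cond_Gamma \<Gamma>" and F2: "cond_F2 f" and F3: "cond_F3 q f" and F4: "cond_F4 q f"
    and f_measurable: "(\<lambda>(x, u). f x u) \<in> borel_measurable lebesgue"
    and f_continuous: "AE x in lebesgue. continuous_on UNIV (f x)"
    and exponents: "2 < q" "q < p" "p < 2 * real CARD('n) / (real CARD('n) - \<alpha>)"
    and c0: "0 < c0" and growth: "\<And>x u. \<bar>f x u\<bar> \<le> c0 * (1 + \<bar>u\<bar> powr (p - 1))"
begin

definition C\<Gamma> :: real where "C\<Gamma> = \<bar>SOME C. AE x in lebesgue. \<bar>\<Gamma> x\<bar> \<le> C\<bar>"

definition good :: "(real ^ 'n) set" where
  "good = {x. continuous_on UNIV (f x) \<and> 0 \<le> \<Gamma> x \<and> \<Gamma> x \<le> C\<Gamma>}"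

lemma C\<Gamma>_nonneg: "0 \<le> C\<Gamma>" by (simp add: C\<Gamma>_def)

lemma AE_good: "AE x in lebesgue. x \<in> good"
proof -
  have "AE x in lebesgue. \<bar>\<Gamma> x\<bar> \<le> (SOME C. AE x in lebesgue. \<bar>\<Gamma> x\<bar> \<le> C)"
    using \<Gamma> unfolding cond_Gamma_def by (intro someI_ex[where P="\<lambda>C. AE x in lebesgue. \<bar>\<Gamma> x\<bar> \<le> C"]) blast
  moreover have "AE x in lebesgue. 0 \<le> \<Gamma> x" using \<Gamma> by (simp add: cond_Gamma_def)
  ultimately show ?thesis using f_continuous
    by eventually_elim (auto simp: good_def C\<Gamma>_def)
qed

lemma good_measurable [measurable]: "good \<in> sets lebesgue"
proof -
  have "- good \<in> null_sets lebesgue"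
    using AE_good by (simp add: completion.AE_iff_null_sets Compl_eq)
  then have "- good \<in> sets lebesgue" by auto
  then show ?thesis using Compl_in_sets_lebesgue by blast
qed

lemma \<Gamma>_measurable [measurable]: "\<Gamma> \<in> borel_measurable lebesgue"
  using \<Gamma> by (simp add: cond_Gamma_def)

text \<open>The whole nonlinearity and its primitive, set to zero on the null set where the
  hypotheses fail, so that the pointwise facts below hold everywhere.\<close>

definition g :: "real ^ 'n \<Rightarrow> real \<Rightarrow> real" where
  "g x s = (if x \<in> good then f x s - \<Gamma> x * (\<bar>s\<bar> powr (q - 2) * s) else 0)"

definition G :: "real ^ 'n \<Rightarrow> real \<Rightarrow> real" where
  "G x s = (if x \<in> good then primitive f x s - (1 / q) * \<Gamma> x * \<bar>s\<bar> powr q else 0)"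

lemma g_continuous: "continuous_on UNIV (g x)"
proof (cases "x \<in> good")
  case True
  then have "continuous_on UNIV (\<lambda>s. f x s - \<Gamma> x * (\<bar>s\<bar> powr (q - 2) * s))"
    using exponents by (intro continuous_intros continuous_on_powr') (auto simp: good_def)
  then show ?thesis using True by (simp add: g_def[abs_def])
qed (simp add: g_def[abs_def])

lemma G_has_derivative: "(G x has_real_derivative g x s) (at s)"
proof (cases "x \<in> good")
  case True
  have "((\<lambda>s. primitive f x s - (1 / q) * \<Gamma> x * \<bar>s\<bar> powr q) has_real_derivative f x s - (1 / q) * \<Gamma> x * (q * (\<bar>s\<bar> powr (q - 2) * s))) (at s)"
    using True exponents
    by (intro DERIV_diff DERIV_cmult primitive_has_derivative abs_powr_has_derivative) (auto simp: good_def)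
  then show ?thesis using True exponents by (simp add: G_def[abs_def] g_def)
qed (simp add: G_def[abs_def] g_def)

lemma G_0: "G x 0 = 0"
  using primitive_has_derivative(2)[of f x] by (simp add: G_def good_def)

lemma g_section_measurable: "(\<lambda>x. g x s) \<in> borel_measurable lebesgue"
  unfolding g_def using section_lebesgue_measurable[OF f_measurable f_continuous, of s] by measurable

lemma g_superposition_measurable:
  "u \<in> borel_measurable lebesgue \<Longrightarrow> (\<lambda>x. g x (u x)) \<in> borel_measurable lebesgue"
  by (rule Caratheodory_measurable[OF g_section_measurable g_continuous])

text \<open>By the fundamental theorem of calculus \<open>G x (u x)\<close> is an integral over \<open>t\<close> of values of \<open>g\<close>, so the
  measurability of \<open>g\<close> in both variables suffices.\<close>

lemma G_superposition_measurable:
  assumes u [measurable]: "u \<in> borel_measurable lebesgue"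
  shows "(\<lambda>x. G x (u x)) \<in> borel_measurable lebesgue"
proof -
  have "(\<lambda>z. g (fst z) (snd z * u (fst z))) \<in> borel_measurable (lebesgue \<Otimes>\<^sub>M (lborel :: real measure))"
  proof (rule Caratheodory_measurable[where h="\<lambda>z. g (fst z)"])
    show "(\<lambda>z. g (fst z) s) \<in> borel_measurable (lebesgue \<Otimes>\<^sub>M (lborel :: real measure))" for s
      by (rule measurable_compose[OF measurable_fst g_section_measurable])
  qed (rule g_continuous, measurable)
  then have m: "(\<lambda>(x, t). u x * (g x (t * u x) * indicator {0..1} t)) \<in> borel_measurable (lebesgue \<Otimes>\<^sub>M (lborel :: real measure))"
    unfolding case_prod_beta by measurable
  have "(\<lambda>x. LINT t|lborel. u x * (g x (t * u x) * indicator {0..1} t)) \<in> borel_measurable lebesgue"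
    by (rule lborel.borel_measurable_lebesgue_integral[OF m])
  moreover have "(LINT t|lborel. u x * (g x (t * u x) * indicator {0..1} t)) = G x (u x)" for x
  proof -
    have d: "((\<lambda>t. G x (t * u x)) has_real_derivative g x (t * u x) * u x) (at t)" for t
      by (rule DERIV_chain2[OF G_has_derivative]) (auto intro!: derivative_eq_intros)
    have c: "isCont (\<lambda>t. g x (t * u x) * u x) t" for t
    proof -
      have "continuous_on UNIV (\<lambda>t. g x (t * u x))"
        by (rule continuous_on_compose2[OF g_continuous]) (auto intro!: continuous_intros)
      then have "continuous_on UNIV (\<lambda>t. g x (t * u x) * u x)" by (intro continuous_on_mult continuous_on_const)
      then show ?thesis by (simp add: continuous_on_eq_continuous_at)
    qed
    have "(LINT t|lborel. (g x (t * u x) * u x) * indicator {0..1} t) = G x (1 * u x) - G x (0 * u x)"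
      by (rule integral_FTC_Icc_real) (use d c in auto)
    then show ?thesis by (simp add: G_0 mult_ac)
  qed
  ultimately show ?thesis by simp
qed

lemma energy_eq: "energy \<alpha> V f \<Gamma> q u = (1 / 2) * (nrm u)\<^sup>2 - (LINT x|lebesgue. G x (u x))"
  if u: "u \<in> borel_measurable lebesgue"
proof -
  have ae: "AE x in lebesgue. G x (u x) = primitive f x (u x) - (1 / q) * \<Gamma> x * \<bar>u x\<bar> powr q"
    using AE_good by eventually_elim (simp add: G_def)
  have m: "(\<lambda>x. primitive f x (u x) - (1 / q) * \<Gamma> x * \<bar>u x\<bar> powr q) \<in> borel_measurable lebesgue"
    by (rule borel_measurable_AE[OF G_superposition_measurable[OF u] ae])
  show ?thesis
    unfolding energy_def using integral_cong_AE[OF G_superposition_measurable[OF u] m ae] by simp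
qed

text \<open>The limit at \<open>0\<close> says nothing about the value at \<open>0\<close>, which vanishes by continuity.\<close>

lemma f_small: assumes "\<epsilon> > 0" obtains \<delta> where "\<delta> > 0" "\<And>x s. x \<in> good \<Longrightarrow> \<bar>s\<bar> < \<delta> \<Longrightarrow> \<bar>f x s\<bar> \<le> \<epsilon> * \<bar>s\<bar>"
proof -
  have "\<forall>\<^sub>F u in at 0. \<forall>x\<in>UNIV. dist (f x u / \<bar>u\<bar>) 0 < \<epsilon>"
    using F2 assms unfolding cond_F2_def uniform_limit_iff by blast
  then obtain \<delta> where \<delta>: "\<delta> > 0" and d: "\<And>u x. u \<noteq> 0 \<Longrightarrow> \<bar>u\<bar> < \<delta> \<Longrightarrow> \<bar>f x u\<bar> / \<bar>u\<bar> < \<epsilon>"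
    by (auto simp: eventually_at)
  have le: "\<bar>f x s\<bar> \<le> \<epsilon> * \<bar>s\<bar>" if "\<bar>s\<bar> < \<delta>" "s \<noteq> 0" for x s
    using d[of s x] that by (simp add: pos_divide_less_eq less_imp_le)
  have z: "f x 0 = 0" if "x \<in> good" for x
  proof -
    have "continuous_on UNIV (f x)" using that by (simp add: good_def)
    then have l: "((f x) \<longlongrightarrow> f x 0) (at 0)" by (simp add: continuous_on_def)
    have "((\<lambda>s. \<epsilon> * \<bar>s\<bar>) \<longlongrightarrow> \<epsilon> * \<bar>0\<bar>) (at 0)" by (intro tendsto_intros)
    then have l0: "((\<lambda>s. \<epsilon> * \<bar>s\<bar>) \<longlongrightarrow> 0) (at 0)" by simp
    have "eventually (\<lambda>s. norm (f x s) \<le> \<epsilon> * \<bar>s\<bar>) (at 0)"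
      unfolding eventually_at using \<delta> le by (intro exI[of _ \<delta>]) auto
    from Lim_null_comparison[OF this l0] have "((f x) \<longlongrightarrow> 0) (at 0)" .
    then show ?thesis using tendsto_unique[OF _ l] by force
  qed
  show ?thesis
    by (rule that[OF \<delta>]) (use le z in force)
qed

text \<open>Near \<open>0\<close> both terms are of higher than linear order, since \<open>q > 2\<close>; away from \<open>0\<close> every constant is absorbed
  by the power \<open>p - 1\<close>.\<close>

lemma g_bound_eps:
  assumes \<epsilon>: "\<epsilon> > 0" obtains C where "C \<ge> 0" "\<And>x s. \<bar>g x s\<bar> \<le> \<epsilon> * \<bar>s\<bar> + C * \<bar>s\<bar> powr (p - 1)"
proof -
  obtain \<delta>1 where \<delta>1: "\<delta>1 > 0" and f1: "\<And>x s. x \<in> good \<Longrightarrow> \<bar>s\<bar> < \<delta>1 \<Longrightarrow> \<bar>f x s\<bar> \<le> (\<epsilon> / 2) * \<bar>s\<bar>"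
    using f_small[of "\<epsilon> / 2"] \<epsilon> by auto
  have "((\<lambda>s::real. C\<Gamma> * \<bar>s\<bar> powr (q - 2)) \<longlongrightarrow> C\<Gamma> * \<bar>0\<bar> powr (q - 2)) (at_right 0)"
    using exponents by (intro tendsto_intros tendsto_powr') auto
  then have "eventually (\<lambda>s. C\<Gamma> * \<bar>s\<bar> powr (q - 2) < \<epsilon> / 2) (at_right (0::real))"
    by (rule order_tendstoD) (use \<epsilon> in simp)
  then obtain \<delta>2 where \<delta>2: "\<delta>2 > 0" "\<And>s. 0 < s \<Longrightarrow> s < \<delta>2 \<Longrightarrow> C\<Gamma> * \<bar>s\<bar> powr (q - 2) < \<epsilon> / 2"
    by (auto simp: eventually_at_right_field)
  define \<delta> where "\<delta> = min \<delta>1 \<delta>2"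
  have \<delta>: "\<delta> > 0" using \<delta>1 \<delta>2 by (simp add: \<delta>_def)
  \<comment> \<open>\<open>\<delta> powr (1 - p)\<close> converts the constant in the growth condition into a multiple of \<open>\<bar>s\<bar> powr (p - 1)\<close>\<close>
  define C where "C = (c0 + C\<Gamma>) * (\<delta> powr (1 - p) + 1) + (c0 + C\<Gamma>)"
  have C0: "C \<ge> 0" using c0 C\<Gamma>_nonneg by (auto simp: C_def intro!: add_nonneg_nonneg mult_nonneg_nonneg)
  have "\<bar>g x s\<bar> \<le> \<epsilon> * \<bar>s\<bar> + C * \<bar>s\<bar> powr (p - 1)" for x s
  proof (cases "x \<in> good")
    case False then show ?thesis using \<epsilon> C0 by (simp add: g_def)
  next
    case True
    then have \<Gamma>x: "0 \<le> \<Gamma> x" "\<Gamma> x \<le> C\<Gamma>" by (auto simp: good_def)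
    have tri: "\<bar>g x s\<bar> \<le> \<bar>f x s\<bar> + C\<Gamma> * (\<bar>s\<bar> powr (q - 2) * \<bar>s\<bar>)"
    proof -
      have "\<bar>g x s\<bar> \<le> \<bar>f x s\<bar> + \<Gamma> x * (\<bar>s\<bar> powr (q - 2) * \<bar>s\<bar>)"
        using True \<Gamma>x abs_triangle_ineq4[of "f x s" "\<Gamma> x * (\<bar>s\<bar> powr (q - 2) * s)"] by (simp add: g_def abs_mult)
      also have "\<Gamma> x * (\<bar>s\<bar> powr (q - 2) * \<bar>s\<bar>) \<le> C\<Gamma> * (\<bar>s\<bar> powr (q - 2) * \<bar>s\<bar>)"
        using \<Gamma>x by (intro mult_right_mono) auto
      finally show ?thesis by simp
    qed
    show ?thesis
    proof (cases "\<bar>s\<bar> < \<delta>")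
      case small: True
      show ?thesis
      proof (cases "s = 0")
        case True then show ?thesis using f1[OF \<open>x \<in> good\<close>, of 0] \<delta>1 tri by simp
      next
        case False
        have "\<bar>f x s\<bar> \<le> (\<epsilon> / 2) * \<bar>s\<bar>" using f1 True small by (simp add: \<delta>_def)
        moreover have "(C\<Gamma> * \<bar>s\<bar> powr (q - 2)) * \<bar>s\<bar> \<le> (\<epsilon> / 2) * \<bar>s\<bar>"
          using \<delta>2(2)[of "\<bar>s\<bar>"] False small by (intro mult_right_mono) (auto simp: \<delta>_def)
        ultimately have "\<bar>g x s\<bar> \<le> \<epsilon> * \<bar>s\<bar>" using tri by (simp add: mult.assoc)
        moreover have "0 \<le> C * \<bar>s\<bar> powr (p - 1)" using C0 by simp
        ultimately show ?thesis by linarith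
      qed
    next
      case big: False
      let ?m = "\<bar>s\<bar> powr (p - 1)"
      have s0: "s \<noteq> 0" using big \<delta> by auto
      have one: "1 \<le> \<delta> powr (1 - p) * ?m"
      proof -
        have "\<delta> powr (p - 1) \<le> ?m" using big \<delta> exponents by (intro powr_mono2) auto
        then have "\<delta> powr (1 - p) * \<delta> powr (p - 1) \<le> \<delta> powr (1 - p) * ?m" by (intro mult_left_mono) auto
        moreover have "\<delta> powr (1 - p) * \<delta> powr (p - 1) = 1" using \<delta> by (simp add: powr_add[symmetric])
        ultimately show ?thesis by simp
      qed
      have qp: "\<bar>s\<bar> powr (q - 2) * \<bar>s\<bar> \<le> 1 + ?m"
      proof -
        have e: "\<bar>s\<bar> powr (q - 2) * \<bar>s\<bar> = \<bar>s\<bar> powr (q - 1)"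
          using s0 powr_mult_base[of "\<bar>s\<bar>" "q - 2"] by (simp add: mult.commute)
        show ?thesis
        proof (cases "\<bar>s\<bar> \<le> 1")
          case True then have "\<bar>s\<bar> powr (q - 1) \<le> 1 powr (q - 1)" using exponents by (intro powr_mono2) auto
          then have "\<bar>s\<bar> powr (q - 1) \<le> 1" by simp
          then show ?thesis unfolding e using powr_ge_zero[of "\<bar>s\<bar>" "p - 1"] by linarith
        next
          case False then have "\<bar>s\<bar> powr (q - 1) \<le> ?m" using exponents by (intro powr_mono) auto
          then show ?thesis unfolding e by simp
        qed
      qed
      have "\<bar>g x s\<bar> \<le> c0 * (1 + ?m) + C\<Gamma> * (1 + ?m)"
        using tri growth[of x s] mult_left_mono[OF qp C\<Gamma>_nonneg] by linarith
      also have "\<dots> = (c0 + C\<Gamma>) * 1 + (c0 + C\<Gamma>) * ?m" by (simp add: algebra_simps)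
      also have "\<dots> \<le> (c0 + C\<Gamma>) * (\<delta> powr (1 - p) * ?m) + (c0 + C\<Gamma>) * ?m"
        using one c0 C\<Gamma>_nonneg by (intro add_mono mult_left_mono) auto
      also have "\<dots> \<le> C * ?m"
        using c0 C\<Gamma>_nonneg by (simp add: C_def algebra_simps)
      finally show ?thesis using \<epsilon> by (simp add: add_increasing)
    qed
  qed
  with C0 show ?thesis by (rule that)
qed

text \<open>The monotonicity assumption says that \<open>t\<close> enters the Nehari identity monotonically once
  the factor \<open>t\<close> to the power \<open>q - 1\<close> is divided out; the term with \<open>\<Gamma>\<close> becomes constant.\<close>

lemma g_quotient_mono:
  assumes st: "0 < s" "s \<le> t"
  shows "g x (s * y) * y / s powr (q - 1) \<le> g x (t * y) * y / t powr (q - 1)"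
proof (cases "x \<in> good \<and> y \<noteq> 0")
  case False then show ?thesis by (auto simp: g_def)
next
  case True
  have t0: "0 < t" using st by linarith
  let ?h = "\<lambda>u. f x u / \<bar>u\<bar> powr (q - 1)"
  have sm: "strict_mono_on {..<0} ?h" "strict_mono_on {0<..} ?h" using F4 by (auto simp: cond_F4_def)
  have pm: "\<bar>r * y\<bar> powr (q - 1) = r powr (q - 1) * \<bar>y\<bar> powr (q - 1)" if "0 < r" for r
    using that by (simp add: abs_mult powr_mult)
  have F: "f x (r * y) * y / r powr (q - 1) = ?h (r * y) * (\<bar>y\<bar> powr (q - 1) * y)" if "0 < r" for r
    using that True by (simp add: pm)
  have Gm: "\<bar>r * y\<bar> powr (q - 2) * (r * y) * y / r powr (q - 1) = \<bar>y\<bar> powr (q - 2) * y * y" if "0 < r" for r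
  proof -
    have "r powr (q - 1) = r powr (q - 2) * r" using that powr_mult_base[of r "q - 2"] by (simp add: mult.commute)
    then show ?thesis using that by (simp add: abs_mult powr_mult)
  qed
  have "?h (s * y) * (\<bar>y\<bar> powr (q - 1) * y) \<le> ?h (t * y) * (\<bar>y\<bar> powr (q - 1) * y)"
  proof (cases "y > 0")
    case True
    have "?h (s * y) \<le> ?h (t * y)"
      using strict_mono_on_leD[OF sm(2), of "s * y" "t * y"] st t0 True by simp
    then show ?thesis using True by (intro mult_right_mono) auto
  next
    case False
    then have y: "y < 0" using True by linarith
    have "?h (t * y) \<le> ?h (s * y)"
      using strict_mono_on_leD[OF sm(1), of "t * y" "s * y"] st t0 y by (simp add: mult_pos_neg mult_right_mono_neg)
    then show ?thesis using y by (intro mult_right_mono_neg) (auto simp: mult_nonneg_nonpos)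
  qed
  then have le: "f x (s * y) * y / s powr (q - 1) \<le> f x (t * y) * y / t powr (q - 1)"
    using F[OF st(1)] F[OF t0] by simp
  have split: "g x (r * y) * y / r powr (q - 1) = f x (r * y) * y / r powr (q - 1) - \<Gamma> x * (\<bar>y\<bar> powr (q - 2) * y * y)" if "0 < r" for r
  proof -
    have "g x (r * y) * y / r powr (q - 1) = f x (r * y) * y / r powr (q - 1) - \<Gamma> x * (\<bar>r * y\<bar> powr (q - 2) * (r * y) * y / r powr (q - 1))"
      using True by (simp add: g_def left_diff_distrib right_diff_distrib diff_divide_distrib mult_ac)
    then show ?thesis by (simp only: Gm[OF that])
  qed
  show ?thesis unfolding split[OF st(1)] split[OF t0] using le by simp
qed

text \<open>Compare \<open>g x (t s)\<close> with \<open>g x s\<close> by monotonicity of the quotient and integrate over \<open>t\<close> from \<open>0\<close> to \<open>1\<close>.\<close>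

lemma Ambrosetti_Rabinowitz: "q * G x s \<le> g x s * s"
proof -
  let ?k = "\<lambda>t. t powr q * (g x s * s) - q * G x (t * s)"
  have "?k 0 \<le> ?k 1"
  proof (rule DERIV_nonneg_imp_increasing_open[where f="?k" and a=0 and b=1])
    fix t :: real assume t: "0 < t" "t < 1"
    have "(?k has_real_derivative (q * t powr (q - 1)) * (g x s * s) - q * (g x (t * s) * s)) (at t)"
      by (intro DERIV_diff DERIV_cmult DERIV_cmult_right has_real_derivative_powr t DERIV_chain2[OF G_has_derivative])
        (auto intro!: derivative_eq_intros)
    moreover have "0 \<le> (q * t powr (q - 1)) * (g x s * s) - q * (g x (t * s) * s)"
    proof -
      have "g x (t * s) * s / t powr (q - 1) \<le> g x (1 * s) * s / 1 powr (q - 1)"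
        by (rule g_quotient_mono) (use t in auto)
      then have "g x (t * s) * s \<le> t powr (q - 1) * (g x s * s)" using t by (simp add: pos_divide_le_eq mult.commute)
      then have "q * (g x (t * s) * s) \<le> q * (t powr (q - 1) * (g x s * s))" using exponents by (intro mult_left_mono) auto
      then show ?thesis by (simp add: mult.assoc)
    qed
    ultimately show "\<exists>y. (?k has_real_derivative y) (at t) \<and> 0 \<le> y" by blast
  next
    have "continuous_on UNIV (G x)" using G_has_derivative DERIV_isCont by (blast intro: continuous_at_imp_continuous_on)
    then have "continuous_on {0..1} (\<lambda>t. G x (t * s))"
      by (rule continuous_on_compose2) (auto intro!: continuous_intros)
    then show "continuous_on {0..1} ?k"
      using exponents by (intro continuous_intros continuous_on_powr') auto
  qed simp
  then show ?thesis using exponents by (simp add: G_0)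
qed

section \<open>Differentiability of the energy\<close>

lemma p_bounds: "2 \<le> p" "p < 2 * real CARD('n) / (real CARD('n) - \<alpha>)"
  using exponents by auto

text \<open>The integrand that dominates all nonlinear terms and whose integral is controlled by the energy norm.\<close>

definition m :: "real \<Rightarrow> real" where "m a = a\<^sup>2 + \<bar>a\<bar> powr p"

lemma m_nonneg: "0 \<le> m a" by (simp add: m_def)

lemma m_mono: "\<bar>a\<bar> \<le> \<bar>b\<bar> \<Longrightarrow> m a \<le> m b"
  unfolding m_def using p_bounds by (intro add_mono powr_mono2) (auto simp: abs_le_square_iff)

lemma m_add: "m (a + b) \<le> 2 powr p * (m a + m b)"
proof -
  have "2 powr 1 \<le> 2 powr p" using p_bounds by (intro powr_mono) auto
  then have "2 * (a\<^sup>2 + b\<^sup>2) \<le> 2 powr p * (a\<^sup>2 + b\<^sup>2)" by (intro mult_right_mono) auto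
  moreover have "(a + b)\<^sup>2 \<le> 2 * (a\<^sup>2 + b\<^sup>2)" using norm_add_power2_le[of 1 a b] by simp
  moreover have "\<bar>a + b\<bar> powr p \<le> 2 powr p * (\<bar>a\<bar> powr p + \<bar>b\<bar> powr p)" using p_bounds by (intro abs_powr_add_le) auto
  ultimately show ?thesis unfolding m_def distrib_left by linarith
qed

lemma g_m_bound_ex: "\<exists>K\<ge>0. \<forall>x a b. \<bar>g x a * b\<bar> \<le> K * (m a + m b)"
proof -
  obtain C where C: "C \<ge> 0" "\<And>x s. \<bar>g x s\<bar> \<le> 1 * \<bar>s\<bar> + C * \<bar>s\<bar> powr (p - 1)"
    using g_bound_eps[of 1] by auto
  have "\<bar>g x a * b\<bar> \<le> (1 + C) * (m a + m b)" for x a b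
  proof -
    have "\<bar>g x a * b\<bar> \<le> (\<bar>a\<bar> + C * \<bar>a\<bar> powr (p - 1)) * \<bar>b\<bar>"
      unfolding abs_mult using C(2)[of x a] by (intro mult_right_mono) auto
    also have "\<dots> = \<bar>a\<bar> * \<bar>b\<bar> + C * (\<bar>a\<bar> powr (p - 1) * \<bar>b\<bar>)" by (simp add: algebra_simps)
    also have "\<dots> \<le> (a\<^sup>2 + b\<^sup>2) + C * (\<bar>a\<bar> powr p + \<bar>b\<bar> powr p)"
    proof (intro add_mono mult_left_mono C(1))
      have "2 * (\<bar>a\<bar> * \<bar>b\<bar>) \<le> \<bar>a\<bar>\<^sup>2 + \<bar>b\<bar>\<^sup>2" using sum_squares_bound[of "\<bar>a\<bar>" "\<bar>b\<bar>"] by simp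
      moreover have "0 \<le> \<bar>a\<bar> * \<bar>b\<bar>" by simp
      ultimately have "\<bar>a\<bar> * \<bar>b\<bar> \<le> \<bar>a\<bar>\<^sup>2 + \<bar>b\<bar>\<^sup>2" by linarith
      then show "\<bar>a\<bar> * \<bar>b\<bar> \<le> a\<^sup>2 + b\<^sup>2" by simp
      let ?M = "max \<bar>a\<bar> \<bar>b\<bar>"
      have "\<bar>a\<bar> powr (p - 1) * \<bar>b\<bar> \<le> ?M powr (p - 1) * ?M" using p_bounds by (intro mult_mono powr_mono2) auto
      also have "\<dots> = ?M powr p"
      proof (cases "?M = 0")
        case False
        then have "0 < ?M" by (auto simp: max_def split: if_splits)
        then show ?thesis using powr_mult_base[of ?M "p - 1"] by (simp add: mult.commute)
      next
        case True
        then show ?thesis unfolding True by simp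
      qed
      also have "\<dots> \<le> \<bar>a\<bar> powr p + \<bar>b\<bar> powr p" by (auto simp: max_def)
      finally show "\<bar>a\<bar> powr (p - 1) * \<bar>b\<bar> \<le> \<bar>a\<bar> powr p + \<bar>b\<bar> powr p" .
    qed
    also have "\<dots> \<le> (1 + C) * (m a + m b)"
    proof -
      have "0 \<le> C * (a\<^sup>2 + b\<^sup>2)" using C(1) by simp
      moreover have "0 \<le> \<bar>a\<bar> powr p + \<bar>b\<bar> powr p" by simp
      ultimately show ?thesis by (simp add: m_def algebra_simps)
    qed
    finally show ?thesis .
  qed
  then show ?thesis using C(1) by (intro exI[of _ "1 + C"]) auto
qed

definition Kg :: real where "Kg = (SOME K. K \<ge> 0 \<and> (\<forall>x a b. \<bar>g x a * b\<bar> \<le> K * (m a + m b)))"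

lemma Kg: "Kg \<ge> 0" "\<bar>g x a * b\<bar> \<le> Kg * (m a + m b)"
  using someI_ex[OF g_m_bound_ex[unfolded Bex_def]] unfolding Kg_def by blast+

lemma G_mean_value: "\<exists>z. \<bar>z - a\<bar> \<le> \<bar>d\<bar> \<and> G x (a + d) - G x a = g x z * d"
proof -
  consider "d > 0" | "d < 0" | "d = 0" by linarith
  then show ?thesis
  proof cases
    case 1
    obtain z where "a < z" "z < a + d" "G x (a + d) - G x a = (a + d - a) * g x z"
      using MVT2[of a "a + d" "G x" "g x"] 1 G_has_derivative by auto
    then show ?thesis by (intro exI[of _ z]) auto
  next
    case 2
    obtain z where "a + d < z" "z < a" "G x a - G x (a + d) = (a - (a + d)) * g x z"
      using MVT2[of "a + d" a "G x" "g x"] 2 G_has_derivative by auto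
    then show ?thesis by (intro exI[of _ z]) (auto simp: algebra_simps)
  qed auto
qed

lemma G_m_bound: "\<bar>G x a\<bar> \<le> 2 * Kg * m a"
proof -
  obtain z where z: "\<bar>z - 0\<bar> \<le> \<bar>a\<bar>" "G x (0 + a) - G x 0 = g x z * a" using G_mean_value[of 0 a x] by blast
  have "\<bar>G x a\<bar> \<le> Kg * (m z + m a)" using z(2) Kg(2)[of x z a] by (simp add: G_0)
  also have "\<dots> \<le> Kg * (m a + m a)" using z(1) Kg(1) m_mono[of z a] by (intro mult_left_mono add_mono) auto
  finally show ?thesis by simp
qed

lemma m_integrable: assumes u: "u \<in> E" shows "integrable lebesgue (\<lambda>x. m (u x))"
proof -
  have "integrable lebesgue (\<lambda>x. (u x)\<^sup>2)" using E_D(1)[OF u] by (simp add: sq_int_def)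
  moreover have "integrable lebesgue (\<lambda>x. \<bar>u x\<bar> powr p)" using subcritical_embedding[OF p_bounds] u by blast
  ultimately show ?thesis by (simp add: m_def)
qed

lemma m_integral_bound: "\<exists>C\<ge>0. \<forall>u\<in>E. nrm u \<le> 1 \<longrightarrow> (LINT x|lebesgue. m (u x)) \<le> C"
proof -
  obtain C where C: "C \<ge> 0" "\<And>u. u \<in> E \<Longrightarrow> integrable lebesgue (\<lambda>x. \<bar>u x\<bar> powr p) \<and> (LINT x|lebesgue. \<bar>u x\<bar> powr p) \<le> C * nrm u powr p"
    using subcritical_embedding[OF p_bounds] by blast
  have "(LINT x|lebesgue. m (u x)) \<le> 1 / V0 + C" if u: "u \<in> E" "nrm u \<le> 1" for u
  proof -
    have i: "integrable lebesgue (\<lambda>x. (u x)\<^sup>2)" using E_D(1)[OF u(1)] by (simp add: sq_int_def)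
    have "(LINT x|lebesgue. m (u x)) = (l2 lebesgue u)\<^sup>2 + (LINT x|lebesgue. \<bar>u x\<bar> powr p)"
      using i C(2)[OF u(1)] by (simp add: m_def l2_power2)
    also have "(l2 lebesgue u)\<^sup>2 \<le> (1 / sqrt V0)\<^sup>2"
      using l2_le_nrm[OF u(1)] u(2) V0_pos by (intro power_mono order_trans[OF l2_le_nrm[OF u(1)]] divide_right_mono) auto
    also have "(1 / sqrt V0)\<^sup>2 = 1 / V0" using V0_pos by (simp add: power_divide)
    also have "(LINT x|lebesgue. \<bar>u x\<bar> powr p) \<le> C * nrm u powr p" using C(2)[OF u(1)] by simp
    also have "C * nrm u powr p \<le> C * 1 powr p"
      using u(2) p_bounds C(1) by (intro mult_left_mono powr_mono2) auto
    finally show ?thesis by simp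
  qed
  then show ?thesis using C(1) V0_pos by (intro exI[of _ "1 / V0 + C"]) auto
qed

lemma g_dominated_convergence:
  assumes [measurable]: "\<And>n. u n \<in> borel_measurable lebesgue" "\<And>n. v n \<in> borel_measurable lebesgue"
      "u' \<in> borel_measurable lebesgue" "v' \<in> borel_measurable lebesgue"
    and ul: "AE x in lebesgue. (\<lambda>n. u n x) \<longlonglongrightarrow> u' x" and vl: "AE x in lebesgue. (\<lambda>n. v n x) \<longlonglongrightarrow> v' x"
    and k: "integrable lebesgue k" and uk: "\<And>n. AE x in lebesgue. m (u n x) \<le> k x" and vk: "\<And>n. AE x in lebesgue. m (v n x) \<le> k x"
  shows "(\<lambda>n. LINT x|lebesgue. g x (u n x) * v n x) \<longlonglongrightarrow> (LINT x|lebesgue. g x (u' x) * v' x)"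
proof (rule integral_dominated_convergence[where w="\<lambda>x. Kg * (k x + k x)"])
  show "(\<lambda>x. g x (u' x) * v' x) \<in> borel_measurable lebesgue"
    by (intro borel_measurable_times g_superposition_measurable) measurable
  show "(\<lambda>x. g x (u n x) * v n x) \<in> borel_measurable lebesgue" for n
    by (intro borel_measurable_times g_superposition_measurable) measurable
  show "integrable lebesgue (\<lambda>x. Kg * (k x + k x))" using k by simp
  show "AE x in lebesgue. (\<lambda>n. g x (u n x) * v n x) \<longlonglongrightarrow> g x (u' x) * v' x"
    using ul vl
  proof eventually_elim
    case (elim x)
    have "isCont (g x) (u' x)" using g_continuous[of x] by (simp add: continuous_on_eq_continuous_at)
    from isCont_tendsto_compose[OF this elim(1)] show ?case by (intro tendsto_mult elim)
  qed
  show "AE x in lebesgue. norm (g x (u n x) * v n x) \<le> Kg * (k x + k x)" for n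
    using uk[of n] vk[of n]
  proof eventually_elim
    case (elim x)
    have "\<bar>g x (u n x) * v n x\<bar> \<le> Kg * (m (u n x) + m (v n x))" by (rule Kg(2))
    also have "\<dots> \<le> Kg * (k x + k x)" using elim Kg(1) by (intro mult_left_mono add_mono) auto
    finally show ?case by simp
  qed
qed

lemma G_dominated_convergence:
  assumes [measurable]: "\<And>n. u n \<in> borel_measurable lebesgue" "u' \<in> borel_measurable lebesgue"
    and ul: "AE x in lebesgue. (\<lambda>n. u n x) \<longlonglongrightarrow> u' x"
    and k: "integrable lebesgue k" and uk: "\<And>n. AE x in lebesgue. m (u n x) \<le> k x"
  shows "(\<lambda>n. LINT x|lebesgue. G x (u n x)) \<longlonglongrightarrow> (LINT x|lebesgue. G x (u' x))"
proof (rule integral_dominated_convergence[where w="\<lambda>x. 2 * Kg * k x"])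
  show "(\<lambda>x. G x (u' x)) \<in> borel_measurable lebesgue"
    by (intro G_superposition_measurable) measurable
  show "(\<lambda>x. G x (u n x)) \<in> borel_measurable lebesgue" for n
    by (intro G_superposition_measurable) measurable
  show "integrable lebesgue (\<lambda>x. 2 * Kg * k x)" using k by simp
  show "AE x in lebesgue. (\<lambda>n. G x (u n x)) \<longlonglongrightarrow> G x (u' x)"
    using ul
  proof eventually_elim
    case (elim x)
    from isCont_tendsto_compose[OF DERIV_isCont[OF G_has_derivative] elim] show ?case .
  qed
  show "AE x in lebesgue. norm (G x (u n x)) \<le> 2 * Kg * k x" for n
    using uk[of n]
  proof eventually_elim
    case (elim x)
    have "\<bar>G x (u n x)\<bar> \<le> 2 * Kg * m (u n x)" by (rule G_m_bound)
    also have "\<dots> \<le> 2 * Kg * k x" using elim Kg(1) by (intro mult_left_mono) auto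
    finally show ?case by simp
  qed
qed

definition \<Psi> :: "(real ^ 'n \<Rightarrow> real) \<Rightarrow> real" where "\<Psi> u = (LINT x|lebesgue. G x (u x))"

definition N :: "(real ^ 'n \<Rightarrow> real) \<Rightarrow> (real ^ 'n \<Rightarrow> real) \<Rightarrow> real" where
  "N u v = (LINT x|lebesgue. g x (u x) * v x)"

lemma g_integrable:
  assumes u: "u \<in> E" and v: "v \<in> E" shows "integrable lebesgue (\<lambda>x. g x (u x) * v x)"
proof (rule Bochner_Integration.integrable_bound)
  show "integrable lebesgue (\<lambda>x. Kg * (m (u x) + m (v x)))" using m_integrable[OF u] m_integrable[OF v] by simp
  show "(\<lambda>x. g x (u x) * v x) \<in> borel_measurable lebesgue"
    by (intro borel_measurable_times g_superposition_measurable E_D u v)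
  show "AE x in lebesgue. norm (g x (u x) * v x) \<le> norm (Kg * (m (u x) + m (v x)))"
    using Kg by (intro always_eventually allI) (metis abs_ge_self order_trans real_norm_def)
qed

lemma G_integrable:
  assumes u: "u \<in> E" shows "integrable lebesgue (\<lambda>x. G x (u x))"
proof (rule Bochner_Integration.integrable_bound)
  show "integrable lebesgue (\<lambda>x. 2 * Kg * m (u x))" using m_integrable[OF u] by simp
  show "(\<lambda>x. G x (u x)) \<in> borel_measurable lebesgue"
    by (intro G_superposition_measurable E_D u)
  show "AE x in lebesgue. norm (G x (u x)) \<le> norm (2 * Kg * m (u x))"
    using G_m_bound by (intro always_eventually allI) (metis abs_ge_self order_trans real_norm_def)
qed

lemma N_linear:
  assumes "u \<in> E" "v \<in> E" "w \<in> E"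
  shows "N u (\<lambda>x. a * v x + b * w x) = a * N u v + b * N u w"
proof -
  have "N u (\<lambda>x. a * v x + b * w x) = (LINT x|lebesgue. a * (g x (u x) * v x) + b * (g x (u x) * w x))"
    unfolding N_def by (simp add: algebra_simps)
  then show ?thesis unfolding N_def using g_integrable[OF assms(1,2)] g_integrable[OF assms(1,3)] by simp
qed

lemma N_AE_0:
  assumes u: "u \<in> E" and v: "v \<in> E" and ae: "AE x in lebesgue. v x = 0"
  shows "N u v = 0" "\<Psi> (\<lambda>x. u x + v x) = \<Psi> u"
proof -
  have "N u v = (LINT x|(lebesgue :: (real ^ 'n) measure). 0)"
    unfolding N_def by (rule integral_cong_AE) (use g_integrable[OF u v] ae in auto)
  then show "N u v = 0" by simp
  show "\<Psi> (\<lambda>x. u x + v x) = \<Psi> u"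
    unfolding \<Psi>_def
    by (rule integral_cong_AE) (use G_integrable[OF u] G_integrable[OF E_add[OF u v]] ae in auto)
qed

lemma normalise:
  assumes v: "v \<in> E" and pos: "nrm v \<noteq> 0"
  shows "(\<lambda>x. (1 / nrm v) * v x) \<in> E" "nrm (\<lambda>x. (1 / nrm v) * v x) = 1"
  using E_scale[OF v, of "1 / nrm v"] nrm_scale[OF v, of "1 / nrm v"] pos by auto

lemma N_bound: assumes u: "u \<in> E" shows "\<exists>C. \<forall>v\<in>E. \<bar>N u v\<bar> \<le> C * nrm v"
proof -
  obtain C where C: "C \<ge> 0" "\<And>u. u \<in> E \<Longrightarrow> nrm u \<le> 1 \<Longrightarrow> (LINT x|lebesgue. m (u x)) \<le> C"
    using m_integral_bound by blast
  let ?C = "Kg * ((LINT x|lebesgue. m (u x)) + C)"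
  have one: "\<bar>N u v\<bar> \<le> ?C" if v: "v \<in> E" "nrm v = 1" for v
  proof -
    have "\<bar>N u v\<bar> \<le> (LINT x|lebesgue. \<bar>g x (u x) * v x\<bar>)" unfolding N_def by (rule integral_abs_bound)
    also have "\<dots> \<le> (LINT x|lebesgue. Kg * (m (u x) + m (v x)))"
      using g_integrable[OF u v(1)] m_integrable[OF u] m_integrable[OF v(1)] Kg(2) by (intro integral_mono) auto
    also have "\<dots> = Kg * ((LINT x|lebesgue. m (u x)) + (LINT x|lebesgue. m (v x)))"
      using m_integrable[OF u] m_integrable[OF v(1)] by simp
    also have "\<dots> \<le> ?C" using Kg(1) C(2)[OF v(1)] v(2) by (intro mult_left_mono) auto
    finally show ?thesis .
  qed
  have "\<bar>N u v\<bar> \<le> ?C * nrm v" if v: "v \<in> E" for v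
  proof (cases "nrm v = 0")
    case True then show ?thesis using N_AE_0(1)[OF u v nrm_eq_0_imp[OF v]] by simp
  next
    case False
    let ?w = "\<lambda>x. (1 / nrm v) * v x"
    have "N u v = nrm v * N u ?w"
      using N_linear[OF u v v, of "1 / nrm v" 0] False by simp
    then have "\<bar>N u v\<bar> = nrm v * \<bar>N u ?w\<bar>" by (simp add: abs_mult)
    also have "\<dots> \<le> nrm v * ?C" using one[OF normalise[OF v False]] by (intro mult_left_mono) auto
    finally show ?thesis by (simp add: mult.commute)
  qed
  then show ?thesis by blast
qed

text \<open>If the remainder were not small, normalised increments along which it is large would,
  by the compact embedding, converge and be dominated; but then the mean value theorem and
  dominated convergence make the remainder small.\<close>

lemma \<Psi>_Frechet:
  assumes u: "u \<in> E" and \<epsilon>: "\<epsilon> > 0"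
  shows "\<exists>\<delta>>0. \<forall>v\<in>E. nrm v < \<delta> \<longrightarrow> \<bar>\<Psi> (\<lambda>x. u x + v x) - \<Psi> u - N u v\<bar> \<le> \<epsilon> * nrm v"
proof (rule ccontr)
  assume neg: "\<not> ?thesis"
  have "\<exists>v. v \<in> E \<and> nrm v < 1 / real (Suc n) \<and> \<epsilon> * nrm v < \<bar>\<Psi> (\<lambda>x. u x + v x) - \<Psi> u - N u v\<bar>" for n
  proof -
    have "0 < 1 / real (Suc n)" by simp
    with neg show ?thesis by (meson not_le)
  qed
  then obtain v where v: "\<And>n. v n \<in> E" "\<And>n. nrm (v n) < 1 / real (Suc n)"
    "\<And>n. \<epsilon> * nrm (v n) < \<bar>\<Psi> (\<lambda>x. u x + v n x) - \<Psi> u - N u (v n)\<bar>" by metis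
  have nz: "nrm (v n) \<noteq> 0" for n
  proof
    assume 0: "nrm (v n) = 0"
    have "AE x in lebesgue. v n x = 0" by (rule nrm_eq_0_imp[OF v(1) 0])
    from N_AE_0[OF u v(1) this] v(3)[of n] 0 show False by simp
  qed
  have pos: "0 < nrm (v n)" for n using nz[of n] nrm_nonneg[of "v n"] by linarith
  define w where "w = (\<lambda>n x. (1 / nrm (v n)) * v n x)"
  have wE: "w n \<in> E" and w1: "nrm (w n) = 1" for n unfolding w_def using normalise[OF v(1) nz] by auto
  obtain r w' L k where r: "strict_mono (r :: nat \<Rightarrow> nat)" and w': "w' \<in> E" and wl: "AE x in lebesgue. (\<lambda>n. w (r n) x) \<longlonglongrightarrow> w' x"
    and k: "integrable lebesgue k" and wk: "\<And>n. AE x in lebesgue. (w (r n) x)\<^sup>2 + \<bar>w (r n) x\<bar> powr p \<le> k x"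
    and "(\<lambda>n. nrm (w (r n))) \<longlonglongrightarrow> L" "nrm w' \<le> L"
    by (rule bounded_sequence_compact[where u=w and M=1, OF p_bounds wE eq_refl[OF w1]]) (rule that; assumption)
  define \<tau> where "\<tau> = (\<lambda>n. nrm (v (r n)))"
  have \<tau>pos: "0 < \<tau> n" for n unfolding \<tau>_def by (rule pos)
  have vw: "v (r n) x = \<tau> n * w (r n) x" for n x using \<tau>pos[of n] by (simp add: w_def \<tau>_def)
  have \<tau>le: "\<tau> n \<le> 1 / real (Suc n)" for n
  proof -
    have "\<tau> n < 1 / real (Suc (r n))" unfolding \<tau>_def by (rule v(2))
    also have "\<dots> \<le> 1 / real (Suc n)" using seq_suble[OF r, of n] by (intro divide_left_mono) auto
    finally show ?thesis by simp
  qed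
  have \<tau>1: "\<tau> n \<le> 1" for n using \<tau>le[of n] order_trans[of "\<tau> n" "1 / real (Suc n)" 1] by simp
  have \<tau>0: "\<tau> \<longlonglongrightarrow> 0"
    by (rule tendsto_0_le[OF _ \<tau>le lim_1_over_n[THEN LIMSEQ_Suc]]) (simp add: less_imp_le[OF \<tau>pos])
  \<comment> \<open>the integrand of the remainder, divided by the norm of the increment\<close>
  define h where "h = (\<lambda>n x. (G x (u x + v (r n) x) - G x (u x) - g x (u x) * v (r n) x) / \<tau> n)"
  have hz: "\<exists>z. \<bar>z - u x\<bar> \<le> \<bar>\<tau> n * w (r n) x\<bar> \<and> h n x = (g x z - g x (u x)) * w (r n) x" for n x
  proof -
    obtain z where z: "\<bar>z - u x\<bar> \<le> \<bar>\<tau> n * w (r n) x\<bar>" "G x (u x + \<tau> n * w (r n) x) - G x (u x) = g x z * (\<tau> n * w (r n) x)"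
      using G_mean_value[of "u x" "\<tau> n * w (r n) x" x] by blast
    have "h n x = (g x z * (\<tau> n * w (r n) x) - g x (u x) * (\<tau> n * w (r n) x)) / \<tau> n"
      unfolding h_def vw z(2) ..
    also have "\<dots> = (g x z - g x (u x)) * w (r n) x" using \<tau>pos[of n] by (simp add: field_simps)
    finally show ?thesis using z(1) by blast
  qed
  have "(\<lambda>n. LINT x|lebesgue. h n x) \<longlonglongrightarrow> (LINT x|(lebesgue :: (real ^ 'n) measure). 0)"
  proof (rule integral_dominated_convergence[where w="\<lambda>x. Kg * ((2 powr p + 1) * m (u x) + (2 powr p + 2) * k x)"])
    show "h n \<in> borel_measurable lebesgue" for n
      unfolding h_def using G_integrable[OF u] G_integrable[OF E_add[OF u v(1)], of "r n"] g_integrable[OF u v(1), of "r n"]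
      by (intro borel_measurable_divide borel_measurable_diff) auto
    show "integrable lebesgue (\<lambda>x. Kg * ((2 powr p + 1) * m (u x) + (2 powr p + 2) * k x))"
      using k m_integrable[OF u] by simp
    show "AE x in lebesgue. (\<lambda>n. h n x) \<longlonglongrightarrow> 0"
      using wl
    proof eventually_elim
      case (elim x)
      obtain z where z: "\<And>n. \<bar>z n - u x\<bar> \<le> \<bar>\<tau> n * w (r n) x\<bar>" "\<And>n. h n x = (g x (z n) - g x (u x)) * w (r n) x"
        using hz[of x] by metis
      have "(\<lambda>n. \<tau> n * w (r n) x) \<longlonglongrightarrow> 0 * w' x" by (intro tendsto_mult \<tau>0 elim)
      then have "(\<lambda>n. \<bar>\<tau> n * w (r n) x\<bar>) \<longlonglongrightarrow> 0" by (simp add: tendsto_rabs_zero_iff)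
      from tendsto_0_le[OF _ z(1) this] have "(\<lambda>n. \<bar>z n - u x\<bar>) \<longlonglongrightarrow> 0" by simp
      then have zl: "z \<longlonglongrightarrow> u x" by (simp add: tendsto_rabs_zero_iff LIM_zero_iff)
      have "isCont (g x) (u x)" using g_continuous[of x] by (simp add: continuous_on_eq_continuous_at)
      from isCont_tendsto_compose[OF this zl]
      have "(\<lambda>n. (g x (z n) - g x (u x)) * w (r n) x) \<longlonglongrightarrow> (g x (u x) - g x (u x)) * w' x"
        by (intro tendsto_intros elim)
      then show ?case by (simp add: z(2))
    qed
    show "AE x in lebesgue. norm (h n x) \<le> Kg * ((2 powr p + 1) * m (u x) + (2 powr p + 2) * k x)" for n
      using wk[of n]
    proof eventually_elim
      case (elim x)
      let ?w = "w (r n) x"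
      have mw: "m ?w \<le> k x" using elim by (simp add: m_def)
      obtain z where z: "\<bar>z - u x\<bar> \<le> \<bar>\<tau> n * ?w\<bar>" "h n x = (g x z - g x (u x)) * ?w" using hz by blast
      have "\<bar>\<tau> n * ?w\<bar> \<le> 1 * \<bar>?w\<bar>" unfolding abs_mult using \<tau>pos[of n] \<tau>1[of n] by (intro mult_right_mono) auto
      then have "\<bar>z\<bar> \<le> \<bar>\<bar>u x\<bar> + \<bar>?w\<bar>\<bar>" using z(1) by linarith
      then have "m z \<le> m (\<bar>u x\<bar> + \<bar>?w\<bar>)" by (rule m_mono)
      also have "\<dots> \<le> 2 powr p * (m (u x) + m ?w)" using m_add[of "\<bar>u x\<bar>" "\<bar>?w\<bar>"] by (simp add: m_def)
      finally have mz: "m z \<le> 2 powr p * (m (u x) + m ?w)" .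
      have "\<bar>h n x\<bar> \<le> \<bar>g x z * ?w\<bar> + \<bar>g x (u x) * ?w\<bar>"
        unfolding z(2) left_diff_distrib by (rule abs_triangle_ineq4)
      also have "\<dots> \<le> Kg * (m z + m ?w) + Kg * (m (u x) + m ?w)" by (intro add_mono Kg)
      also have "\<dots> = Kg * (m z + m (u x) + 2 * m ?w)" by (simp add: algebra_simps)
      also have "\<dots> \<le> Kg * (2 powr p * (m (u x) + m ?w) + m (u x) + 2 * m ?w)"
        using mz Kg(1) by (intro mult_left_mono) auto
      also have "\<dots> = Kg * ((2 powr p + 1) * m (u x) + (2 powr p + 2) * m ?w)" by (simp add: algebra_simps)
      also have "\<dots> \<le> Kg * ((2 powr p + 1) * m (u x) + (2 powr p + 2) * k x)"
        using mw Kg(1) by (intro mult_left_mono add_left_mono) auto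
      finally show ?case by simp
    qed
  qed simp
  then have "(\<lambda>n. LINT x|lebesgue. h n x) \<longlonglongrightarrow> 0" by simp
  from LIMSEQ_D[OF this \<epsilon>] obtain n0 where "\<forall>n\<ge>n0. norm ((LINT x|lebesgue. h n x) - 0) < \<epsilon>" by blast
  then obtain n where n: "\<bar>LINT x|lebesgue. h n x\<bar> < \<epsilon>" by fastforce
  have hn: "(LINT x|lebesgue. h n x) = (\<Psi> (\<lambda>x. u x + v (r n) x) - \<Psi> u - N u (v (r n))) / \<tau> n"
    unfolding h_def \<Psi>_def N_def
    using G_integrable[OF u] G_integrable[OF E_add[OF u v(1)], of "r n"] g_integrable[OF u v(1), of "r n"] by simp
  have "\<bar>\<Psi> (\<lambda>x. u x + v (r n) x) - \<Psi> u - N u (v (r n))\<bar> / \<tau> n < \<epsilon>"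
    using n unfolding hn abs_divide abs_of_pos[OF \<tau>pos] .
  then have "\<bar>\<Psi> (\<lambda>x. u x + v (r n) x) - \<Psi> u - N u (v (r n))\<bar> < \<epsilon> * \<tau> n" using \<tau>pos[of n] by (simp add: pos_divide_less_eq)
  then show False using v(3)[of "r n"] by (simp add: \<tau>_def)
qed

abbreviation "J \<equiv> energy \<alpha> V f \<Gamma> q"

lemma J_eq: "u \<in> E \<Longrightarrow> J u = (1 / 2) * (nrm u)\<^sup>2 - \<Psi> u"
  unfolding \<Psi>_def by (rule energy_eq[OF E_D(4)])

definition J' :: "(real ^ 'n \<Rightarrow> real) \<Rightarrow> (real ^ 'n \<Rightarrow> real) \<Rightarrow> real" where
  "J' u v = B u v - N u v"

lemma J'_linear:
  "u \<in> E \<Longrightarrow> v \<in> E \<Longrightarrow> w \<in> E \<Longrightarrow> J' u (\<lambda>x. a * v x + b * w x) = a * J' u v + b * J' u w"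
  by (simp add: J'_def B_linear N_linear algebra_simps)

theorem J_Frechet:
  assumes u: "u \<in> E" shows "has_energy_derivative \<alpha> V J u (J' u)"
  unfolding has_energy_derivative_def
proof (intro conjI ballI allI impI)
  show "J' u (\<lambda>x. a * v x + b * w x) = a * J' u v + b * J' u w" if "v \<in> E" "w \<in> E" for v w a b
    using J'_linear[OF u that] .
  obtain C where C: "\<And>v. v \<in> E \<Longrightarrow> \<bar>N u v\<bar> \<le> C * nrm v" using N_bound[OF u] by blast
  have "\<bar>J' u v\<bar> \<le> (nrm u + C) * nrm v" if v: "v \<in> E" for v
    using B_bound[OF u v] C[OF v] unfolding J'_def by (simp add: distrib_right)
  then show "\<exists>C. \<forall>v\<in>E. \<bar>J' u v\<bar> \<le> C * nrm v" by blast
  fix \<epsilon> :: real assume \<epsilon>: "\<epsilon> > 0"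
  obtain \<delta> where \<delta>: "\<delta> > 0" "\<And>v. v \<in> E \<Longrightarrow> nrm v < \<delta> \<Longrightarrow> \<bar>\<Psi> (\<lambda>x. u x + v x) - \<Psi> u - N u v\<bar> \<le> (\<epsilon> / 2) * nrm v"
    using \<Psi>_Frechet[OF u, of "\<epsilon> / 2"] \<epsilon> by auto
  have "\<bar>J (\<lambda>x. u x + v x) - J u - J' u v\<bar> \<le> \<epsilon> * nrm v" if v: "v \<in> E" and s: "nrm v < min \<delta> \<epsilon>" for v
  proof -
    have "(nrm (\<lambda>x. u x + v x))\<^sup>2 = (nrm u)\<^sup>2 + 2 * B u v + (nrm v)\<^sup>2" using nrm_linear_power2[OF u v, of 1 1] by simp
    then have "J (\<lambda>x. u x + v x) - J u - J' u v = (1 / 2) * (nrm v)\<^sup>2 - (\<Psi> (\<lambda>x. u x + v x) - \<Psi> u - N u v)"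
      using J_eq[OF u] J_eq[OF E_add[OF u v]] unfolding J'_def by linarith
    moreover have "\<bar>\<Psi> (\<lambda>x. u x + v x) - \<Psi> u - N u v\<bar> \<le> (\<epsilon> / 2) * nrm v" using \<delta>(2)[OF v] s by simp
    moreover have "(nrm v)\<^sup>2 \<le> \<epsilon> * nrm v" using s unfolding power2_eq_square by (intro mult_right_mono) auto
    ultimately show ?thesis using zero_le_power2[of "nrm v"] by linarith
  qed
  then show "\<exists>\<delta>>0. \<forall>v\<in>E. nrm v < \<delta> \<longrightarrow> \<bar>J (\<lambda>x. u x + v x) - J u - J' u v\<bar> \<le> \<epsilon> * nrm v"
    using \<delta>(1) \<epsilon> by (intro exI[of _ "min \<delta> \<epsilon>"]) auto
qed

section \<open>The Nehari manifold\<close>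

text \<open>Two derivatives differ by a linear form that is small compared with the norm near \<open>0\<close>.\<close>

lemma energy_derivative_unique:
  assumes L: "has_energy_derivative \<alpha> V \<Phi> u L" and L': "has_energy_derivative \<alpha> V \<Phi> u L'" and v: "v \<in> E"
  shows "L v = L' v"
proof -
  have "\<bar>L v - L' v\<bar> \<le> 0 + e" if e: "e > 0" for e
  proof -
    define \<epsilon> where "\<epsilon> = e / (2 * (nrm v + 1))"
    have \<epsilon>: "\<epsilon> > 0" using e nrm_nonneg[of v] by (simp add: \<epsilon>_def add_nonneg_pos)
    obtain d where d: "d > 0" "\<And>w. w \<in> E \<Longrightarrow> nrm w < d \<Longrightarrow> \<bar>\<Phi> (\<lambda>x. u x + w x) - \<Phi> u - L w\<bar> \<le> \<epsilon> * nrm w"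
      using L \<epsilon> unfolding has_energy_derivative_def by blast
    obtain d' where d': "d' > 0" "\<And>w. w \<in> E \<Longrightarrow> nrm w < d' \<Longrightarrow> \<bar>\<Phi> (\<lambda>x. u x + w x) - \<Phi> u - L' w\<bar> \<le> \<epsilon> * nrm w"
      using L' \<epsilon> unfolding has_energy_derivative_def by blast
    \<comment> \<open>scales \<open>v\<close> into both neighbourhoods; adding \<open>1\<close> covers the case that the norm of \<open>v\<close> vanishes\<close>
    define t where "t = min d d' / (2 * (nrm v + 1))"
    have nv: "0 < nrm v + 1" using nrm_nonneg[of v] by linarith
    have t: "t > 0" using d(1) d'(1) nv by (simp add: t_def)
    let ?w = "\<lambda>x. t * v x"
    have w: "?w \<in> E" by (rule E_scale[OF v])
    have nw: "nrm ?w = t * nrm v" using nrm_scale[OF v, of t] t by simp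
    have "t * nrm v \<le> t * (nrm v + 1)" using t by (intro mult_left_mono) auto
    also have "\<dots> = min d d' / 2" using nv by (simp add: t_def field_simps)
    also have "\<dots> < min d d'"
    proof -
      have "0 < min d d'" using d(1) d'(1) by simp
      then show ?thesis by linarith
    qed
    finally have "nrm ?w < min d d'" by (simp add: nw)
    then have a: "\<bar>\<Phi> (\<lambda>x. u x + ?w x) - \<Phi> u - L ?w\<bar> \<le> \<epsilon> * nrm ?w" "\<bar>\<Phi> (\<lambda>x. u x + ?w x) - \<Phi> u - L' ?w\<bar> \<le> \<epsilon> * nrm ?w"
      using d(2)[OF w] d'(2)[OF w] by auto
    have lin: "M ?w = t * M v" if "has_energy_derivative \<alpha> V \<Phi> u M" for M
    proof -
      have "M (\<lambda>x. t * v x + 0 * v x) = t * M v + 0 * M v"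
        using that v unfolding has_energy_derivative_def by blast
      then show ?thesis by simp
    qed
    have "\<bar>t * L v - t * L' v\<bar> \<le> 2 * (\<epsilon> * (t * nrm v))" using a unfolding lin[OF L] lin[OF L'] nw by linarith
    then have "t * \<bar>L v - L' v\<bar> \<le> t * (2 * \<epsilon> * nrm v)"
      using t by (simp add: right_diff_distrib[symmetric] abs_mult mult_ac)
    then have "\<bar>L v - L' v\<bar> \<le> 2 * \<epsilon> * nrm v" using t by simp
    also have "\<dots> \<le> 2 * \<epsilon> * (nrm v + 1)" using \<epsilon> by (intro mult_left_mono) auto
    also have "\<dots> = e"
    proof -
      have "2 * (e / (2 * a)) * a = e" if "0 < a" for a using that by simp
      from this[OF nv] show ?thesis unfolding \<epsilon>_def .
    qed
    finally show ?thesis by simp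
  qed
  then have "\<bar>L v - L' v\<bar> \<le> 0" by (rule field_le_epsilon)
  then show ?thesis by simp
qed

abbreviation "\<N> \<equiv> nehari \<alpha> V f \<Gamma> q"

lemma nehari_iff: "u \<in> \<N> \<longleftrightarrow> u \<in> E \<and> \<not> (AE x in lebesgue. u x = 0) \<and> J' u u = 0"
proof
  assume "u \<in> \<N>"
  then obtain L where u: "u \<in> E" "\<not> (AE x in lebesgue. u x = 0)" and L: "has_energy_derivative \<alpha> V J u L" "L u = 0"
    unfolding nehari_def by blast
  have "J' u u = L u" by (rule energy_derivative_unique[OF J_Frechet[OF u(1)] L(1) u(1)])
  then show "u \<in> E \<and> \<not> (AE x in lebesgue. u x = 0) \<and> J' u u = 0" using u L by simp
next
  assume u: "u \<in> E \<and> \<not> (AE x in lebesgue. u x = 0) \<and> J' u u = 0"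
  then have "has_energy_derivative \<alpha> V J u (J' u)" by (intro J_Frechet) simp
  with u show "u \<in> \<N>" unfolding nehari_def by blast
qed

lemma nrm_AE_0:
  assumes y: "y \<in> E" and ae: "AE x in lebesgue. y x = 0" shows "nrm y = 0"
proof -
  note ys = E_D(1)[OF y]
  have "l2 lebesgue (fourier y) = 0" using ae fourier_props(3)[OF ys] l2_eq_0_iff[OF ys] by simp
  then have "AE \<xi> in lebesgue. fourier y \<xi> = 0" using l2_eq_0_iff[OF fourier_props(1)[OF ys]] by simp
  then have "AE \<xi> in lebesgue. kin y \<xi> = 0" unfolding kin_def by eventually_elim simp
  then have "l2 lebesgue (kin y) = 0" using l2_eq_0_iff[OF E_D(2)[OF y]] by simp
  moreover have "AE x in lebesgue. pot y x = 0" unfolding pot_def using ae by eventually_elim simp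
  then have "l2 lebesgue (pot y) = 0" using l2_eq_0_iff[OF E_D(3)[OF y]] by simp
  ultimately show ?thesis using nrm_power2[of y] by simp
qed

lemma J'_scale: "u \<in> E \<Longrightarrow> v \<in> E \<Longrightarrow> J' u (\<lambda>x. a * v x) = a * J' u v"
  using J'_linear[of u v v a 0] by simp

lemma J_line_derivative:
  assumes u: "u \<in> E" and v: "v \<in> E"
  shows "((\<lambda>t. J (\<lambda>x. u x + t * v x)) has_real_derivative J' (\<lambda>x. u x + t * v x) v) (at t)"
  unfolding DERIV_def
proof (rule LIM_I)
  let ?w = "\<lambda>x. u x + t * v x"
  have w: "?w \<in> E" using E_linear[OF u v, of 1 t] by simp
  have nv: "0 < nrm v + 1" using nrm_nonneg[of v] by linarith
  fix e :: real assume e: "e > 0"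
  define \<epsilon> where "\<epsilon> = e / (2 * (nrm v + 1))"
  have \<epsilon>: "\<epsilon> > 0" using e nv by (simp add: \<epsilon>_def)
  obtain d where d: "d > 0" "\<And>y. y \<in> E \<Longrightarrow> nrm y < d \<Longrightarrow> \<bar>J (\<lambda>x. ?w x + y x) - J ?w - J' ?w y\<bar> \<le> \<epsilon> * nrm y"
    using J_Frechet[OF w] \<epsilon> unfolding has_energy_derivative_def by blast
  have "norm ((J (\<lambda>x. u x + (t + h) * v x) - J ?w) / h - J' ?w v) < e"
    if h: "h \<noteq> 0" "norm (h - 0) < d / (nrm v + 1)" for h
  proof -
    let ?y = "\<lambda>x. h * v x"
    have ny: "nrm ?y = \<bar>h\<bar> * nrm v" by (rule nrm_scale[OF v])
    have "\<bar>h\<bar> * nrm v \<le> \<bar>h\<bar> * (nrm v + 1)" by (intro mult_left_mono) auto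
    also have "\<dots> < d" using h(2) nv by (simp add: pos_less_divide_eq)
    finally have "nrm ?y < d" by (simp add: ny)
    from d(2)[OF E_scale[OF v] this]
    have "\<bar>J (\<lambda>x. u x + (t + h) * v x) - J ?w - h * J' ?w v\<bar> \<le> \<epsilon> * (\<bar>h\<bar> * nrm v)"
      unfolding ny J'_scale[OF w v] by (simp add: algebra_simps)
    then have "\<bar>J (\<lambda>x. u x + (t + h) * v x) - J ?w - h * J' ?w v\<bar> / \<bar>h\<bar> \<le> \<epsilon> * nrm v"
      using h(1) by (simp add: pos_divide_le_eq mult_ac)
    moreover have "(J (\<lambda>x. u x + (t + h) * v x) - J ?w) / h - J' ?w v = (J (\<lambda>x. u x + (t + h) * v x) - J ?w - h * J' ?w v) / h"
      using h(1) by (simp add: diff_divide_distrib)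
    ultimately have "\<bar>(J (\<lambda>x. u x + (t + h) * v x) - J ?w) / h - J' ?w v\<bar> \<le> \<epsilon> * nrm v" by simp
    also have "\<dots> \<le> \<epsilon> * (nrm v + 1)" using \<epsilon> by (intro mult_left_mono) auto
    also have "\<dots> = e / 2"
    proof -
      have "e / (2 * a) * a = e / 2" if "0 < a" for a using that by simp
      from this[OF nv] show ?thesis unfolding \<epsilon>_def .
    qed
    finally show ?thesis using e by simp
  qed
  then show "\<exists>s>0. \<forall>h. h \<noteq> 0 \<and> norm (h - 0) < s \<longrightarrow> norm ((J (\<lambda>x. u x + (t + h) * v x) - J ?w) / h - J' ?w v) < e"
    using d(1) nv by (intro exI[of _ "d / (nrm v + 1)"]) auto
qed

lemma m_scale: "m (t * a) \<le> (t\<^sup>2 + \<bar>t\<bar> powr p) * m a"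
proof -
  have "m (t * a) = t\<^sup>2 * a\<^sup>2 + \<bar>t\<bar> powr p * \<bar>a\<bar> powr p" by (simp add: m_def power_mult_distrib abs_mult powr_mult)
  also have "\<dots> \<le> t\<^sup>2 * m a + \<bar>t\<bar> powr p * m a"
    by (intro add_mono mult_left_mono) (auto simp: m_def)
  finally show ?thesis by (simp add: distrib_right)
qed

lemma J'_tendsto:
  assumes u: "u \<in> E" and v: "v \<in> E" and w: "w \<in> E" and t: "t \<longlonglongrightarrow> t0" and s: "s \<longlonglongrightarrow> s0"
  shows "(\<lambda>n. J' (\<lambda>x. t n * u x + s n * v x) w) \<longlonglongrightarrow> J' (\<lambda>x. t0 * u x + s0 * v x) w"
proof -
  have B: "B (\<lambda>x. a * u x + b * v x) w = a * B u w + b * B v w" for a b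
    using B_linear[OF u v w, of a b] by (simp add: B_commute[of _ w])
  obtain R where R: "\<And>n. \<bar>t n\<bar> \<le> R" "\<And>n. \<bar>s n\<bar> \<le> R"
  proof -
    obtain K1 K2 where "\<And>n. \<bar>t n\<bar> \<le> K1" "\<And>n. \<bar>s n\<bar> \<le> K2"
      using convergent_imp_Bseq[OF convergentI[OF t]] convergent_imp_Bseq[OF convergentI[OF s]] unfolding Bseq_def by auto
    then show ?thesis by (intro that[of "max K1 K2"]) (auto simp: le_max_iff_disj)
  qed
  let ?k = "\<lambda>x. 2 powr p * (m (R * u x) + m (R * v x)) + m (w x)"
  have "(\<lambda>n. N (\<lambda>x. t n * u x + s n * v x) w) \<longlonglongrightarrow> N (\<lambda>x. t0 * u x + s0 * v x) w"
    unfolding N_def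
  proof (rule g_dominated_convergence[where k="?k"])
    show "integrable lebesgue ?k"
      using m_integrable[OF E_scale[OF u, of R]] m_integrable[OF E_scale[OF v, of R]] m_integrable[OF w] by simp
    show "AE x in lebesgue. m (t n * u x + s n * v x) \<le> ?k x" for n
    proof (intro always_eventually allI)
      fix x
      have *: "m (t n * u x) \<le> m (R * u x)" "m (s n * v x) \<le> m (R * v x)"
        using R(1)[of n] R(2)[of n] by (auto intro!: m_mono mult_mono simp: abs_mult)
      have "m (t n * u x + s n * v x) \<le> 2 powr p * (m (t n * u x) + m (s n * v x))" by (rule m_add)
      also have "\<dots> \<le> 2 powr p * (m (R * u x) + m (R * v x))" using * by (intro mult_left_mono add_mono) auto
      finally show "m (t n * u x + s n * v x) \<le> ?k x" using m_nonneg[of "w x"] by linarith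
    qed
    show "AE x in lebesgue. m (w x) \<le> ?k x" for n :: nat
      by (intro always_eventually allI) (simp add: m_nonneg)
    show "AE x in lebesgue. (\<lambda>n. t n * u x + s n * v x) \<longlonglongrightarrow> t0 * u x + s0 * v x"
      by (intro always_eventually allI tendsto_intros t s)
  qed (auto intro!: E_D E_linear u v w)
  moreover have "(\<lambda>n. t n * B u w + s n * B v w) \<longlonglongrightarrow> t0 * B u w + s0 * B v w" by (intro tendsto_intros t s)
  ultimately show ?thesis unfolding J'_def B by (intro tendsto_diff)
qed

subsection \<open>Fibres\<close>

text \<open>Half of the squared norm absorbs the part of the nonlinearity that is small near \<open>0\<close>; what remains is of order
  \<open>p > 2\<close>.\<close>

lemma J'_positive_near_0: "\<exists>\<rho>>0. \<forall>w\<in>E. 0 < nrm w \<and> nrm w \<le> \<rho> \<longrightarrow> 0 < J' w w"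
proof -
  obtain C where C: "C \<ge> 0" "\<And>x s. \<bar>g x s\<bar> \<le> V0 / 2 * \<bar>s\<bar> + C * \<bar>s\<bar> powr (p - 1)"
    using g_bound_eps[of "V0 / 2"] V0_pos by auto
  obtain S where S: "S \<ge> 0" "\<And>u. u \<in> E \<Longrightarrow> integrable lebesgue (\<lambda>x. \<bar>u x\<bar> powr p) \<and> (LINT x|lebesgue. \<bar>u x\<bar> powr p) \<le> S * nrm u powr p"
    using subcritical_embedding[OF p_bounds] by blast
  have "((\<lambda>r. C * S * r powr (p - 2)) \<longlongrightarrow> C * S * 0 powr (p - 2)) (at_right 0)"
    using exponents by (intro tendsto_intros tendsto_powr') (auto simp: eventually_at_filter)
  then have "eventually (\<lambda>r. C * S * r powr (p - 2) < 1 / 2) (at_right 0)"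
    by (rule order_tendstoD) simp
  then obtain \<rho>' where \<rho>': "\<rho>' > 0" "\<And>r. 0 < r \<Longrightarrow> r < \<rho>' \<Longrightarrow> C * S * r powr (p - 2) < 1 / 2"
    by (auto simp: eventually_at_right_field)
  have "0 < J' w w" if w: "w \<in> E" "0 < nrm w" "nrm w \<le> \<rho>' / 2" for w
  proof -
    have i2: "integrable lebesgue (\<lambda>x. (w x)\<^sup>2)" using E_D(1)[OF w(1)] by (simp add: sq_int_def)
    have ip: "integrable lebesgue (\<lambda>x. \<bar>w x\<bar> powr p)" using S(2)[OF w(1)] by simp
    have pw: "g x (w x) * w x \<le> V0 / 2 * (w x)\<^sup>2 + C * \<bar>w x\<bar> powr p" for x
    proof -
      have "g x (w x) * w x \<le> \<bar>g x (w x)\<bar> * \<bar>w x\<bar>" by (metis abs_ge_self abs_mult)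
      also have "\<dots> \<le> (V0 / 2 * \<bar>w x\<bar> + C * \<bar>w x\<bar> powr (p - 1)) * \<bar>w x\<bar>" by (intro mult_right_mono C) auto
      also have "\<dots> = V0 / 2 * (w x)\<^sup>2 + C * (\<bar>w x\<bar> powr (p - 1) * \<bar>w x\<bar>)"
        by (simp add: distrib_right power2_eq_square abs_mult_self_eq mult.assoc)
      also have "\<bar>w x\<bar> powr (p - 1) * \<bar>w x\<bar> = \<bar>w x\<bar> powr p"
        using powr_mult_base[of "\<bar>w x\<bar>" "p - 1"] by (cases "w x = 0") (auto simp: mult.commute)
      finally show ?thesis .
    qed
    have "N w w \<le> (LINT x|lebesgue. V0 / 2 * (w x)\<^sup>2 + C * \<bar>w x\<bar> powr p)"
      unfolding N_def using i2 ip by (intro integral_mono g_integrable w pw) auto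
    also have "\<dots> = V0 / 2 * (l2 lebesgue w)\<^sup>2 + C * (LINT x|lebesgue. \<bar>w x\<bar> powr p)"
      using i2 ip by (simp add: l2_power2)
    also have "\<dots> \<le> V0 / 2 * (nrm w / sqrt V0)\<^sup>2 + C * (S * nrm w powr p)"
      using S(2)[OF w(1)] C(1) V0_pos l2_le_nrm[OF w(1)] by (intro add_mono mult_left_mono power_mono) auto
    also have "V0 / 2 * (nrm w / sqrt V0)\<^sup>2 = (nrm w)\<^sup>2 / 2" using V0_pos by (simp add: power_divide)
    also have "C * (S * nrm w powr p) = (C * S * nrm w powr (p - 2)) * (nrm w)\<^sup>2"
      using powr_split2[of "nrm w" p] by simp
    also have "(nrm w)\<^sup>2 / 2 + (C * S * nrm w powr (p - 2)) * (nrm w)\<^sup>2 < (nrm w)\<^sup>2 / 2 + (1 / 2) * (nrm w)\<^sup>2"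
      using \<rho>'(2)[of "nrm w"] w \<rho>'(1) by (intro add_strict_left_mono mult_strict_right_mono) auto
    finally show ?thesis by (simp add: J'_def B_self)
  qed
  then show ?thesis using \<rho>'(1) by (intro exI[of _ "\<rho>' / 2"]) auto
qed

text \<open>For large arguments the superlinearity assumption also pays for the term with \<open>\<Gamma>\<close>; on a bounded set of
  arguments every power above \<open>2\<close> is comparable with the square.\<close>

lemma G_lower_bound: "\<exists>C\<ge>0. \<forall>x\<in>good. \<forall>s. \<bar>s\<bar> powr q - C * s\<^sup>2 \<le> G x s"
proof -
  have "\<forall>\<^sub>F u in at_infinity. \<forall>x. 1 + C\<Gamma> / q \<le> primitive f x u / \<bar>u\<bar> powr q"
    using F3 by (simp add: cond_F3_def)
  then obtain R0 where R0: "\<And>u x. R0 \<le> \<bar>u\<bar> \<Longrightarrow> 1 + C\<Gamma> / q \<le> primitive f x u / \<bar>u\<bar> powr q"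
    by (auto simp: eventually_at_infinity)
  define R where "R = max 1 R0"
  have R: "R > 0" by (simp add: R_def)
  let ?C = "2 * Kg * (1 + R powr (p - 2)) + R powr (q - 2)"
  have C0: "?C \<ge> 0" using Kg(1) by simp
  have "\<bar>s\<bar> powr q - ?C * s\<^sup>2 \<le> G x s" if x: "x \<in> good" for x s
  proof (cases "\<bar>s\<bar> \<le> R")
    case True
    have a: "\<bar>s\<bar> powr r \<le> R powr (r - 2) * s\<^sup>2" if "2 \<le> r" for r
      unfolding powr_split2[of s r] using True that by (intro mult_right_mono powr_mono2) auto
    have "m s \<le> (1 + R powr (p - 2)) * s\<^sup>2" using a[of p] p_bounds by (simp add: m_def distrib_right)
    then have "2 * Kg * m s \<le> 2 * Kg * ((1 + R powr (p - 2)) * s\<^sup>2)" using Kg(1) by (intro mult_left_mono) auto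
    moreover have "- (2 * Kg * m s) \<le> G x s" using G_m_bound[of x s] by linarith
    moreover have "\<bar>s\<bar> powr q \<le> R powr (q - 2) * s\<^sup>2" using a[of q] exponents by simp
    ultimately show ?thesis by (simp add: algebra_simps)
  next
    case False
    then have s: "R0 \<le> \<bar>s\<bar>" "0 < \<bar>s\<bar> powr q" using R by (auto simp: R_def)
    have "(1 + C\<Gamma> / q) * \<bar>s\<bar> powr q \<le> primitive f x s" using R0[OF s(1), of x] s(2) by (simp add: pos_le_divide_eq)
    moreover have "(1 / q) * \<Gamma> x * \<bar>s\<bar> powr q \<le> (C\<Gamma> / q) * \<bar>s\<bar> powr q"
      using x exponents by (intro mult_right_mono) (auto simp: good_def divide_right_mono)
    ultimately have "\<bar>s\<bar> powr q \<le> G x s" using x by (simp add: G_def algebra_simps)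
    moreover have "0 \<le> ?C * s\<^sup>2" using C0 by (intro mult_nonneg_nonneg) auto
    ultimately show ?thesis by linarith
  qed
  then show ?thesis using C0 by blast
qed

lemma nrm_pos: "u \<in> E \<Longrightarrow> \<not> (AE x in lebesgue. u x = 0) \<Longrightarrow> 0 < nrm u"
  using nrm_eq_0_imp[of u] nrm_nonneg[of u] by (metis less_eq_real_def)

lemma fibre_negative:
  assumes u: "u \<in> E" and nz: "\<not> (AE x in lebesgue. u x = 0)"
  shows "\<exists>T>0. J (\<lambda>x. T * u x) < 0"
proof -
  obtain C where C: "C \<ge> 0" "\<And>x s. x \<in> good \<Longrightarrow> \<bar>s\<bar> powr q - C * s\<^sup>2 \<le> G x s" using G_lower_bound by blast
  have q: "2 \<le> q" "q < 2 * real CARD('n) / (real CARD('n) - \<alpha>)" using exponents by auto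
  have iq: "integrable lebesgue (\<lambda>x. \<bar>u x\<bar> powr q)" using subcritical_embedding[OF q] u by blast
  have i2: "integrable lebesgue (\<lambda>x. (u x)\<^sup>2)" using E_D(1)[OF u] by (simp add: sq_int_def)
  let ?Q = "LINT x|lebesgue. \<bar>u x\<bar> powr q"
  have Q: "?Q > 0"
  proof -
    have "?Q \<noteq> 0"
      using nz integral_nonneg_eq_0_iff_AE[OF iq] by simp
    moreover have "?Q \<ge> 0" by simp
    ultimately show ?thesis by linarith
  qed
  let ?A = "(nrm u)\<^sup>2 / 2 + C * (l2 lebesgue u)\<^sup>2"
  have up: "J (\<lambda>x. t * u x) \<le> t\<^sup>2 * ?A - t powr q * ?Q" if t: "t > 0" for t
  proof -
    have tu: "(\<lambda>x. t * u x) \<in> E" by (rule E_scale[OF u])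
    have "(LINT x|lebesgue. t powr q * \<bar>u x\<bar> powr q - (C * t\<^sup>2) * (u x)\<^sup>2) \<le> \<Psi> (\<lambda>x. t * u x)"
      unfolding \<Psi>_def
    proof (rule integral_mono_AE)
      show "AE x in lebesgue. t powr q * \<bar>u x\<bar> powr q - (C * t\<^sup>2) * (u x)\<^sup>2 \<le> G x (t * u x)"
        using AE_good
      proof eventually_elim
        case (elim x)
        then show ?case using C(2)[OF elim, of "t * u x"] t by (simp add: abs_mult powr_mult power_mult_distrib mult.assoc)
      qed
    qed (use iq i2 G_integrable[OF tu] in auto)
    moreover have "(LINT x|lebesgue. t powr q * \<bar>u x\<bar> powr q - (C * t\<^sup>2) * (u x)\<^sup>2) = t powr q * ?Q - (C * t\<^sup>2) * (l2 lebesgue u)\<^sup>2"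
      using iq i2 by (simp add: l2_power2)
    moreover have "J (\<lambda>x. t * u x) = t\<^sup>2 * ((nrm u)\<^sup>2 / 2) - \<Psi> (\<lambda>x. t * u x)"
      using J_eq[OF tu] nrm_scale[OF u, of t] by (simp add: power_mult_distrib)
    ultimately show ?thesis by (simp add: algebra_simps)
  qed
  \<comment> \<open>large enough for the power \<open>q\<close> to outweigh the square\<close>
  define T where "T = (?A / ?Q + 1) powr (1 / (q - 2))"
  have AQ: "0 < ?A / ?Q + 1" using Q C(1) by (intro add_nonneg_pos divide_nonneg_nonneg) auto
  then have T: "?A / ?Q + 1 \<le> T powr (q - 2)" "0 < T" using exponents by (auto simp: T_def powr_powr)
  have "?A < (?A / ?Q + 1) * ?Q"
  proof -
    have "a < (a / b + 1) * b" if "0 < b" for a b :: real using that by (simp add: distrib_right)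
    from this[OF Q] show ?thesis .
  qed
  also have "\<dots> \<le> T powr (q - 2) * ?Q" using T(1) Q by (intro mult_right_mono) auto
  finally have "T\<^sup>2 * ?A < T\<^sup>2 * (T powr (q - 2) * ?Q)" using T(2) by simp
  also have "\<dots> = T powr q * ?Q" using powr_split2[of T q] T(2) by simp
  finally show ?thesis using up[OF T(2)] T(2) by (intro exI[of _ T]) linarith
qed

text \<open>The quadratic part contributes \<open>t powr (2 - q)\<close>, strictly decreasing as \<open>q > 2\<close>; the nonlinear part is monotone
  pointwise.\<close>

lemma fibre_quotient_decreasing:
  assumes u: "u \<in> E" and pos: "0 < nrm u" and st: "0 < s" "s < t"
  shows "J' (\<lambda>x. t * u x) u / t powr (q - 1) < J' (\<lambda>x. s * u x) u / s powr (q - 1)"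
proof -
  have t0: "0 < t" using st by linarith
  have d: "J' (\<lambda>x. r * u x) u / r powr (q - 1) = r powr (2 - q) * (nrm u)\<^sup>2 - N (\<lambda>x. r * u x) u / r powr (q - 1)" if r: "0 < r" for r
  proof -
    have "B (\<lambda>x. r * u x) u = r * (nrm u)\<^sup>2" using B_linear[OF u u u, of r 0] by (simp add: B_commute[of _ u] B_self)
    moreover have "r / r powr (q - 1) = r powr (2 - q)"
      using r powr_diff[of r 1 "q - 1"] by simp
    moreover have "r * (nrm u)\<^sup>2 / r powr (q - 1) = r / r powr (q - 1) * (nrm u)\<^sup>2" by simp
    ultimately show ?thesis unfolding J'_def diff_divide_distrib by (simp only:)
  qed
  have "N (\<lambda>x. s * u x) u / s powr (q - 1) \<le> N (\<lambda>x. t * u x) u / t powr (q - 1)"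
  proof -
    have i: "integrable lebesgue (\<lambda>x. g x (r * u x) * u x / r powr (q - 1))" for r
      using g_integrable[OF E_scale[OF u, of r] u] by simp
    have "(LINT x|lebesgue. g x (s * u x) * u x / s powr (q - 1)) \<le> (LINT x|lebesgue. g x (t * u x) * u x / t powr (q - 1))"
      by (intro integral_mono i g_quotient_mono) (use st in auto)
    then show ?thesis by (simp add: N_def)
  qed
  moreover have "t powr (2 - q) * (nrm u)\<^sup>2 < s powr (2 - q) * (nrm u)\<^sup>2"
    using st pos exponents by (intro mult_strict_right_mono powr_less_mono2_neg) auto
  ultimately show ?thesis unfolding d[OF st(1)] d[OF t0] by linarith
qed

lemma fibre_sign:
  assumes u: "u \<in> E" and pos: "0 < nrm u" and t0: "0 < t0" and z: "J' (\<lambda>x. t0 * u x) u = 0"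
  shows "0 < t \<Longrightarrow> t < t0 \<Longrightarrow> 0 < J' (\<lambda>x. t * u x) u" "t0 < t \<Longrightarrow> J' (\<lambda>x. t * u x) u < 0"
  using fibre_quotient_decreasing[OF u pos, of t t0] fibre_quotient_decreasing[OF u pos, of t0 t] t0 z
  by (auto simp: zero_less_divide_iff divide_less_0_iff powr_gt_zero not_less[symmetric])

lemma fibre_derivative:
  assumes u: "u \<in> E" shows "((\<lambda>t. J (\<lambda>x. t * u x)) has_real_derivative J' (\<lambda>x. t * u x) u) (at t)"
  using J_line_derivative[OF E_scale[OF u, of 0] u, of t] by simp

lemma fibre_maximum:
  assumes u: "u \<in> E" and pos: "0 < nrm u" and t0: "0 < t0" and z: "J' (\<lambda>x. t0 * u x) u = 0" and t: "0 < t"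
  shows "J (\<lambda>x. t * u x) \<le> J (\<lambda>x. t0 * u x)"
proof -
  note sg = fibre_sign[OF u pos t0 z]
  consider "t < t0" | "t > t0" | "t = t0" by linarith
  then show ?thesis
  proof cases
    case 1
    obtain y where y: "t < y" "y < t0" "J (\<lambda>x. t0 * u x) - J (\<lambda>x. t * u x) = (t0 - t) * J' (\<lambda>x. y * u x) u"
      using MVT2[OF 1, of "\<lambda>t. J (\<lambda>x. t * u x)" "\<lambda>t. J' (\<lambda>x. t * u x) u"] fibre_derivative[OF u] by auto
    have "0 < (t0 - t) * J' (\<lambda>x. y * u x) u" using sg(1)[of y] y 1 t by (intro mult_pos_pos) auto
    then show ?thesis using y(3) by linarith
  next
    case 2
    obtain y where y: "t0 < y" "y < t" "J (\<lambda>x. t * u x) - J (\<lambda>x. t0 * u x) = (t - t0) * J' (\<lambda>x. y * u x) u"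
      using MVT2[OF 2, of "\<lambda>t. J (\<lambda>x. t * u x)" "\<lambda>t. J' (\<lambda>x. t * u x) u"] fibre_derivative[OF u] by auto
    have "(t - t0) * J' (\<lambda>x. y * u x) u < 0" using sg(2)[of y] y 2 by (intro mult_pos_neg) auto
    then show ?thesis using y(3) by linarith
  qed simp
qed

lemma J'_line_continuous:
  assumes u: "u \<in> E" and v: "v \<in> E" and w: "w \<in> E"
  shows "continuous_on S (\<lambda>t. J' (\<lambda>x. t * u x + s * v x) w)"
proof (rule continuous_at_imp_continuous_on, intro ballI)
  fix t
  show "isCont (\<lambda>t. J' (\<lambda>x. t * u x + s * v x) w) t"
    unfolding continuous_at_sequentially o_def
    using J'_tendsto[OF u v w _ tendsto_const] by blast
qed

text \<open>The derivative is positive near \<open>0\<close>; since the energy starts at \<open>0\<close> and becomes negative, it is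
  negative somewhere.\<close>

lemma fibre_zero:
  assumes u: "u \<in> E" and nz: "\<not> (AE x in lebesgue. u x = 0)"
  shows "\<exists>t>0. J' (\<lambda>x. t * u x) u = 0"
proof -
  have pos: "0 < nrm u" by (rule nrm_pos[OF u nz])
  obtain T where T: "T > 0" "J (\<lambda>x. T * u x) < 0" using fibre_negative[OF u nz] by blast
  have J0: "J (\<lambda>x. 0 * u x) = 0"
    using J_eq[OF E_scale[OF u, of 0]] nrm_scale[OF u, of 0] by (simp add: \<Psi>_def G_0)
  obtain y where y: "0 < y" "y < T" "J (\<lambda>x. T * u x) - J (\<lambda>x. 0 * u x) = (T - 0) * J' (\<lambda>x. y * u x) u"
    using MVT2[OF T(1), of "\<lambda>t. J (\<lambda>x. t * u x)" "\<lambda>t. J' (\<lambda>x. t * u x) u"] fibre_derivative[OF u] by auto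
  have neg: "J' (\<lambda>x. y * u x) u < 0"
  proof (rule ccontr)
    assume "\<not> ?thesis"
    then have "0 \<le> (T - 0) * J' (\<lambda>x. y * u x) u" using T by (intro mult_nonneg_nonneg) auto
    then show False using y(3) J0 T(2) by linarith
  qed
  obtain \<rho> where \<rho>: "\<rho> > 0" "\<And>w. w \<in> E \<Longrightarrow> 0 < nrm w \<Longrightarrow> nrm w \<le> \<rho> \<Longrightarrow> 0 < J' w w"
    using J'_positive_near_0 by blast
  define s where "s = min (y / 2) (\<rho> / nrm u)"
  have s: "0 < s" "s < y" using y(1) \<rho>(1) pos by (auto simp: s_def min_less_iff_disj)
  have "s * nrm u \<le> \<rho>" using pos by (simp add: s_def pos_le_divide_eq[symmetric])
  then have "0 < J' (\<lambda>x. s * u x) (\<lambda>x. s * u x)"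
    using \<rho>(2)[OF E_scale[OF u, of s]] nrm_scale[OF u, of s] s pos by simp
  then have p: "0 < J' (\<lambda>x. s * u x) u"
    unfolding J'_scale[OF E_scale[OF u] u] using s by (simp add: zero_less_mult_iff)
  have c: "continuous_on {s..y} (\<lambda>t. J' (\<lambda>x. t * u x) u)"
    using J'_line_continuous[OF u u u, of "{s..y}" 0] by simp
  obtain t where "s \<le> t" "t \<le> y" "J' (\<lambda>x. t * u x) u = 0"
    using IVT2'[OF _ _ _ c, of 0] p neg s by auto
  then show ?thesis using s by (intro exI[of _ t]) auto
qed

lemma fibre_nehari:
  assumes u: "u \<in> E" and nz: "\<not> (AE x in lebesgue. u x = 0)" and t: "t > 0" "J' (\<lambda>x. t * u x) u = 0"
  shows "(\<lambda>x. t * u x) \<in> \<N>"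
  unfolding nehari_iff J'_scale[OF E_scale[OF u] u] using E_scale[OF u] nz t by simp

text \<open>Subtract \<open>1 / q\<close> times the Nehari identity from the energy.\<close>

lemma nehari_coercive: assumes "u \<in> \<N>" shows "(1 / 2 - 1 / q) * (nrm u)\<^sup>2 \<le> J u"
proof -
  have u: "u \<in> E" and z: "J' u u = 0" using assms by (auto simp: nehari_iff)
  have "\<Psi> u \<le> (LINT x|lebesgue. (1 / q) * (g x (u x) * u x))"
    unfolding \<Psi>_def
  proof (rule integral_mono[OF G_integrable[OF u]])
    show "integrable lebesgue (\<lambda>x. (1 / q) * (g x (u x) * u x))" using g_integrable[OF u u] by simp
    show "G x (u x) \<le> (1 / q) * (g x (u x) * u x)" for x
      using Ambrosetti_Rabinowitz[of x "u x"] exponents by (simp add: pos_le_divide_eq mult.commute)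
  qed
  also have "\<dots> = (1 / q) * (nrm u)\<^sup>2" using z by (simp add: N_def[symmetric] J'_def B_self)
  finally show ?thesis using J_eq[OF u] by (simp add: algebra_simps)
qed

section \<open>Minimisation on the Nehari manifold\<close>

text \<open>Along a minimising sequence the nonlinear terms converge, while the norm may drop in the limit. Evaluating
  the energy at the multiple \<open>t\<close> of the sequence that puts the limit on the Nehari manifold does not exceed its values,
  because these are maxima on their rays.\<close>

lemma nehari_minimiser: "\<exists>u\<in>\<N>. \<forall>v\<in>\<N>. J u \<le> J v"
proof -
  have q2: "0 < 1 / 2 - 1 / q" using exponents by (simp add: field_simps)
  obtain e where e: "e \<in> E" "\<not> (AE x in lebesgue. e x = 0)" using E_nontrivial by blast
  have ne: "\<N> \<noteq> {}" using fibre_zero[OF e] fibre_nehari[OF e] by blast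
  have bdd: "bdd_below (J ` \<N>)"
  proof (rule bdd_belowI[of _ 0])
    fix y assume "y \<in> J ` \<N>"
    then obtain v where "v \<in> \<N>" "y = J v" by blast
    moreover have "0 \<le> (1 / 2 - 1 / q) * (nrm v)\<^sup>2" using q2 by simp
    ultimately show "0 \<le> y" using nehari_coercive[of v] by linarith
  qed
  define c where "c = Inf (J ` \<N>)"
  have cle: "c \<le> J v" if "v \<in> \<N>" for v unfolding c_def using that bdd by (intro cInf_lower) auto
  have "\<exists>u\<in>\<N>. J u < c + 1 / real (Suc n)" for n
  proof -
    have "Inf (J ` \<N>) < c + 1 / real (Suc n)" by (simp add: c_def)
    then show ?thesis using cInf_lessD[of "J ` \<N>"] ne by blast
  qed
  then obtain u where uN: "\<And>n. u n \<in> \<N>" and uc: "\<And>n. J (u n) < c + 1 / real (Suc n)" by metis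
  have uE: "u n \<in> E" and uz: "\<not> (AE x in lebesgue. u n x = 0)" and u0: "J' (u n) (u n) = 0" for n
    using uN[of n] by (auto simp: nehari_iff)
  have upos: "0 < nrm (u n)" for n by (rule nrm_pos[OF uE uz])
  have Jl: "(\<lambda>n. J (u n)) \<longlonglongrightarrow> c"
  proof (rule tendsto_sandwich[OF always_eventually always_eventually tendsto_const])
    show "\<forall>n. c \<le> J (u n)" "\<forall>n. J (u n) \<le> c + 1 / real (Suc n)" using cle uN uc by (auto intro: less_imp_le)
    have "(\<lambda>n. c + 1 / real (Suc n)) \<longlonglongrightarrow> c + 0" by (intro tendsto_intros lim_1_over_n[THEN LIMSEQ_Suc])
    then show "(\<lambda>n. c + 1 / real (Suc n)) \<longlonglongrightarrow> c" by simp
  qed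
  have nb: "nrm (u n) \<le> sqrt ((c + 1) / (1 / 2 - 1 / q))" for n
  proof (rule real_le_rsqrt)
    have "1 / real (Suc n) \<le> 1" by simp
    then have "(1 / 2 - 1 / q) * (nrm (u n))\<^sup>2 \<le> c + 1" using nehari_coercive[OF uN[of n]] uc[of n] by linarith
    then show "(nrm (u n))\<^sup>2 \<le> (c + 1) / (1 / 2 - 1 / q)" using q2 by (simp add: pos_le_divide_eq mult.commute)
  qed
  obtain r v L k where r: "strict_mono (r :: nat \<Rightarrow> nat)" and v: "v \<in> E" and ul: "AE x in lebesgue. (\<lambda>n. u (r n) x) \<longlonglongrightarrow> v x"
    and k: "integrable lebesgue k" and uk: "\<And>n. AE x in lebesgue. (u (r n) x)\<^sup>2 + \<bar>u (r n) x\<bar> powr p \<le> k x"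
    and nl: "(\<lambda>n. nrm (u (r n))) \<longlonglongrightarrow> L" and vL: "nrm v \<le> L"
    by (rule bounded_sequence_compact[where u=u, OF p_bounds uE nb]) (rule that; assumption)
  have mk: "AE x in lebesgue. m (u (r n) x) \<le> k x" for n using uk[of n] by (simp add: m_def)
  obtain \<rho> where \<rho>: "\<rho> > 0" "\<And>w. w \<in> E \<Longrightarrow> 0 < nrm w \<Longrightarrow> nrm w \<le> \<rho> \<Longrightarrow> 0 < J' w w"
    using J'_positive_near_0 by blast
  \<comment> \<open>the Nehari manifold avoids a ball around \<open>0\<close>, which keeps the limit away from \<open>0\<close>\<close>
  have "\<rho> \<le> nrm (u n)" for n using \<rho>(2)[OF uE upos, of n] u0[of n] by force
  then have "\<rho> \<le> L" by (intro LIMSEQ_le_const[OF nl]) auto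
  have "(\<lambda>n. N (u (r n)) (u (r n))) \<longlonglongrightarrow> N v v"
    unfolding N_def by (rule g_dominated_convergence[OF E_D(4)[OF uE] E_D(4)[OF uE] E_D(4)[OF v] E_D(4)[OF v] ul ul k mk mk])
  moreover have "N (u (r n)) (u (r n)) = (nrm (u (r n)))\<^sup>2" for n using u0[of "r n"] by (simp add: J'_def B_self)
  ultimately have "(\<lambda>n. (nrm (u (r n)))\<^sup>2) \<longlonglongrightarrow> N v v" by simp
  moreover have "(\<lambda>n. (nrm (u (r n)))\<^sup>2) \<longlonglongrightarrow> L\<^sup>2" by (intro tendsto_intros nl)
  ultimately have "N v v = L\<^sup>2" by (rule LIMSEQ_unique)
  then have "N v v \<noteq> 0" using \<open>\<rho> \<le> L\<close> \<rho>(1) by simp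
  then have vz: "\<not> (AE x in lebesgue. v x = 0)" using N_AE_0(1)[OF v v] by blast
  obtain t where t: "t > 0" "J' (\<lambda>x. t * v x) v = 0" using fibre_zero[OF v vz] by blast
  have tN: "(\<lambda>x. t * v x) \<in> \<N>" by (rule fibre_nehari[OF v vz t])
  have "(\<lambda>n. J (\<lambda>x. t * u (r n) x)) \<longlonglongrightarrow> (1 / 2) * (t\<^sup>2 * L\<^sup>2) - \<Psi> (\<lambda>x. t * v x)"
  proof -
    have "(\<lambda>n. \<Psi> (\<lambda>x. t * u (r n) x)) \<longlonglongrightarrow> \<Psi> (\<lambda>x. t * v x)"
      unfolding \<Psi>_def
    proof (rule G_dominated_convergence[where k="\<lambda>x. (t\<^sup>2 + \<bar>t\<bar> powr p) * k x"])
      show "(\<lambda>x. t * u (r n) x) \<in> borel_measurable lebesgue" for n by (rule E_D(4)[OF E_scale[OF uE]])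
      show "(\<lambda>x. t * v x) \<in> borel_measurable lebesgue" by (rule E_D(4)[OF E_scale[OF v]])
      show "AE x in lebesgue. (\<lambda>n. t * u (r n) x) \<longlonglongrightarrow> t * v x" using ul by eventually_elim (intro tendsto_intros)
      show "integrable lebesgue (\<lambda>x. (t\<^sup>2 + \<bar>t\<bar> powr p) * k x)" using k by simp
      show "AE x in lebesgue. m (t * u (r n) x) \<le> (t\<^sup>2 + \<bar>t\<bar> powr p) * k x" for n
        using mk[of n]
      proof eventually_elim
        case (elim x)
        have "m (t * u (r n) x) \<le> (t\<^sup>2 + \<bar>t\<bar> powr p) * m (u (r n) x)" by (rule m_scale)
        also have "\<dots> \<le> (t\<^sup>2 + \<bar>t\<bar> powr p) * k x" using elim by (intro mult_left_mono) auto
        finally show ?case .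
      qed
    qed
    then have "(\<lambda>n. (1 / 2) * (t\<^sup>2 * (nrm (u (r n)))\<^sup>2) - \<Psi> (\<lambda>x. t * u (r n) x)) \<longlonglongrightarrow> (1 / 2) * (t\<^sup>2 * L\<^sup>2) - \<Psi> (\<lambda>x. t * v x)"
      by (intro tendsto_diff tendsto_mult tendsto_const tendsto_power nl)
    moreover have "J (\<lambda>x. t * u (r n) x) = (1 / 2) * (t\<^sup>2 * (nrm (u (r n)))\<^sup>2) - \<Psi> (\<lambda>x. t * u (r n) x)" for n
      using J_eq[OF E_scale[OF uE[of "r n"], of t]] nrm_scale[OF uE[of "r n"], of t] by (simp add: power_mult_distrib)
    ultimately show ?thesis by simp
  qed
  moreover have "(\<lambda>n. J (u (r n))) \<longlonglongrightarrow> c" using LIMSEQ_subseq_LIMSEQ[OF Jl r] by (simp add: o_def)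
  moreover have "J (\<lambda>x. t * u (r n) x) \<le> J (u (r n))" for n
    using fibre_maximum[OF uE upos, of 1 "r n" t] u0[of "r n"] t(1) by simp
  ultimately have "(1 / 2) * (t\<^sup>2 * L\<^sup>2) - \<Psi> (\<lambda>x. t * v x) \<le> c"
    by (intro LIMSEQ_le[where X="\<lambda>n. J (\<lambda>x. t * u (r n) x)" and Y="\<lambda>n. J (u (r n))"]) auto
  \<comment> \<open>only the norm can be lost in the limit, and that lowers the energy\<close>
  moreover have "J (\<lambda>x. t * v x) \<le> (1 / 2) * (t\<^sup>2 * L\<^sup>2) - \<Psi> (\<lambda>x. t * v x)"
  proof -
    have "(nrm (\<lambda>x. t * v x))\<^sup>2 = t\<^sup>2 * (nrm v)\<^sup>2" using nrm_scale[OF v, of t] by (simp add: power_mult_distrib)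
    also have "\<dots> \<le> t\<^sup>2 * L\<^sup>2" using vL by (intro mult_left_mono power_mono) auto
    finally show ?thesis using J_eq[OF E_scale[OF v, of t]] by simp
  qed
  ultimately have "J (\<lambda>x. t * v x) \<le> c" by linarith
  then show ?thesis using tN cle by (meson order_trans)
qed

text \<open>If the derivative at a minimiser were negative in a direction \<open>z\<close>, then moving a little in
  that direction lowers the energy on a whole piece of the fibre; since the Nehari functional
  changes sign along this piece, the displaced piece meets the Nehari manifold below the
  minimum.\<close>

lemma minimiser_derivative_nonneg:
  assumes w: "w \<in> \<N>" and min: "\<And>v. v \<in> \<N> \<Longrightarrow> J w \<le> J v" and z: "z \<in> E"
  shows "0 \<le> J' w z"
proof (rule ccontr)
  assume neg: "\<not> 0 \<le> J' w z"
  have wE: "w \<in> E" and wz: "\<not> (AE x in lebesgue. w x = 0)" and w0: "J' w w = 0" using w by (auto simp: nehari_iff)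
  have pos: "0 < nrm w" by (rule nrm_pos[OF wE wz])
  let ?y = "\<lambda>t s x. t * w x + s * z x"
  have yE: "?y t s \<in> E" for t s by (rule E_linear[OF wE z])
  have lim: "(\<lambda>n. J' (?y (t n) (s n)) v) \<longlonglongrightarrow> J' (?y t0 s0) v" if "t \<longlonglongrightarrow> t0" "s \<longlonglongrightarrow> s0" "v \<in> E" for t s t0 s0 v
    by (rule J'_tendsto[OF wE z that(3,1,2)])
  \<comment> \<open>by continuity the derivative in direction \<open>z\<close> stays negative near \<open>w\<close>; the shift by two makes the radius less than \<open>1\<close>\<close>
  have "\<exists>n. \<forall>t s. \<bar>t - 1\<bar> \<le> 1 / real (Suc (Suc n)) \<and> \<bar>s\<bar> \<le> 1 / real (Suc (Suc n)) \<longrightarrow> J' (?y t s) z < 0"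
  proof (rule ccontr)
    assume "\<not> ?thesis"
    then have "\<forall>n. \<exists>t s. \<bar>t - 1\<bar> \<le> 1 / real (Suc (Suc n)) \<and> \<bar>s\<bar> \<le> 1 / real (Suc (Suc n)) \<and> 0 \<le> J' (?y t s) z"
      by (meson not_less)
    then obtain t s where ts: "\<And>n. \<bar>t n - 1\<bar> \<le> 1 / real (Suc (Suc n))" "\<And>n. \<bar>s n\<bar> \<le> 1 / real (Suc (Suc n))" "\<And>n. 0 \<le> J' (?y (t n) (s n)) z"
      by metis
    have l: "(\<lambda>n. 1 / real (Suc (Suc n))) \<longlonglongrightarrow> 0" using lim_1_over_n[THEN LIMSEQ_Suc, THEN LIMSEQ_Suc] .
    have "(\<lambda>n. \<bar>t n - 1\<bar>) \<longlonglongrightarrow> 0" by (rule tendsto_0_le[OF _ ts(1) l]) simp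
    then have tl: "t \<longlonglongrightarrow> 1" by (simp add: tendsto_rabs_zero_iff LIM_zero_iff)
    have "(\<lambda>n. \<bar>s n\<bar>) \<longlonglongrightarrow> 0" by (rule tendsto_0_le[OF _ ts(2) l]) simp
    then have sl: "s \<longlonglongrightarrow> 0" by (simp add: tendsto_rabs_zero_iff)
    have "0 \<le> J' (?y 1 0) z" using lim[OF tl sl z] ts(3) by (intro LIMSEQ_le_const) auto
    then show False using neg by simp
  qed
  then obtain n0 where n0: "\<And>t s. \<bar>t - 1\<bar> \<le> 1 / real (Suc (Suc n0)) \<Longrightarrow> \<bar>s\<bar> \<le> 1 / real (Suc (Suc n0)) \<Longrightarrow> J' (?y t s) z < 0"
    by blast
  define \<eta> where "\<eta> = 1 / real (Suc (Suc n0))"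
  have \<eta>: "0 < \<eta>" "\<eta> < 1" by (auto simp: \<eta>_def)
  define D where "D = (\<lambda>t s. J' (?y t s) (?y t s))"
  have D: "D t s = t * J' (?y t s) w + s * J' (?y t s) z" for t s
    unfolding D_def by (rule J'_linear[OF yE wE z])
  have z1: "J' (\<lambda>x. 1 * w x) w = 0" using w0 by simp
  note sg = fibre_sign[OF wE pos zero_less_one z1]
  have D1: "0 < D (1 - \<eta>) 0" using sg(1)[of "1 - \<eta>"] \<eta> by (simp add: D)
  have D2: "D (1 + \<eta>) 0 < 0" using sg(2)[of "1 + \<eta>"] \<eta> by (simp add: D mult_pos_neg)
  have sl: "(\<lambda>n. \<eta> / real (Suc n)) \<longlonglongrightarrow> 0" by (rule LIMSEQ_Suc[OF lim_const_over_n])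
  have Dl: "(\<lambda>n. D t (\<eta> / real (Suc n))) \<longlonglongrightarrow> D t 0" for t
    unfolding D by (intro tendsto_add tendsto_mult tendsto_const sl lim wE z)
  have "eventually (\<lambda>n. 0 < D (1 - \<eta>) (\<eta> / real (Suc n)) \<and> D (1 + \<eta>) (\<eta> / real (Suc n)) < 0) sequentially"
    by (intro eventually_conj order_tendstoD(1)[OF Dl D1] order_tendstoD(2)[OF Dl D2])
  then obtain n where n: "0 < D (1 - \<eta>) (\<eta> / real (Suc n))" "D (1 + \<eta>) (\<eta> / real (Suc n)) < 0"
    by (auto simp: eventually_sequentially)
  define s where "s = \<eta> / real (Suc n)"
  have s: "0 < s" "s \<le> \<eta>" using \<eta> by (auto simp: s_def divide_le_eq_1 field_simps)
  have c: "continuous_on {1 - \<eta>..1 + \<eta>} (\<lambda>t. D t s)"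
    unfolding D by (intro continuous_on_add continuous_on_mult continuous_on_id continuous_on_const J'_line_continuous wE z)
  obtain t where t: "1 - \<eta> \<le> t" "t \<le> 1 + \<eta>" "D t s = 0"
    using IVT2'[OF _ _ _ c, of 0] n \<eta> by (auto simp: s_def)
  have t0: "0 < t" using t \<eta> by linarith
  have tb: "\<bar>t - 1\<bar> \<le> 1 / real (Suc (Suc n0))" using t unfolding \<eta>_def[symmetric] by linarith
  \<comment> \<open>otherwise \<open>z\<close> would be a multiple of \<open>w\<close>, and the derivative vanishes in the direction \<open>w\<close>\<close>
  have "\<not> (AE x in lebesgue. ?y t s x = 0)"
  proof
    assume ae: "AE x in lebesgue. ?y t s x = 0"
    have "B w (?y t s) = 0" using B_bound[OF wE yE, of t s] nrm_AE_0[OF yE ae] by simp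
    then have "J' w (?y t s) = 0" using N_AE_0(1)[OF wE yE ae] by (simp add: J'_def)
    then have "s * J' w z = 0" using J'_linear[OF wE wE z, of t s] w0 by simp
    then show False using s neg by simp
  qed
  then have yN: "?y t s \<in> \<N>" using yE t(3) by (simp add: nehari_iff D_def)
  obtain y where y: "0 < y" "y < s" "J (\<lambda>x. t * w x + s * z x) - J (\<lambda>x. t * w x + 0 * z x) = (s - 0) * J' (\<lambda>x. t * w x + y * z x) z"
    using MVT2[OF s(1), of "\<lambda>s. J (\<lambda>x. t * w x + s * z x)" "\<lambda>s. J' (\<lambda>x. t * w x + s * z x) z"]
      J_line_derivative[OF E_scale[OF wE, of t] z] by auto
  have "J' (?y t y) z < 0" 
  proof (rule n0[OF tb])
    show "\<bar>y\<bar> \<le> 1 / real (Suc (Suc n0))" using y s unfolding \<eta>_def[symmetric] by linarith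
  qed
  then have "(s - 0) * J' (\<lambda>x. t * w x + y * z x) z < 0" using s by (intro mult_pos_neg) auto
  then have "J (?y t s) < J (\<lambda>x. t * w x)" using y(3) by simp
  also have "\<dots> \<le> J w" using fibre_maximum[OF wE pos zero_less_one z1 t0] by simp
  finally show False using min[OF yN] by simp
qed

theorem ground_state_exists: "\<exists>u. ground_state \<alpha> V f \<Gamma> q u"
proof -
  obtain w where w: "w \<in> \<N>" and min: "\<And>v. v \<in> \<N> \<Longrightarrow> J w \<le> J v" using nehari_minimiser by blast
  have wE: "w \<in> E" and wz: "\<not> (AE x in lebesgue. w x = 0)" using w by (auto simp: nehari_iff)
  have J0: "J' w z = 0" if z: "z \<in> E" for z
    using minimiser_derivative_nonneg[OF w min z] minimiser_derivative_nonneg[OF w min E_scale[OF z, of "-1"]]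
      J'_scale[OF wE z, of "-1"] by simp
  have "has_energy_derivative \<alpha> V J w (\<lambda>v. 0)"
    using J_Frechet[OF wE] J0 unfolding has_energy_derivative_def by simp
  moreover have "ereal (J w) = (INF v\<in>\<N>. ereal (J v))"
    by (intro antisym INF_greatest INF_lower2[OF w]) (use min in auto)
  ultimately show ?thesis using wE wz unfolding ground_state_def by blast
qed

end

theorem theorem1p3:
  fixes \<alpha> q :: real
    and V \<Gamma> :: "real ^ 'n::finite \<Rightarrow> real"
    and f :: "real ^ 'n \<Rightarrow> real \<Rightarrow> real"
  assumes "0 < \<alpha>" and "\<alpha> \<le> 2" and "\<alpha> < real CARD('n)"
    and "cond_V V"
    and "cond_Gamma \<Gamma>"
    and "cond_F1 \<alpha> q f"
    and "cond_F2 f"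
    and "cond_F3 q f"
    and "cond_F4 q f"
  shows "\<exists>u. ground_state \<alpha> V f \<Gamma> q u"
proof -
  obtain c p where "c > 0" "2 < q" "q < p" "p < 2 * real CARD('n) / (real CARD('n) - \<alpha>)"
    "\<And>x u. \<bar>f x u\<bar> \<le> c * (1 + \<bar>u\<bar> powr (p - 1))"
    using assms(6) unfolding cond_F1_def by blast
  then interpret nehari_problem \<alpha> V q p c \<Gamma> f
    using assms by unfold_locales (auto simp: cond_F1_def)
  show ?thesis by (rule ground_state_exists)
qed

end
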